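(* Let $\gamma\in\mathcal{M}$ and $\lambda\in\mathbb{C}\setminus\mathbb{R}$ be such that the monodromy matrix $\tilde A_\lambda$ has two fixed points on the sphere at infinity of hyperbolic space, with corresponding maps $S_\pm\colon M\to S^2$. Then the two curves $\eta_\pm\colon M\to\mathbb{R}^3$ given by $$\eta_\pm=\gamma+\frac{\operatorname{Im}(\lambda)}{|\lambda|^2}S_\pm$$ are Darboux transforms of $\gamma$ having the same monodromy as $\gamma$, that is $\eta_\pm\in\mathcal{M}$. In particular, $\eta_\pm$ have constant distance to $\gamma$ and induce the same arclength on $M$ as $\gamma$. All Hamiltonians $E_k$, $k\ge-2$, satisfy $E_k(\eta_\pm)=E_k(\gamma)$.
   Context: Let $M\cong\mathbb{R}$ be an oriented 1-manifold with a fixed translation $\tau\in\mathrm{Diff}(M)$, $M/\tau\cong S^1$, base point $x_0\in M$, and $I$ the fundamental domain from $x_0$ to $\tau(x_0)$. Identify $\mathbb{R}^3$ with $\mathfrak{su}_2$ by $p\mapsto -i\sum_jp_j\sigma_j$ ($\sigma_j$ the Pauli matrices), so unit vectors satisfy $p^2=-\mathbf{1}$. Fix $A\in SU_2$, $a\in\mathbb{R}^3$; $\mathcal{M}$ is the space of smooth immersions $\gamma\colon M\to\mathbb{R}^3$ with $\gamma\circ\tau=h\circ\gamma$, where $h(p)=ApA^{-1}+a$. Let $dx$ be arclength, $(\ )'$ the arclength derivative, $T=\gamma'$. For $\lambda\in\mathbb{C}$ let $F_\lambda\colon M\to SL_2(\mathbb{C})$ solve $F_\lambda'=F_\lambda\,\lambda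 T$, $F_\lambda(x_0)=\mathbf{1}$, and set $\tilde A_\lambda=F_\lambda(\tau(x_0))A$; moving the base point to $x$ gives $\tilde A_\lambda(x)=F_\lambda(x)^{-1}\tilde A_\lambda F_\lambda(x)$. $SL_2(\mathbb{C})$ acts on $H^3=\{p \text{ Hermitian } 2\times2,\ \det p=1,\ \operatorname{tr}p>0\}$ by $p\mapsto BpB^*$. The fixed points of $\tilde A_\lambda(x)$ at infinity correspond to its eigenlines $\mathbb{C}w_\pm(x)$, $w_\pm(x)=F_\lambda(x)^{-1}w_\pm(x_0)$. Under stereographic projection $\pi(p)=i\,\frac{(\operatorname{tr}p)\mathbf{1}-2p}{2+\operatorname{tr}p}$, extended to infinity, they become the unit vectors $$S_\pm(x)=i\Big(\mathbf{1}-2\,\frac{w_\pm(x)w_\pm(x)^*}{|w_\pm(x)|^2}\Big)\in S^2\subset\mathfrak{su}_2=\mathbb{R}^3 .$$ Darboux transform: a curve $\eta$ is a Darboux transform of $\gamma$ if $|\eta-\gamma|$ is a nonzero constant and $\eta'$ (derivative with respect to arclength of $\gamma$) is obtained from $\gamma'$ by rotation about the direction $\eta-\gamma$ through a constant angle. Hamiltonians: let $v$ be a unit vector spanning the axis of $h$, with the origin of $\mathbb{R}^3$ chosen on this axis, so that the linear part of $h$ fixes $v$ and $a\in\mathbb{R}v$. Then $E_{-2}=\frac12\int_I|\gamma-(\gamma,v)v|^2(d\gamma,v)$ (invariance is insensitive to its sign), $E_{-1}=\frac12\int_I(\gamma\times d\gamma,v)$, $E_0=0$, $E_1=\int_Idx$,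 $E_2=\int_I(\nu',T\times\nu)dx$ modulo $2\pi$ for any unit normal field $\nu$ with $\nu\circ\tau=A\nu A^{-1}$. With $Y_0=T$, $Y_{k+1}=T\times Y_k'-\frac12\sum_{i=1}^k(Y_i,Y_{k-i+1})T$, for $k\ge3$ the functional $E_k$ is the coefficient of $\lambda^{-k}$ in $$\tfrac12\lambda^{-2}\int_I\sum_{i\ge1,j\ge0}(Y_i,Y_1)\lambda^{-i}(-1)^j\Big(\sum_{l\ge2}\tfrac12(T,Y_l)\lambda^{-l}\Big)^jdx .$$ Here $\times$ is the Euclidean cross product. *)

theory Defs
  imports
    "HOL-Analysis.Analysis"
    "HOL-Computational_Algebra.Formal_Power_Series"
    "HOL-Library.Real_Mod"
begin

type_synonym R3 = "real ^ 3"
type_synonym mat2 = "complex ^ 2 ^ 2"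

definition sigma1 :: mat2 where "sigma1 = vector [vector [0, 1], vector [1, 0]]"
definition sigma2 :: mat2 where "sigma2 = vector [vector [0, - \<i>], vector [\<i>, 0]]"
definition sigma3 :: mat2 where "sigma3 = vector [vector [1, 0], vector [0, - 1]]"

text \<open>Scalar multiplication of a complex matrix; the library's \<open>*s\<close> only acts on rows.\<close>
definition cscale :: "complex \<Rightarrow> mat2 \<Rightarrow> mat2" (infixr "*\<^sub>C" 75) where
  "c *\<^sub>C X = map_matrix ((*) c) X"

definition su2_mat :: "R3 \<Rightarrow> mat2" where
  "su2_mat p = (- \<i>) *\<^sub>C (p $ 1 *\<^sub>R sigma1 + p $ 2 *\<^sub>R sigma2 + p $ 3 *\<^sub>R sigma3)"

text \<open>The inverse of \<^const>\<open>su2_mat\<close> on its range, since \<open>tr (\<sigma>\<^sub>j \<sigma>\<^sub>k) = 2 \<delta>\<^sub>j\<^sub>k\<close>.\<close>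
definition su2_vec :: "mat2 \<Rightarrow> R3" where
  "su2_vec X = vector [Re (\<i> / 2 * trace (sigma1 ** X)),
                       Re (\<i> / 2 * trace (sigma2 ** X)),
                       Re (\<i> / 2 * trace (sigma3 ** X))]"

lemma su2_vec_su2_mat: "su2_vec (su2_mat p) = p"
  by (simp add: su2_vec_def su2_mat_def cscale_def sigma1_def sigma2_def sigma3_def trace_def
      matrix_matrix_mult_def sum_2 vec_eq_iff forall_3)

definition conj_transpose :: "mat2 \<Rightarrow> mat2" where
  "conj_transpose B = (\<chi> i j. cnj (B $ j $ i))"

lemma su2_mat_su2_vec:
  assumes "conj_transpose X = - X" "trace X = 0"
  shows "su2_mat (su2_vec X) = X"
proof -
  have "cnj (X $ 1 $ 1) = - X $ 1 $ 1" "cnj (X $ 2 $ 1) = - X $ 1 $ 2"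
    using assms(1) by (auto simp: conj_transpose_def vec_eq_iff forall_2)
  moreover have "X $ 2 $ 2 = - X $ 1 $ 1"
    using assms(2) by (simp add: trace_def sum_2 add_eq_0_iff)
  ultimately show ?thesis
    by (simp add: su2_vec_def su2_mat_def cscale_def sigma1_def sigma2_def sigma3_def trace_def
        matrix_matrix_mult_def sum_2 vec_eq_iff forall_2 complex_eq_iff)
qed

definition SU2 :: "mat2 set" where
  "SU2 = {A. A ** conj_transpose A = mat 1 \<and> det A = 1}"

definition rot_part :: "mat2 \<Rightarrow> R3 \<Rightarrow> R3" where
  "rot_part A p = su2_vec (A ** su2_mat p ** matrix_inv A)"

lemma su2_mat_rot_part:
  assumes "A \<in> SU2"
  shows "su2_mat (rot_part A p) = A ** su2_mat p ** matrix_inv A"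
proof -
  let ?A' = "conj_transpose A"
  have r: "A ** ?A' = mat 1" using assms by (simp add: SU2_def)
  have l: "?A' ** A = mat 1" by (rule matrix_left_right_inverse1[OF r])
  have inv: "matrix_inv A = ?A'"
  proof -
    have "A ** matrix_inv A = mat 1 \<and> matrix_inv A ** A = mat 1"
      unfolding matrix_inv_def by (rule someI[of _ ?A']) (use l r in simp)
    then show ?thesis by (metis l matrix_mul_assoc matrix_mul_lid matrix_mul_rid)
  qed
  have ct: "conj_transpose (X ** Y) = conj_transpose Y ** conj_transpose X" for X Y
    by (simp add: conj_transpose_def matrix_matrix_mult_def vec_eq_iff mult.commute)
  have ct2: "conj_transpose ?A' = A"
    by (simp add: conj_transpose_def vec_eq_iff)
  have neg: "X ** (- Y) = - (X ** Y)" "(- X) ** Y = - (X ** Y)" for X Y :: mat2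
    by (simp_all add: matrix_matrix_mult_def vec_eq_iff sum_negf)
  have p: "conj_transpose (su2_mat p) = - su2_mat p" "trace (su2_mat p) = 0"
    by (simp_all add: conj_transpose_def su2_mat_def cscale_def sigma1_def sigma2_def sigma3_def
        vec_eq_iff forall_2 trace_def sum_2 complex_eq_iff)
  have "conj_transpose (A ** su2_mat p ** ?A') = - (A ** su2_mat p ** ?A')"
    by (simp add: ct ct2 p(1) matrix_mul_assoc neg)
  moreover have "trace (A ** su2_mat p ** ?A') = 0"
    by (metis trace_mul_sym matrix_mul_assoc l matrix_mul_lid p(2))
  ultimately show ?thesis by (simp add: rot_part_def inv su2_mat_su2_vec)
qed

definition rigid_motion :: "mat2 \<Rightarrow> R3 \<Rightarrow> R3 \<Rightarrow> R3" where
  "rigid_motion A a p = rot_part A p + a"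

definition smooth :: "(real \<Rightarrow> 'a::real_normed_vector) \<Rightarrow> bool" where
  "smooth f \<longleftrightarrow>
     (\<forall>k x. ((\<lambda>g t. vector_derivative g (at t)) ^^ k) f differentiable (at x))"

text \<open>The manifold \<open>M\<close> is the real line with its standard orientation, and \<open>\<tau>\<close> is a fixed-point-free
  diffeomorphism moving points in the positive direction, so that \<open>M / \<tau>\<close> is a circle and
  \<open>{x\<^sub>0..\<tau> x\<^sub>0}\<close> is a fundamental domain.\<close>
definition translation_diffeo :: "(real \<Rightarrow> real) \<Rightarrow> bool" where
  "translation_diffeo \<tau> \<longleftrightarrow> bij \<tau> \<and> smooth \<tau> \<and> smooth (inv \<tau>) \<and> (\<forall>x. x < \<tau> x)"

definition immersed_curves :: "(real \<Rightarrow> real) \<Rightarrow> mat2 \<Rightarrow> R3 \<Rightarrow> (real \<Rightarrow> R3) set" where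
  "immersed_curves \<tau> A a =
     {\<gamma>. smooth \<gamma> \<and> (\<forall>x. vector_derivative \<gamma> (at x) \<noteq> 0) \<and>
          \<gamma> \<circ> \<tau> = rigid_motion A a \<circ> \<gamma>}"

definition speed :: "(real \<Rightarrow> R3) \<Rightarrow> real \<Rightarrow> real" where
  "speed \<gamma> x = norm (vector_derivative \<gamma> (at x))"

definition arc_deriv :: "(real \<Rightarrow> R3) \<Rightarrow> (real \<Rightarrow> 'a::real_normed_vector) \<Rightarrow> real \<Rightarrow> 'a" where
  "arc_deriv \<gamma> f x = (1 / speed \<gamma> x) *\<^sub>R vector_derivative f (at x)"

definition tangent :: "(real \<Rightarrow> R3) \<Rightarrow> real \<Rightarrow> R3" where
  "tangent \<gamma> = arc_deriv \<gamma> \<gamma>"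

definition arc_integral :: "(real \<Rightarrow> real) \<Rightarrow> real \<Rightarrow> (real \<Rightarrow> R3) \<Rightarrow> (real \<Rightarrow> real) \<Rightarrow> real" where
  "arc_integral \<tau> x0 \<gamma> f = integral {x0..\<tau> x0} (\<lambda>x. f x * speed \<gamma> x)"

definition is_frame :: "(real \<Rightarrow> R3) \<Rightarrow> real \<Rightarrow> complex \<Rightarrow> (real \<Rightarrow> mat2) \<Rightarrow> bool" where
  "is_frame \<gamma> x0 \<mu> F \<longleftrightarrow> F x0 = mat 1 \<and>
     (\<forall>x. F differentiable (at x) \<and>
          arc_deriv \<gamma> F x = F x ** (\<mu> *\<^sub>C su2_mat (tangent \<gamma> x)))"

definition monodromy_matrix :: "(real \<Rightarrow> real) \<Rightarrow> mat2 \<Rightarrow> real \<Rightarrow> (real \<Rightarrow> mat2) \<Rightarrow> mat2" where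
  "monodromy_matrix \<tau> A x0 F = F (\<tau> x0) ** A"

text \<open>With hyperbolic space realised as the Hermitian matrices of determinant 1 and positive trace,
  its points at infinity are the rays of the future light cone.\<close>
definition light_cone :: "mat2 set" where
  "light_cone = {p. conj_transpose p = p \<and> det p = 0 \<and> Re (trace p) > 0}"

definition ray :: "mat2 \<Rightarrow> mat2 set" where
  "ray p = {c *\<^sub>R p |c. c > 0}"

definition sphere_at_infinity :: "mat2 set set" where
  "sphere_at_infinity = ray ` light_cone"

definition hyp_action :: "mat2 \<Rightarrow> mat2 \<Rightarrow> mat2" where
  "hyp_action B p = B ** p ** conj_transpose B"

definition fixed_points_at_infinity :: "mat2 \<Rightarrow> mat2 set set" where
  "fixed_points_at_infinity B = {P \<in> sphere_at_infinity. hyp_action B ` P = P}"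

definition outer :: "complex ^ 2 \<Rightarrow> mat2" where
  "outer w = (\<chi> i j. w $ i * cnj (w $ j))"

text \<open>The point at infinity corresponding to the complex line spanned by \<open>w\<close>.
  (For \<open>w = 0\<close> this is not a point of \<^const>\<open>sphere_at_infinity\<close>.)\<close>
definition ideal_point :: "complex ^ 2 \<Rightarrow> mat2 set" where
  "ideal_point w = ray (outer w)"

text \<open>Stereographic projection \<open>p \<mapsto> \<i> ((tr p) 1 - 2 p) / (2 + tr p)\<close> of hyperbolic space onto the
  unit ball extends to the ray of \<open>p\<close> in the light cone by \<open>\<i> (1 - 2 p / tr p)\<close>; for
  \<open>p = outer w\<close> one has \<open>tr p = |w|\<^sup>2\<close>.\<close>
definition ideal_direction :: "complex ^ 2 \<Rightarrow> R3" where
  "ideal_direction w = su2_vec (\<i> *\<^sub>C (mat 1 - (2 / (norm w)\<^sup>2) *\<^sub>R outer w))"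

lemma su2_mat_ideal_direction:
  assumes "w \<noteq> 0"
  shows "su2_mat (ideal_direction w) = \<i> *\<^sub>C (mat 1 - (2 / (norm w)\<^sup>2) *\<^sub>R outer w)"
proof -
  define n where "n = (norm w)\<^sup>2"
  define X where "X = \<i> *\<^sub>C (mat 1 - (2 / n) *\<^sub>R outer w)"
  have n0: "n \<noteq> 0" using assms by (simp add: n_def)
  have n: "complex_of_real n = w $ 1 * cnj (w $ 1) + w $ 2 * cnj (w $ 2)"
    by (simp add: n_def norm_vec_def L2_set_def sum_2 complex_norm_square del: of_real_power)
  have "conj_transpose X = - X"
    by (simp add: X_def conj_transpose_def cscale_def outer_def mat_def vec_eq_iff forall_2
        complex_eq_iff)
  moreover have "trace X = 0"
  proof -
    have "trace X = \<i> * (2 - of_real (2 / n) * (w $ 1 * cnj (w $ 1) + w $ 2 * cnj (w $ 2)))"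
      by (simp add: X_def cscale_def outer_def mat_def trace_def sum_2 complex_eq_iff
          algebra_simps add_divide_distrib)
    then show ?thesis using n0 by (simp add: n[symmetric])
  qed
  ultimately have "su2_mat (su2_vec X) = X" by (rule su2_mat_su2_vec)
  then show ?thesis by (simp add: ideal_direction_def X_def n_def)
qed

definition ideal_map :: "(real \<Rightarrow> mat2) \<Rightarrow> complex ^ 2 \<Rightarrow> real \<Rightarrow> R3" where
  "ideal_map F w x = ideal_direction (matrix_inv (F x) *v w)"

text \<open>Rodrigues' formula; \<open>u\<close> is a unit vector.\<close>
definition rotation_about :: "R3 \<Rightarrow> real \<Rightarrow> R3 \<Rightarrow> R3" where
  "rotation_about u \<theta> p =
     cos \<theta> *\<^sub>R p + sin \<theta> *\<^sub>R cross3 u p + ((1 - cos \<theta>) * (u \<bullet> p)) *\<^sub>R u"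

definition darboux_transform :: "(real \<Rightarrow> R3) \<Rightarrow> (real \<Rightarrow> R3) \<Rightarrow> bool" where
  "darboux_transform \<gamma> \<eta> \<longleftrightarrow>
     (\<exists>r \<theta>. r \<noteq> 0 \<and>
       (\<forall>x. norm (\<eta> x - \<gamma> x) = r \<and> \<eta> differentiable (at x) \<and>
            arc_deriv \<gamma> \<eta> x = rotation_about (sgn (\<eta> x - \<gamma> x)) \<theta> (tangent \<gamma> x)))"

text \<open>The line through \<open>b\<close> spanned by the unit vector \<open>v\<close> is an axis of the rigid motion.  In the
  next two functionals \<open>b\<close> serves as the origin, which has to lie on the axis.\<close>
definition is_axis :: "mat2 \<Rightarrow> R3 \<Rightarrow> R3 \<Rightarrow> R3 \<Rightarrow> bool" where
  "is_axis A a b v \<longleftrightarrow> norm v = 1 \<and> rot_part A v = v \<and>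
     (\<exists>c. rigid_motion A a b = b + c *\<^sub>R v)"

definition E_minus2 :: "(real \<Rightarrow> real) \<Rightarrow> real \<Rightarrow> R3 \<Rightarrow> R3 \<Rightarrow> (real \<Rightarrow> R3) \<Rightarrow> real" where
  "E_minus2 \<tau> x0 b v \<gamma> = 1/2 * integral {x0..\<tau> x0}
     (\<lambda>x. (norm ((\<gamma> x - b) - ((\<gamma> x - b) \<bullet> v) *\<^sub>R v))\<^sup>2 * (vector_derivative \<gamma> (at x) \<bullet> v))"

definition E_minus1 :: "(real \<Rightarrow> real) \<Rightarrow> real \<Rightarrow> R3 \<Rightarrow> R3 \<Rightarrow> (real \<Rightarrow> R3) \<Rightarrow> real" where
  "E_minus1 \<tau> x0 b v \<gamma> = 1/2 * integral {x0..\<tau> x0}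
     (\<lambda>x. cross3 (\<gamma> x - b) (vector_derivative \<gamma> (at x)) \<bullet> v)"

definition unit_normal_field :: "(real \<Rightarrow> real) \<Rightarrow> mat2 \<Rightarrow> (real \<Rightarrow> R3) \<Rightarrow> (real \<Rightarrow> R3) \<Rightarrow> bool" where
  "unit_normal_field \<tau> A \<gamma> \<nu> \<longleftrightarrow>
     smooth \<nu> \<and> (\<forall>x. norm (\<nu> x) = 1 \<and> \<nu> x \<bullet> tangent \<gamma> x = 0) \<and> \<nu> \<circ> \<tau> = rot_part A \<circ> \<nu>"

text \<open>The total torsion; only its class modulo \<open>2\<pi>\<close> is independent of the normal field \<open>\<nu>\<close>.\<close>
definition E_two :: "(real \<Rightarrow> real) \<Rightarrow> real \<Rightarrow> (real \<Rightarrow> R3) \<Rightarrow> (real \<Rightarrow> R3) \<Rightarrow> real" where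
  "E_two \<tau> x0 \<nu> \<gamma> = arc_integral \<tau> x0 \<gamma> (\<lambda>x. arc_deriv \<gamma> \<nu> x \<bullet> cross3 (tangent \<gamma> x) (\<nu> x))"

fun Y_field :: "(real \<Rightarrow> R3) \<Rightarrow> nat \<Rightarrow> real \<Rightarrow> R3" where
  "Y_field \<gamma> 0 = tangent \<gamma>"
| "Y_field \<gamma> (Suc k) = (\<lambda>x. cross3 (tangent \<gamma> x) (arc_deriv \<gamma> (Y_field \<gamma> k) x)
     - (1/2 * (\<Sum>i\<in>{1..k}. Y_field \<gamma> i x \<bullet> Y_field \<gamma> (k - i + 1) x)) *\<^sub>R tangent \<gamma> x)"

text \<open>Formal power series in \<open>\<lambda>\<^sup>-\<^sup>1\<close>.  The composition \<open>oo\<close> with \<open>\<Sum>\<^sub>j (-1)\<^sup>j X\<^sup>j\<close> is the geometric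
  series in the given series, whose constant term vanishes.\<close>
definition E_integrand :: "(real \<Rightarrow> R3) \<Rightarrow> real \<Rightarrow> real fps" where
  "E_integrand \<gamma> x =
     Abs_fps (\<lambda>i. if i \<ge> 1 then Y_field \<gamma> i x \<bullet> Y_field \<gamma> 1 x else 0) *
     (Abs_fps (\<lambda>j. (-1) ^ j) oo
      Abs_fps (\<lambda>l. if l \<ge> 2 then 1/2 * (tangent \<gamma> x \<bullet> Y_field \<gamma> l x) else 0))"

definition E_generating :: "(real \<Rightarrow> real) \<Rightarrow> real \<Rightarrow> (real \<Rightarrow> R3) \<Rightarrow> real fps" where
  "E_generating \<tau> x0 \<gamma> = fps_const (1/2) * fps_X\<^sup>2 *
     Abs_fps (\<lambda>n. arc_integral \<tau> x0 \<gamma> (\<lambda>x. fps_nth (E_integrand \<gamma> x) n))"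

text \<open>The functional of index \<open>k \<ge> 0\<close>, except for \<open>k = 2\<close>, which is \<^const>\<open>E_two\<close>.\<close>
definition E_nonneg :: "(real \<Rightarrow> real) \<Rightarrow> real \<Rightarrow> nat \<Rightarrow> (real \<Rightarrow> R3) \<Rightarrow> real" where
  "E_nonneg \<tau> x0 k \<gamma> =
     (if k = 0 then 0
      else if k = 1 then arc_integral \<tau> x0 \<gamma> (\<lambda>x. 1)
      else fps_nth (E_generating \<tau> x0 \<gamma>) k)"

end

theory Submission
  imports Defs
begin

text \<open>
  The spectral parameter enters through \<open>c + \<i> \<rho> = - 1 / \<mu>\<close>, so that \<open>\<rho> = Im \<mu> / |\<mu>|\<^sup>2\<close>.  An
  eigenline of the monodromy is transported by \<open>w' = - \<mu> \<gamma>' w\<close>, an infinitesimal Lorentz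
  transformation of the light-like vector \<open>w w\<^sup>*\<close>.  Its direction \<open>S\<close> therefore solves a Riccati
  equation driven by the velocity \<open>\<gamma>'\<close> (\<open>ideal_direction_derivative\<close>), and being an eigenline
  means \<open>S \<circ> \<tau> = A S A\<^sup>-\<^sup>1\<close> (\<open>ideal_map_properties\<close>).  Everything else is deduced from these two
  properties, which are the assumptions of the locale \<open>darboux_direction\<close>.

  For a unit field the Riccati equation amounts to the linear relation
  \<open>c S' + \<rho> S \<times> S' = 2 \<gamma>' \<times> S\<close> (\<open>riccati_linear_relation\<close>).  In quaternions it says \<open>(c + \<rho> S) \<eta>'
      = \<gamma>' (c + \<rho> S)\<close> for
  \<open>\<eta> = \<gamma> + \<rho> S\<close>: the velocity of \<open>\<eta>\<close> is that of \<open>\<gamma>\<close>, rotated about \<open>S\<close> through a constant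
  angle.

  A Hamiltonian is preserved because its two densities differ by the derivative of a periodic
  function (\<open>integral_eq_if_periodic_derivative\<close>).  For the area and the volume this function is
  a polynomial in \<open>\<gamma>\<close> and \<open>S\<close>.  For the total torsion, the rotation carries a normal field of
  \<open>\<gamma>\<close> to a normal field of \<open>\<eta>\<close> with the same torsion density (\<open>rotated_normal_torsion\<close>), and two
  normal fields of one curve differ by an angle that is periodic modulo \<open>2 \<pi>\<close>
  (\<open>E_two_normal_independent\<close>).

  The remaining Hamiltonians are treated with formal power series in \<open>z = 1 / \<lambda>\<close>.  The series
  \<open>Y = \<Sum> Y\<^sub>k z\<^sup>k\<close> is the unique unit field starting with the tangent \<open>T\<close> that is parallel for the
  connection with parameter \<open>\<lambda>\<close>, that is \<open>z Y' = - \<gamma>' \<times> Y\<close> (\<open>formal_parallel_Y_series\<close>,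
  \<open>formal_parallel_unique\<close>).  The quaternion \<open>2 z + c + \<rho> S\<close> is a gauge transformation between
  the connections of \<open>\<gamma>\<close> and \<open>\<eta>\<close>, hence conjugation by it carries the one field to the other
  (\<open>formal_parallel_gauged\<close>); it follows that the integrals of \<open>(T, Y\<^sub>k)\<close> are preserved
  (\<open>tangential_integral\<close>).  Finally the generating function of the Hamiltonians is the angle of
  the holonomy, whose derivative with respect to \<open>\<lambda>\<close> is the integral of \<open>(T, Y)\<close>.  This gives
  \<open>E\<^sub>k = - \<integral> (T, Y\<^sub>k\<^sub>-\<^sub>1) dx / (k - 2)\<close> for \<open>k \<ge> 3\<close> (\<open>arc_integral_E_integrand\<close>).
\<close>

unbundle cross3_syntax

section \<open>Rotations of Euclidean space\<close>

lemma matrix_inv_eqI: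
  fixes X Y :: mat2
  assumes "X ** Y = mat 1"
  shows "matrix_inv X = Y"
proof -
  have l: "Y ** X = mat 1" by (rule matrix_left_right_inverse1[OF assms])
  have "X ** matrix_inv X = mat 1 \<and> matrix_inv X ** X = mat 1"
    unfolding matrix_inv_def by (rule someI[of _ Y]) (use l assms in simp)
  then show ?thesis by (metis l matrix_mul_assoc matrix_mul_lid matrix_mul_rid)
qed

lemma SU2_matrix_inv:
  assumes "A \<in> SU2"
  shows "matrix_inv A = conj_transpose A" "A ** matrix_inv A = mat 1" "matrix_inv A ** A = mat 1"
  using assms matrix_inv_eqI[of A "conj_transpose A"]
    matrix_left_right_inverse1[of A "conj_transpose A"]
  by (auto simp: SU2_def)

lemma su2_mat_mult: "su2_mat p ** su2_mat q = su2_mat (p \<times> q) - mat (complex_of_real (p \<bullet> q))"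
  by (simp add: su2_mat_def cscale_def sigma1_def sigma2_def sigma3_def matrix_matrix_mult_def
      sum_2 vec_eq_iff forall_2 cross3_def inner_vec_def sum_3 mat_def complex_eq_iff algebra_simps)

lemma su2_vec_minus_mat [simp]: "su2_vec (X - mat (complex_of_real r)) = su2_vec X"
  by (simp add: su2_vec_def sigma1_def sigma2_def sigma3_def trace_def
      matrix_matrix_mult_def sum_2 mat_def vec_eq_iff forall_3)

lemma trace_su2_mat [simp]: "trace (su2_mat p) = 0"
  by (simp add: su2_mat_def cscale_def sigma1_def sigma2_def sigma3_def trace_def sum_2)

lemma su2_mat_inject: "su2_mat p = su2_mat q \<Longrightarrow> p = q"
  by (metis su2_vec_su2_mat)

lemma su2_mat_add: "su2_mat (p + q) = su2_mat p + su2_mat q"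
  and su2_mat_scaleR: "su2_mat (r *\<^sub>R p) = r *\<^sub>R su2_mat p"
  by (simp_all add: su2_mat_def cscale_def sigma1_def sigma2_def sigma3_def vec_eq_iff forall_2
      complex_eq_iff algebra_simps)

lemma matrix_add_rdistrib: "((X + Y) ** Z) = X ** Z + Y ** Z" for X Y Z :: mat2
  by (simp add: matrix_matrix_mult_def vec_eq_iff sum.distrib distrib_right)

lemma linear_rot_part:
  assumes "A \<in> SU2"
  shows "linear (rot_part A)"
proof (rule linearI)
  show "rot_part A (p + q) = rot_part A p + rot_part A q" for p q
    by (rule su2_mat_inject)
       (simp add: su2_mat_rot_part[OF assms] su2_mat_add matrix_add_ldistrib matrix_add_rdistrib)
  show "rot_part A (r *\<^sub>R p) = r *\<^sub>R rot_part A p" for r p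
    by (rule su2_mat_inject)
       (simp add: su2_mat_rot_part[OF assms] su2_mat_scaleR scalar_matrix_assoc matrix_scalar_ac)
qed

text \<open>Conjugation respects the matrix product, whose scalar and trace-free parts are the two
  products of Euclidean space.\<close>

lemma
  assumes "A \<in> SU2"
  shows inner_rot_part: "rot_part A p \<bullet> rot_part A q = p \<bullet> q"
    and cross_rot_part: "rot_part A p \<times> rot_part A q = rot_part A (p \<times> q)"
proof -
  let ?B = "matrix_inv A" and ?M = "A ** (su2_mat p ** su2_mat q) ** matrix_inv A"
  have 1: "su2_mat (rot_part A p) ** su2_mat (rot_part A q) = ?M"
    by (metis (no_types, lifting) su2_mat_rot_part[OF assms] SU2_matrix_inv(3)[OF assms]
        matrix_mul_assoc matrix_mul_lid)
  have m: "A ** mat c ** ?B = mat c" for c :: complex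
  proof -
    have "A ** mat c = mat c ** A"
      by (simp add: matrix_matrix_mult_def mat_def vec_eq_iff forall_2 sum_2)
    then show ?thesis
      by (metis SU2_matrix_inv(2)[OF assms] matrix_mul_assoc matrix_mul_rid)
  qed
  have 2: "?M = su2_mat (rot_part A (p \<times> q)) - mat (complex_of_real (p \<bullet> q))"
    using m[of "complex_of_real (p \<bullet> q)"]
    by (simp add: su2_mat_mult su2_mat_rot_part[OF assms] matrix_mul_lid)
       (simp add: matrix_matrix_mult_def vec_eq_iff forall_2 sum_2 algebra_simps)
  have 3: "su2_mat (rot_part A p \<times> rot_part A q) - mat (complex_of_real (rot_part A p \<bullet> rot_part A q))
    = su2_mat (rot_part A (p \<times> q)) - mat (complex_of_real (p \<bullet> q))" (is "?l = ?r")
    using 1 2 by (simp add: su2_mat_mult)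
  have "trace ?l = trace ?r" by (simp add: 3)
  then have "complex_of_real (rot_part A p \<bullet> rot_part A q) = complex_of_real (p \<bullet> q)"
    unfolding trace_sub trace_su2_mat by (simp add: trace_def mat_def sum_2)
  then show "rot_part A p \<bullet> rot_part A q = p \<bullet> q" using of_real_eq_iff by blast
  have "su2_vec ?l = su2_vec ?r" by (simp add: 3)
  then show "rot_part A p \<times> rot_part A q = rot_part A (p \<times> q)"
    by (simp add: su2_vec_su2_mat)
qed

section \<open>Smooth maps of a real variable\<close>

text \<open>The finite differentiability classes, which allow induction on the order.\<close>

fun Cdiff :: "nat \<Rightarrow> (real \<Rightarrow> 'a::real_normed_vector) \<Rightarrow> bool" where
  "Cdiff 0 f \<longleftrightarrow> True"
| "Cdiff (Suc n) f \<longleftrightarrow> (\<forall>x. f differentiable (at x)) \<and> Cdiff n (\<lambda>x. vector_derivative f (at x))"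

lemma smooth_iff_Cdiff: "smooth f \<longleftrightarrow> (\<forall>n. Cdiff n f)"
proof -
  let ?D = "\<lambda>g t. vector_derivative g (at t)"
  have *: "Cdiff n f \<longleftrightarrow> (\<forall>k<n. \<forall>x. (?D ^^ k) f differentiable (at x))" for n and f :: "real \<Rightarrow> 'a"
  proof (induction n arbitrary: f)
    case (Suc n)
    have "(\<forall>k<Suc n. \<forall>x. (?D ^^ k) f differentiable (at x)) \<longleftrightarrow>
      (\<forall>x. f differentiable (at x)) \<and> (\<forall>k<n. \<forall>x. (?D ^^ k) (?D f) differentiable (at x))"
      by (simp add: All_less_Suc2 funpow_Suc_right del: funpow.simps)
    then show ?case by (simp add: Suc)
  qed simp
  show ?thesis unfolding smooth_def * by blast
qed

lemma Cdiff_SucI: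
  assumes "\<And>x. (f has_vector_derivative f' x) (at x)" "Cdiff n f'"
  shows "Cdiff (Suc n) f"
proof -
  have "(\<lambda>x. vector_derivative f (at x)) = f'"
    using assms(1) vector_derivative_at by blast
  then show ?thesis using assms by (auto intro: differentiableI_vector)
qed

lemma Cdiff_SucE:
  assumes "Cdiff (Suc n) f"
  obtains f' where "\<And>x. (f has_vector_derivative f' x) (at x)" "Cdiff n f'"
  using assms vector_derivative_works by (metis Cdiff.simps(2))

lemma Cdiff_Suc_imp: "Cdiff (Suc n) f \<Longrightarrow> Cdiff n f"
  by (induction n arbitrary: f) (auto elim!: Cdiff_SucE intro!: Cdiff_SucI)

lemma Cdiff_const: "Cdiff n (\<lambda>x. c)"
  by (induction n arbitrary: c) (auto intro: Cdiff_SucI[where f' = "\<lambda>_. 0"])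

lemma Cdiff_add: "Cdiff n f \<Longrightarrow> Cdiff n g \<Longrightarrow> Cdiff n (\<lambda>x. f x + g x)"
proof (induction n arbitrary: f g)
  case (Suc n)
  obtain f' g' where "\<And>x. (f has_vector_derivative f' x) (at x)" "Cdiff n f'"
    "\<And>x. (g has_vector_derivative g' x) (at x)" "Cdiff n g'"
    using Suc.prems by (meson Cdiff_SucE)
  then show ?case
    by (intro Cdiff_SucI[where f' = "\<lambda>x. f' x + g' x"] Suc.IH has_vector_derivative_add) 
qed simp

lemma Cdiff_bilinear:
  assumes "bounded_bilinear p" "Cdiff n f" "Cdiff n g"
  shows "Cdiff n (\<lambda>x. p (f x) (g x))"
  using assms(2,3)
proof (induction n arbitrary: f g)
  case (Suc n)
  obtain f' g' where *: "\<And>x. (f has_vector_derivative f' x) (at x)" "Cdiff n f'"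
    "\<And>x. (g has_vector_derivative g' x) (at x)" "Cdiff n g'"
    using Suc.prems by (meson Cdiff_SucE)
  moreover have "Cdiff n f" "Cdiff n g" using Suc.prems Cdiff_Suc_imp by blast+
  ultimately show ?case
    by (intro Cdiff_SucI[where f' = "\<lambda>x. p (f x) (g' x) + p (f' x) (g x)"] Cdiff_add Suc.IH
        bounded_bilinear.has_vector_derivative[OF assms(1)])
qed simp

lemmas Cdiff_scaleR = Cdiff_bilinear[OF bounded_bilinear_scaleR]
lemmas Cdiff_inner = Cdiff_bilinear[OF bounded_bilinear_inner]
lemmas Cdiff_mult = Cdiff_bilinear[OF bounded_bilinear_mult]

lemma bounded_bilinear_cross3: "bounded_bilinear cross3"
  using bilinear_cross bilinear_conv_bounded_bilinear by blast

lemmas Cdiff_cross = Cdiff_bilinear[OF bounded_bilinear_cross3]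

lemma Cdiff_diff:
  assumes "Cdiff n f" "Cdiff n g" shows "Cdiff n (\<lambda>x. f x - g x)"
proof -
  have "Cdiff n (\<lambda>x. f x + (-1) *\<^sub>R g x)"
    by (intro Cdiff_add assms Cdiff_scaleR Cdiff_const)
  then show ?thesis by simp
qed

lemma smooth_has_vector_derivative:
  "smooth f \<Longrightarrow> (f has_vector_derivative vector_derivative f (at x)) (at x)"
  by (metis Cdiff.simps(2) smooth_iff_Cdiff vector_derivative_works)

lemma smooth_vector_derivative: "smooth f \<Longrightarrow> smooth (\<lambda>x. vector_derivative f (at x))"
  by (metis Cdiff.simps(2) smooth_iff_Cdiff)

text \<open>A solution of a differential equation is as smooth as its right-hand side, so the order can be
  raised step by step.\<close>

lemma smooth_bootstrap:
  assumes "\<And>x. (f has_vector_derivative f' x) (at x)" "\<And>n. Cdiff n f \<Longrightarrow> Cdiff n f'"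
  shows "smooth f"
proof -
  have "Cdiff n f" for n
    by (induction n) (auto intro: Cdiff_SucI assms simp del: Cdiff.simps(2))
  then show ?thesis by (simp add: smooth_iff_Cdiff)
qed

lemma smooth_inverse_norm:
  fixes f :: "real \<Rightarrow> 'a::real_inner"
  assumes "smooth f" "\<And>x. f x \<noteq> 0"
  shows "smooth (\<lambda>x. 1 / norm (f x))"
proof -
  define f' where "f' = (\<lambda>x. vector_derivative f (at x))"
  let ?u = "\<lambda>x. 1 / norm (f x)"
  let ?u' = "\<lambda>x. - (?u x * (?u x * (?u x * (f x \<bullet> f' x))))"
  have f': "(f has_vector_derivative f' x) (at x)" for x
    unfolding f'_def by (rule smooth_has_vector_derivative[OF assms(1)])
  show ?thesis
  proof (rule smooth_bootstrap)
    fix x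
    have "((\<lambda>x. norm (f x)) has_derivative (\<lambda>h. (h *\<^sub>R f' x) \<bullet> sgn (f x))) (at x)"
      by (rule has_derivative_compose[OF f'[unfolded has_vector_derivative_def]
          has_derivative_norm[OF assms(2)]])
    then have n: "((\<lambda>x. norm (f x)) has_real_derivative (f' x \<bullet> sgn (f x))) (at x)"
      by (simp add: has_field_derivative_def mult_commute_abs)
    show "(?u has_vector_derivative ?u' x) (at x)"
      unfolding has_real_derivative_iff_has_vector_derivative[symmetric]
      by (rule derivative_eq_intros n refl | simp add: assms)+
         (simp add: assms sgn_div_norm inner_commute field_simps)
  next
    fix n assume u: "Cdiff n ?u"
    have "Cdiff n f" "Cdiff n f'"
      using assms(1) smooth_vector_derivative[OF assms(1)] by (auto simp: smooth_iff_Cdiff f'_def)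
    then have "Cdiff n (\<lambda>x. (-1) * (?u x * (?u x * (?u x * (f x \<bullet> f' x)))))"
      by (intro Cdiff_mult Cdiff_inner Cdiff_const u)
    then show "Cdiff n ?u'" by simp
  qed
qed

section \<open>The direction field of a fixed point at infinity\<close>

lemma has_vector_derivative_vec_iff:
  fixes f :: "real \<Rightarrow> real ^ 'n"
  shows "(f has_vector_derivative f') (at x) \<longleftrightarrow>
    (\<forall>i. ((\<lambda>x. f x $ i) has_real_derivative f' $ i) (at x))"
  unfolding has_vector_derivative_def
    has_derivative_componentwise_within[where S = UNIV and f = f] has_field_derivative_def
  by (auto simp: Basis_vec_def inner_axis mult_commute_abs)

definition adjugate2 :: "mat2 \<Rightarrow> mat2" where
  "adjugate2 X = vector [vector [X $ 2 $ 2, - X $ 1 $ 2], vector [- X $ 2 $ 1, X $ 1 $ 1]]"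

lemma adjugate2_mult: "adjugate2 (X ** Y) = adjugate2 Y ** adjugate2 X"
  by (simp add: adjugate2_def matrix_matrix_mult_def vec_eq_iff forall_2 sum_2 algebra_simps)

lemma mult_adjugate2: "X ** adjugate2 X = mat (det X)"
  by (simp add: adjugate2_def matrix_matrix_mult_def vec_eq_iff
      forall_2 sum_2 mat_def det_2 algebra_simps)

lemma bounded_linear_adjugate2: "bounded_linear adjugate2"
  unfolding linear_conv_bounded_linear[symmetric]
  by (rule linearI) (simp_all add: adjugate2_def vec_eq_iff forall_2)

lemma adjugate2_su2_mat: "adjugate2 (c *\<^sub>C su2_mat p) = - (c *\<^sub>C su2_mat p)"
  by (simp add: adjugate2_def su2_mat_def cscale_def sigma1_def sigma2_def sigma3_def
      vec_eq_iff forall_2 algebra_simps)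

lemma bounded_bilinear_mat2_mult: "bounded_bilinear ((**) :: mat2 \<Rightarrow> mat2 \<Rightarrow> mat2)"
  unfolding bilinear_conv_bounded_bilinear[symmetric] bilinear_def
  by (auto intro!: linearI simp: matrix_add_ldistrib matrix_add_rdistrib scalar_matrix_assoc
      matrix_scalar_ac)

lemma bounded_linear_mat2_vec: "bounded_linear (\<lambda>X :: mat2. X *v w)"
  unfolding linear_conv_bounded_linear[symmetric]
  by (rule linearI) (simp_all add: matrix_vector_mult_def vec_eq_iff sum.distrib algebra_simps
      scaleR_sum_right)

text \<open>In the given parameter the speed cancels, and the frame equation is driven by the velocity.\<close>

lemma frame_derivative:
  assumes "is_frame \<gamma> x0 \<mu> F" "vector_derivative \<gamma> (at x) \<noteq> 0"
  shows "(F has_vector_derivative F x ** (\<mu> *\<^sub>C su2_mat (vector_derivative \<gamma> (at x)))) (at x)"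
proof -
  let ?g = "vector_derivative \<gamma> (at x)"
  have s: "speed \<gamma> x \<noteq> 0" using assms(2) by (simp add: speed_def)
  have F: "F differentiable (at x)"
    and *: "(1 / speed \<gamma> x) *\<^sub>R vector_derivative F (at x) = F x ** (\<mu> *\<^sub>C su2_mat ((1 / speed \<gamma> x)
        *\<^sub>R ?g))"
    using assms(1) by (auto simp: is_frame_def arc_deriv_def tangent_def)
  have "F x ** (\<mu> *\<^sub>C su2_mat ((1 / speed \<gamma> x) *\<^sub>R ?g)) = (1 / speed \<gamma> x) *\<^sub>R (F x ** (\<mu> *\<^sub>C su2_mat
      ?g))"
    unfolding su2_mat_scaleR
    by (simp add: cscale_def matrix_matrix_mult_def vec_eq_iff sum_2 algebra_simps)
  with * s have "vector_derivative F (at x) = F x ** (\<mu> *\<^sub>C su2_mat ?g)" by simp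
  with F show ?thesis by (metis vector_derivative_works)
qed

lemma constant_if_derivative_zero:
  assumes "\<And>x. (f has_vector_derivative 0) (at x)"
  shows "f x = f y"
  using has_vector_derivative_zero_constant[of UNIV f] assms by (metis UNIV_I convex_UNIV)

text \<open>The coefficient matrix is trace-free.\<close>

lemma frame_det:
  assumes "is_frame \<gamma> x0 \<mu> F" "\<And>x. vector_derivative \<gamma> (at x) \<noteq> 0"
  shows "det (F x) = 1"
proof -
  have "((\<lambda>x. det (F x)) has_vector_derivative 0) (at x)" for x
  proof -
    define X where "X = \<mu> *\<^sub>C su2_mat (vector_derivative \<gamma> (at x))"
    have tr: "X $ 2 $ 2 = - X $ 1 $ 1"
      by (simp add: X_def cscale_def su2_mat_def sigma1_def sigma2_def sigma3_def)
    have "((\<lambda>x. F x $ i $ j) has_vector_derivative (F x ** X) $ i $ j) (at x)" for i j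
      unfolding X_def
      by (intro bounded_linear.has_vector_derivative[OF bounded_linear_vec_nth]
          frame_derivative[OF assms(1)] assms(2))
    then have "((\<lambda>x. F x $ 1 $ 1 * F x $ 2 $ 2 - F x $ 1 $ 2 * F x $ 2 $ 1) has_vector_derivative
      (F x $ 1 $ 1 * (F x ** X) $ 2 $ 2 + (F x ** X) $ 1 $ 1 * F x $ 2 $ 2)
      - (F x $ 1 $ 2 * (F x ** X) $ 2 $ 1 + (F x ** X) $ 1 $ 2 * F x $ 2 $ 1)) (at x)"
      by (intro has_vector_derivative_diff has_vector_derivative_mult)
    then show ?thesis
      unfolding det_2 by (simp add: matrix_matrix_mult_def sum_2 tr algebra_simps)
  qed
  from constant_if_derivative_zero[OF this, of x x0] show ?thesis
    using assms(1) by (simp add: is_frame_def)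
qed

lemma frame_inverse:
  assumes F: "is_frame \<gamma> x0 \<mu> F" "\<And>x. vector_derivative \<gamma> (at x) \<noteq> 0"
  shows "matrix_inv (F x) = adjugate2 (F x)" "F x ** adjugate2 (F x) = mat 1"
    "adjugate2 (F x) ** F x = mat 1"
proof -
  show *: "F x ** adjugate2 (F x) = mat 1" by (simp add: mult_adjugate2 frame_det[OF F])
  show "matrix_inv (F x) = adjugate2 (F x)" "adjugate2 (F x) ** F x = mat 1"
    using matrix_inv_eqI[OF *] matrix_left_right_inverse1[OF *] by blast+
qed

lemma frame_inverse_derivative:
  assumes "is_frame \<gamma> x0 \<mu> F" "vector_derivative \<gamma> (at x) \<noteq> 0"
  shows "((\<lambda>x. adjugate2 (F x)) has_vector_derivative
    - ((\<mu> *\<^sub>C su2_mat (vector_derivative \<gamma> (at x))) ** adjugate2 (F x))) (at x)"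
proof -
  have neg: "(- X) ** Y = - (X ** Y)" for X Y :: mat2
    by (simp add: matrix_matrix_mult_def vec_eq_iff sum_negf)
  show ?thesis
    using bounded_linear.has_vector_derivative[OF bounded_linear_adjugate2 frame_derivative[OF assms]]
    by (simp add: adjugate2_mult adjugate2_su2_mat neg)
qed

text \<open>The spatial part of a light-like vector with time component \<^term>\<open>(norm w)\<^sup>2\<close>:
  \<^term>\<open>outer w\<close> is half of \<open>|w|\<^sup>2 1 + \<Sum>\<^sub>j (hopf w)\<^sub>j \<sigma>\<^sub>j\<close>.\<close>

definition hopf :: "complex ^ 2 \<Rightarrow> R3" where
  "hopf w = vector [2 * Re (w $ 1 * cnj (w $ 2)), - 2 * Im (w $ 1 * cnj (w $ 2)),
    (cmod (w $ 1))\<^sup>2 - (cmod (w $ 2))\<^sup>2]"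

lemma norm_spinor_square: "(norm w)\<^sup>2 = (cmod (w $ 1))\<^sup>2 + (cmod (w $ 2))\<^sup>2" for w :: "complex ^ 2"
  by (simp add: norm_vec_def L2_set_def sum_2)

lemma ideal_direction_hopf: "ideal_direction w = (1 / (norm w)\<^sup>2) *\<^sub>R hopf w"
  by (simp add: ideal_direction_def su2_vec_def hopf_def outer_def cscale_def mat_def trace_def
      matrix_matrix_mult_def sum_2 sigma1_def sigma2_def sigma3_def vec_eq_iff forall_3
      cmod_power2 complex_mult_cnj)
    (simp add: power2_eq_square algebra_simps diff_divide_distrib add_divide_distrib)?

lemma norm_ideal_direction:
  assumes "w \<noteq> 0"
  shows "norm (ideal_direction w) = 1"
proof -
  have "(norm (hopf w))\<^sup>2 = ((norm w)\<^sup>2)\<^sup>2"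
    unfolding norm_spinor_square cmod_power2 power2_norm_eq_inner[of "hopf w"]
    by (simp add: hopf_def inner_vec_def sum_3 cmod_power2)
       (simp add: power2_eq_square algebra_simps)
  then have "norm (hopf w) = (norm w)\<^sup>2" by (rule power2_eq_imp_eq) simp_all
  then show ?thesis using assms by (simp add: ideal_direction_hopf)
qed

text \<open>Points at infinity move by the action of the Lorentz group, here its infinitesimal form: the
  energy \<^term>\<open>(norm w)\<^sup>2\<close> and the momentum \<^term>\<open>hopf w\<close> of the light-like vector are
  boosted by the imaginary and rotated by the real part of the spectral parameter.\<close>

lemma spinor_energy_momentum_derivative:
  fixes w :: "real \<Rightarrow> complex ^ 2" and g :: R3
  assumes w: "(w has_vector_derivative - ((\<mu> *\<^sub>C su2_mat g) *v w x)) (at x)"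
  shows "((\<lambda>x. (norm (w x))\<^sup>2) has_real_derivative - 2 * Im \<mu> * (g \<bullet> hopf (w x))) (at x)"
    and "((\<lambda>x. hopf (w x)) has_vector_derivative
      - (2 * Im \<mu> * (norm (w x))\<^sup>2) *\<^sub>R g - (2 * Re \<mu>) *\<^sub>R (g \<times> hopf (w x))) (at x)"
proof -
  define d where "d = - ((\<mu> *\<^sub>C su2_mat g) *v w x)"
  have wi: "((\<lambda>x. w x $ i) has_vector_derivative d $ i) (at x)" for i
    unfolding d_def by (intro bounded_linear.has_vector_derivative[OF bounded_linear_vec_nth] w)
  define R I where "R i x = Re (w x $ i)" and "I i x = Im (w x $ i)" for i x
  have "(R i has_real_derivative Re (d $ i)) (at x)"
    and "(I i has_real_derivative Im (d $ i)) (at x)" for i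
    unfolding has_real_derivative_iff_has_vector_derivative R_def I_def
    using bounded_linear.has_vector_derivative[OF bounded_linear_Re wi]
      bounded_linear.has_vector_derivative[OF bounded_linear_Im wi] by auto
  note der = this
  note d = d_def cscale_def su2_mat_def sigma1_def sigma2_def sigma3_def matrix_vector_mult_def sum_2
  have n: "(norm (w x))\<^sup>2 = R 1 x * R 1 x + I 1 x * I 1 x + (R 2 x * R 2 x + I 2 x * I 2 x)" for x
    unfolding norm_spinor_square cmod_power2 by (simp add: R_def I_def power2_eq_square)
  have h: "hopf (w x) $ 1 = 2 * (R 1 x * R 2 x + I 1 x * I 2 x)"
    "hopf (w x) $ 2 = 2 * (R 1 x * I 2 x - I 1 x * R 2 x)"
    "hopf (w x) $ 3 = R 1 x * R 1 x + I 1 x * I 1 x - (R 2 x * R 2 x + I 2 x * I 2 x)" for x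
    unfolding hopf_def vector_3 cmod_power2 by (simp_all add: R_def I_def power2_eq_square)
  show "((\<lambda>x. (norm (w x))\<^sup>2) has_real_derivative - 2 * Im \<mu> * (g \<bullet> hopf (w x))) (at x)"
    unfolding n
    by (rule derivative_eq_intros der refl)+
       (simp add: h d inner_vec_def sum_3 R_def[symmetric] I_def[symmetric] algebra_simps)
  show "((\<lambda>x. hopf (w x)) has_vector_derivative
      - (2 * Im \<mu> * (norm (w x))\<^sup>2) *\<^sub>R g - (2 * Re \<mu>) *\<^sub>R (g \<times> hopf (w x))) (at x)"
    unfolding has_vector_derivative_vec_iff forall_3 n h
    by (intro conjI; (rule derivative_eq_intros der refl)+)
       (simp_all add: h d cross3_def R_def[symmetric] I_def[symmetric] algebra_simps)
qed

text \<open>The Riccati equation, by the quotient rule.\<close>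

lemma ideal_direction_derivative:
  fixes w :: "real \<Rightarrow> complex ^ 2" and g :: R3
  assumes w: "(w has_vector_derivative - ((\<mu> *\<^sub>C su2_mat g) *v w x)) (at x)" and "w x \<noteq> 0"
  defines "S \<equiv> \<lambda>x. ideal_direction (w x)"
  shows "(S has_vector_derivative
    - (2 * Im \<mu>) *\<^sub>R (g - (g \<bullet> S x) *\<^sub>R S x) - (2 * Re \<mu>) *\<^sub>R (g \<times> S x)) (at x)"
proof -
  define r where "r x = 1 / (norm (w x))\<^sup>2" for x
  have r: "r x * (norm (w x))\<^sup>2 = 1" using assms(2) by (simp add: r_def)
  have "(r has_real_derivative 2 * Im \<mu> * (g \<bullet> hopf (w x)) * (r x * r x)) (at x)"
    using DERIV_inverse_fun[OF spinor_energy_momentum_derivative(1)[OF w]] assms(2)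
    unfolding r_def[abs_def] by (simp add: inverse_eq_divide power2_eq_square field_simps)
  from has_vector_derivative_scaleR[OF this spinor_energy_momentum_derivative(2)[OF w]]
  have "((\<lambda>x. r x *\<^sub>R hopf (w x)) has_vector_derivative
    - (2 * Im \<mu> * (r x * (norm (w x))\<^sup>2)) *\<^sub>R g - (2 * Re \<mu> * r x) *\<^sub>R (g \<times> hopf (w x))
    + (2 * Im \<mu> * (g \<bullet> hopf (w x)) * (r x * r x)) *\<^sub>R hopf (w x)) (at x)"
    by (simp add: scaleR_diff_right mult_ac)
  then show ?thesis
    unfolding S_def ideal_direction_hopf r_def[symmetric] r
    by (rule has_vector_derivative_eq_rhs)
       (simp add: cross_mult_right scaleR_diff_right mult_ac)
qed

text \<open>Transporting the frame over one period and conjugating back yields another solution of the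
  same linear equation, so the two differ by a constant factor, the monodromy.\<close>

lemma frame_translate:
  assumes F: "is_frame \<gamma> x0 \<mu> F" and "\<And>x. vector_derivative \<gamma> (at x) \<noteq> 0" and "A \<in> SU2"
    and \<tau>: "\<And>x. (\<tau> has_real_derivative \<tau>' x) (at x)"
    and g: "\<And>x. \<tau>' x *\<^sub>R vector_derivative \<gamma> (at (\<tau> x)) = rot_part A (vector_derivative \<gamma> (at x))"
  shows "F (\<tau> x) ** A = monodromy_matrix \<tau> A x0 F ** F x"
proof -
  define X where "X x = \<mu> *\<^sub>C su2_mat (vector_derivative \<gamma> (at x))" for x
  have tX: "\<tau>' x *\<^sub>R X (\<tau> x) ** A = A ** X x" for x
  proof -
    have "\<tau>' x *\<^sub>R X (\<tau> x) = \<mu> *\<^sub>C su2_mat (rot_part A (vector_derivative \<gamma> (at x)))"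
      by (simp add: X_def flip: g) (simp add: su2_mat_scaleR cscale_def vec_eq_iff)
    also have "\<dots> = A ** X x ** matrix_inv A"
      unfolding su2_mat_rot_part[OF assms(3)] X_def
      by (simp add: cscale_def matrix_matrix_mult_def vec_eq_iff sum_2 algebra_simps)
    finally have "\<tau>' x *\<^sub>R X (\<tau> x) = A ** X x ** matrix_inv A" .
    then show ?thesis
      by (metis SU2_matrix_inv(3)[OF assms(3)] matrix_mul_assoc matrix_mul_rid)
  qed
  \<comment> \<open>The quotient of two solutions of \<open>H' = H X\<close>.\<close>
  define K where "K x = F (\<tau> x) ** A ** adjugate2 (F x)" for x
  have K: "(K has_vector_derivative 0) (at x)" for x
  proof -
    have "((F \<circ> \<tau>) has_vector_derivative \<tau>' x *\<^sub>R (F (\<tau> x) ** X (\<tau> x))) (at x)"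
      unfolding X_def
      by (intro vector_diff_chain_at frame_derivative[OF F] assms(2)
          \<tau>[unfolded has_real_derivative_iff_has_vector_derivative])
    then have 1: "((\<lambda>x. F (\<tau> x) ** A) has_vector_derivative (\<tau>' x *\<^sub>R (F (\<tau> x) ** X (\<tau> x))) ** A)
        (at x)"
      unfolding o_def
      by (rule bounded_linear.has_vector_derivative[OF
          bounded_bilinear.bounded_linear_left[OF bounded_bilinear_mat2_mult]])
    have "\<tau>' x *\<^sub>R (F (\<tau> x) ** X (\<tau> x)) ** A = F (\<tau> x) ** (\<tau>' x *\<^sub>R X (\<tau> x) ** A)"
      by (simp add: matrix_scalar_ac scalar_matrix_assoc matrix_mul_assoc)
    also have "\<dots> = F (\<tau> x) ** A ** X x" by (simp add: tX matrix_mul_assoc)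
    finally have 2: "((\<lambda>x. F (\<tau> x) ** A) has_vector_derivative F (\<tau> x) ** A ** X x) (at x)"
      using 1 by simp
    have neg: "X ** (- Y) = - (X ** Y)" for X Y :: mat2
      by (simp add: matrix_matrix_mult_def vec_eq_iff sum_negf)
    show ?thesis
      using bounded_bilinear.has_vector_derivative[OF bounded_bilinear_mat2_mult 2
          frame_inverse_derivative[OF F assms(2)]]
      unfolding K_def by (simp add: X_def neg matrix_mul_assoc)
  qed
  have "K x = K x0" by (rule constant_if_derivative_zero[OF K])
  also have "K x0 = monodromy_matrix \<tau> A x0 F"
    using F by (simp add: K_def monodromy_matrix_def is_frame_def adjugate2_def mat_def
        matrix_matrix_mult_def vec_eq_iff forall_2 sum_2)
  finally have "monodromy_matrix \<tau> A x0 F ** F x = F (\<tau> x) ** A ** adjugate2 (F x) ** F x"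
    by (simp add: K_def)
  then show ?thesis
    by (metis frame_inverse(3)[OF F assms(2)] matrix_mul_assoc matrix_mul_rid)
qed

lemma outer_mult: "outer (B *v w) = B ** outer w ** conj_transpose B"
  by (simp add: outer_def conj_transpose_def matrix_vector_mult_def matrix_matrix_mult_def
      vec_eq_iff forall_2 sum_2 algebra_simps)

lemma trace_outer: "trace (outer w) = of_real ((norm w)\<^sup>2)"
  unfolding norm_spinor_square
  by (simp add: trace_def outer_def sum_2 complex_norm_square del: of_real_power)

text \<open>The direction depends only on the ray of the light-like vector, which is all that a fixed point
  of the monodromy determines.\<close>

lemma ideal_direction_outer:
  assumes "outer w' = r *\<^sub>R outer w" "r \<noteq> 0"
  shows "ideal_direction w' = ideal_direction w"
proof -
  have "complex_of_real ((norm w')\<^sup>2) = trace (r *\<^sub>R outer w)"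
    unfolding trace_outer[symmetric] assms(1) ..
  also have "\<dots> = r *\<^sub>R trace (outer w)" by (simp add: trace_def scaleR_sum_right)
  also have "\<dots> = complex_of_real (r * (norm w)\<^sup>2)" unfolding trace_outer
      by (simp add: scaleR_conv_of_real)
  finally have n: "(norm w')\<^sup>2 = r * (norm w)\<^sup>2" using of_real_eq_iff by blast
  show ?thesis unfolding ideal_direction_def n assms(1) using assms(2) by simp
qed

lemma ideal_direction_SU2:
  assumes "A \<in> SU2" "w \<noteq> 0"
  shows "ideal_direction (A *v w) = rot_part A (ideal_direction w)"
proof -
  have inv: "conj_transpose A = matrix_inv A" using SU2_matrix_inv[OF assms(1)] by simp
  have o: "outer (A *v w) = A ** outer w ** matrix_inv A" by (simp add: outer_mult inv)
  have "complex_of_real ((norm (A *v w))\<^sup>2) = complex_of_real ((norm w)\<^sup>2)"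
    unfolding trace_outer[symmetric] o
    by (metis trace_mul_sym matrix_mul_assoc SU2_matrix_inv(3)[OF assms(1)] matrix_mul_lid)
  then have n: "(norm (A *v w))\<^sup>2 = (norm w)\<^sup>2" using of_real_eq_iff by blast
  with assms(2) have nz: "A *v w \<noteq> 0" by auto
  have distr: "A ** (\<i> *\<^sub>C (mat 1 - r *\<^sub>R X)) ** B = \<i> *\<^sub>C (A ** B - r *\<^sub>R (A ** X ** B))"
    for r and X B :: mat2
    by (simp add: cscale_def mat_def matrix_matrix_mult_def vec_eq_iff forall_2 sum_2 algebra_simps)
  show ?thesis
    by (rule su2_mat_inject)
       (simp only: su2_mat_rot_part[OF assms(1)] su2_mat_ideal_direction[OF assms(2)]
         su2_mat_ideal_direction[OF nz] n o distr SU2_matrix_inv(2)[OF assms(1)])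
qed

lemma fixed_point_spinor:
  assumes "ideal_point w \<in> fixed_points_at_infinity B"
  shows "w \<noteq> 0" "\<exists>r>0. outer (B *v w) = r *\<^sub>R outer w"
proof -
  have mem: "outer w \<in> ideal_point w"
    by (auto simp: ideal_point_def ray_def intro!: exI[of _ 1])
  obtain p where "p \<in> light_cone" "ideal_point w = ray p"
    using assms by (auto simp: fixed_points_at_infinity_def sphere_at_infinity_def)
  with mem obtain c where "c > 0" "outer w = c *\<^sub>R p" "Re (trace p) > 0"
    by (auto simp: ray_def light_cone_def)
  then have "Re (trace (outer w)) > 0"
    by (simp add: trace_def sum_2 flip: distrib_left)
  then show "w \<noteq> 0" by (auto simp: trace_outer)
  have "hyp_action B (outer w) \<in> ideal_point w"
    using assms mem by (auto simp: fixed_points_at_infinity_def)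
  then show "\<exists>r>0. outer (B *v w) = r *\<^sub>R outer w"
    by (auto simp: hyp_action_def outer_mult ideal_point_def ray_def)
qed

text \<open>The frame and its monodromy enter the rest of the proof only through these three properties of
  the direction field.\<close>

lemma ideal_map_properties:
  assumes F: "is_frame \<gamma> x0 \<mu> F" and g: "\<And>x. vector_derivative \<gamma> (at x) \<noteq> 0" and A: "A \<in> SU2"
    and \<tau>: "\<And>x. (\<tau> has_real_derivative \<tau>' x) (at x)"
      "\<And>x. \<tau>' x *\<^sub>R vector_derivative \<gamma> (at (\<tau> x)) = rot_part A (vector_derivative \<gamma> (at x))"
    and w: "ideal_point w \<in> fixed_points_at_infinity (monodromy_matrix \<tau> A x0 F)"
  defines "S \<equiv> ideal_map F w"
  shows "norm (S x) = 1"
    and "(S has_vector_derivative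
      - (2 * Im \<mu>) *\<^sub>R (vector_derivative \<gamma> (at x) - (vector_derivative \<gamma> (at x) \<bullet> S x) *\<^sub>R S x)
      - (2 * Re \<mu>) *\<^sub>R (vector_derivative \<gamma> (at x) \<times> S x)) (at x)"
    and "S (\<tau> x) = rot_part A (S x)"
proof -
  define W where "W x = adjugate2 (F x) *v w" for x
  have FW: "F x *v W x = w" for x
    by (simp add: W_def matrix_vector_mul_assoc frame_inverse(2)[OF F g])
  have W0: "W x \<noteq> 0" for x
    using FW[of x] fixed_point_spinor(1)[OF w] by auto
  have S: "S = (\<lambda>x. ideal_direction (W x))"
    by (simp add: S_def ideal_map_def[abs_def] W_def frame_inverse(1)[OF F g])
  have neg: "(- X) *v y = - (X *v y)" for X :: mat2 and y
    by (simp add: matrix_vector_mult_def vec_eq_iff sum_negf)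
  have "(W has_vector_derivative
    - ((\<mu> *\<^sub>C su2_mat (vector_derivative \<gamma> (at x))) *v W x)) (at x)" for x
    using bounded_linear.has_vector_derivative[OF bounded_linear_mat2_vec
        frame_inverse_derivative[OF F g, of x], of w]
    unfolding W_def[abs_def] by (simp add: neg matrix_vector_mul_assoc)
  from ideal_direction_derivative[OF this W0] show
    "(S has_vector_derivative
      - (2 * Im \<mu>) *\<^sub>R (vector_derivative \<gamma> (at x) - (vector_derivative \<gamma> (at x) \<bullet> S x) *\<^sub>R S x)
      - (2 * Re \<mu>) *\<^sub>R (vector_derivative \<gamma> (at x) \<times> S x)) (at x)"
    by (simp add: S)
  show "norm (S x) = 1" by (simp add: S norm_ideal_direction W0)
  define M where "M = monodromy_matrix \<tau> A x0 F"
  obtain r where r: "r > 0" "outer (M *v w) = r *\<^sub>R outer w"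
    using fixed_point_spinor(2)[OF w] by (auto simp: M_def)
  let ?G = "adjugate2 (F (\<tau> x))"
  have "A *v W x = ?G *v (F (\<tau> x) *v (A *v W x))"
    by (simp add: matrix_vector_mul_assoc matrix_mul_assoc frame_inverse(3)[OF F g])
  also have "\<dots> = ?G *v ((F (\<tau> x) ** A) *v W x)"
    by (simp add: matrix_vector_mul_assoc matrix_mul_assoc)
  also have "\<dots> = ?G *v (M *v w)"
    using frame_translate[OF F g A \<tau>, of x] FW[of x]
    by (simp add: M_def flip: matrix_vector_mul_assoc)
  finally have "outer (A *v W x) = ?G ** (r *\<^sub>R outer w) ** conj_transpose ?G"
    using r by (simp add: outer_mult)
  also have "\<dots> = r *\<^sub>R outer (W (\<tau> x))"
    by (simp add: W_def outer_mult matrix_scalar_ac scalar_matrix_assoc)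
  finally have "ideal_direction (A *v W x) = ideal_direction (W (\<tau> x))"
    using r(1) by (intro ideal_direction_outer) auto
  then show "S (\<tau> x) = rot_part A (S x)"
    by (simp add: S ideal_direction_SU2[OF A W0])
qed

section \<open>Curves with prescribed monodromy\<close>

lemma translation_has_derivative:
  "translation_diffeo \<tau> \<Longrightarrow> (\<tau> has_real_derivative vector_derivative \<tau> (at x)) (at x)"
  unfolding has_real_derivative_iff_has_vector_derivative
  by (auto simp: translation_diffeo_def intro: smooth_has_vector_derivative)

locale equivariant_curve =
  fixes \<tau> :: "real \<Rightarrow> real" and A :: mat2 and a :: R3 and \<gamma> :: "real \<Rightarrow> R3"
  assumes translation: "translation_diffeo \<tau>" and SU2: "A \<in> SU2"
    and curve: "\<gamma> \<in> immersed_curves \<tau> A a"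
begin

abbreviation velocity :: "real \<Rightarrow> R3" where "velocity x \<equiv> vector_derivative \<gamma> (at x)"
abbreviation \<tau>' :: "real \<Rightarrow> real" where "\<tau>' x \<equiv> vector_derivative \<tau> (at x)"

lemma smooth_curve: "smooth \<gamma>" and velocity_nonzero: "velocity x \<noteq> 0"
  and curve_translate: "\<gamma> (\<tau> x) = rot_part A (\<gamma> x) + a"
  using curve by (auto simp: immersed_curves_def rigid_motion_def fun_eq_iff)

lemma curve_derivative: "(\<gamma> has_vector_derivative velocity x) (at x)"
  by (rule smooth_has_vector_derivative[OF smooth_curve])

lemma bounded_linear_rot_part: "bounded_linear (rot_part A)"
  using linear_rot_part[OF SU2] linear_conv_bounded_linear by blast

lemmas rot_part_linear = linear_add[OF linear_rot_part[OF SU2]]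
      linear_diff[OF linear_rot_part[OF SU2]]
  linear_scale[OF linear_rot_part[OF SU2]] linear_0[OF linear_rot_part[OF SU2]]
lemmas rot_part_preserves = inner_rot_part[OF SU2] cross_rot_part[OF SU2]

lemma norm_rot_part: "norm (rot_part A p) = norm p"
  by (simp add: norm_eq_sqrt_inner rot_part_preserves)

text \<open>Differentiating an equivariance; with the arclength derivative the factor \<open>\<tau>'\<close> disappears.\<close>

lemma derivative_translate:
  assumes f: "\<And>x. (f has_vector_derivative f' x) (at x)" and "bounded_linear L" "\<And>x. f (\<tau> x)
      = L (f x) + c"
  shows "\<tau>' x *\<^sub>R f' (\<tau> x) = L (f' x)"
proof -
  have 1: "((f \<circ> \<tau>) has_vector_derivative \<tau>' x *\<^sub>R f' (\<tau> x)) (at x)"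
    using translation_has_derivative[OF translation] f
    unfolding has_real_derivative_iff_has_vector_derivative by (rule vector_diff_chain_at)
  have "((\<lambda>x. L (f x) + c) has_vector_derivative L (f' x)) (at x)"
    using has_vector_derivative_add[OF bounded_linear.has_vector_derivative[OF assms(2) f]
        has_vector_derivative_const[of c]] by simp
  moreover have "f \<circ> \<tau> = (\<lambda>x. L (f x) + c)" using assms(3) by auto
  ultimately show ?thesis using 1 by (simp add: vector_derivative_unique_at)
qed

lemma velocity_translate: "\<tau>' x *\<^sub>R velocity (\<tau> x) = rot_part A (velocity x)"
  by (rule derivative_translate[OF curve_derivative bounded_linear_rot_part curve_translate])

text \<open>The derivative never vanishes because \<open>\<gamma> \<circ> \<tau>\<close> is immersed, and it is positive somewhere
  because every point is moved forward.\<close>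

lemma translation_increasing: "\<tau>' x > 0"
proof (rule ccontr)
  assume "\<not> \<tau>' x > 0"
  then have "\<tau>' x \<le> 0" by simp
  have nz: "\<tau>' y \<noteq> 0" for y
    using arg_cong[OF velocity_translate[of y], of norm] velocity_nonzero[of y]
    by (auto simp: norm_rot_part)
  have fwd: "y < \<tau> y" for y using translation by (simp add: translation_diffeo_def)
  obtain \<xi> where "\<tau> (\<tau> x) - \<tau> x = (\<tau> x - x) * \<tau>' \<xi>"
    using MVT2[OF fwd[of x], of \<tau> \<tau>'] translation_has_derivative[OF translation] by blast
  with fwd[of x] fwd[of "\<tau> x"] have pos: "\<tau>' \<xi> > 0"
    using zero_less_mult_pos[of "\<tau> x - x" "\<tau>' \<xi>"] by simp
  have "smooth \<tau>'"
    using translation by (simp add: translation_diffeo_def smooth_vector_derivative)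
  then have "continuous_on UNIV \<tau>'"
    by (intro continuous_at_imp_continuous_on ballI)
      (rule has_vector_derivative_continuous[OF smooth_has_vector_derivative])
  then have "connected (range \<tau>')" by (intro connected_continuous_image) auto
  then have "0 \<in> range \<tau>'"
    by (rule connectedD_interval[of _ "\<tau>' x" "\<tau>' \<xi>"]) (use \<open>\<tau>' x \<le> 0\<close> pos in auto)
  with nz show False by auto
qed

lemma speed_pos: "speed \<gamma> x > 0" and speed_translate: "\<tau>' x * speed \<gamma> (\<tau> x) = speed \<gamma> x"
proof -
  show "speed \<gamma> x > 0" using velocity_nonzero by (simp add: speed_def)
  show "\<tau>' x * speed \<gamma> (\<tau> x) = speed \<gamma> x"
    using arg_cong[OF velocity_translate, of norm x] translation_increasing[of x]
    by (simp add: speed_def norm_rot_part)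
qed

lemma velocity_eq: "velocity x = speed \<gamma> x *\<^sub>R tangent \<gamma> x"
  using speed_pos[of x] by (simp add: tangent_def arc_deriv_def)

lemma tangent_unit: "tangent \<gamma> x \<bullet> tangent \<gamma> x = 1"
  using velocity_nonzero[of x]
  by (simp add: tangent_def arc_deriv_def speed_def dot_square_norm power2_eq_square)

lemma smooth_inverse_speed: "smooth (\<lambda>x. 1 / speed \<gamma> x)"
  unfolding speed_def
  by (rule smooth_inverse_norm[OF smooth_vector_derivative[OF smooth_curve] velocity_nonzero])

lemma smooth_arc_deriv: "smooth f \<Longrightarrow> smooth (arc_deriv \<gamma> f)"
  using smooth_inverse_speed smooth_vector_derivative[of f]
  by (auto simp: smooth_iff_Cdiff arc_deriv_def[abs_def] intro!: Cdiff_scaleR)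

lemma smooth_tangent: "smooth (tangent \<gamma>)"
  unfolding tangent_def by (rule smooth_arc_deriv[OF smooth_curve])

lemma derivative_eq_arc_deriv:
  "smooth f \<Longrightarrow> (f has_vector_derivative speed \<gamma> x *\<^sub>R arc_deriv \<gamma> f x) (at x)"
  using smooth_has_vector_derivative[of f x] speed_pos[of x] by (simp add: arc_deriv_def)

lemma arc_deriv_eqI:
  "(f has_vector_derivative speed \<gamma> x *\<^sub>R f') (at x) \<Longrightarrow> arc_deriv \<gamma> f x = f'"
  using speed_pos[of x] by (simp add: arc_deriv_def vector_derivative_at)

lemma arc_deriv_translate:
  assumes "smooth f" "bounded_linear L" "\<And>x. f (\<tau> x) = L (f x) + c"
  shows "arc_deriv \<gamma> f (\<tau> x) = L (arc_deriv \<gamma> f x)"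
proof -
  have "L (arc_deriv \<gamma> f x) = (1 / speed \<gamma> x) *\<^sub>R L (vector_derivative f (at x))"
    by (simp add: arc_deriv_def linear_cmul[OF bounded_linear.linear[OF assms(2)]])
  also have "\<dots> = (1 / speed \<gamma> x) *\<^sub>R \<tau>' x *\<^sub>R vector_derivative f (at (\<tau> x))"
    by (subst derivative_translate[OF smooth_has_vector_derivative[OF assms(1)] assms(2,3)]) simp
  also have "\<dots> = arc_deriv \<gamma> f (\<tau> x)"
    using translation_increasing[of x] speed_pos[of "\<tau> x"]
    unfolding speed_translate[of x, symmetric] by (simp add: arc_deriv_def)
  finally show ?thesis by simp
qed

lemma tangent_translate: "tangent \<gamma> (\<tau> x) = rot_part A (tangent \<gamma> x)"
  unfolding tangent_def
  by (rule arc_deriv_translate[OF smooth_curve bounded_linear_rot_part curve_translate])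

text \<open>Conserved quantities differ by the derivative of a periodic function.  If one
  density is not integrable then neither is the other, and both integrals are zero by convention.\<close>

lemma integral_eq_if_periodic_derivative:
  fixes \<Phi> f g :: "real \<Rightarrow> real"
  assumes "\<And>x. (\<Phi> has_real_derivative f x - g x) (at x)" "\<And>x. \<Phi> (\<tau> x) = \<Phi> x"
  shows "integral {x0..\<tau> x0} f = integral {x0..\<tau> x0} g"
proof -
  have "x0 \<le> \<tau> x0" using translation by (simp add: translation_diffeo_def less_imp_le)
  then have 0: "((\<lambda>x. f x - g x) has_integral 0) {x0..\<tau> x0}"
    using fundamental_theorem_of_calculus[of x0 "\<tau> x0" \<Phi> "\<lambda>x. f x - g x"] assms(2)
      assms(1)[unfolded has_real_derivative_iff_has_vector_derivative]
    by (auto intro: has_vector_derivative_at_within)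
  show ?thesis
  proof (cases "g integrable_on {x0..\<tau> x0}")
    case True
    from has_integral_add[OF 0 integrable_integral[OF True]] show ?thesis
      by (simp add: integral_unique)
  next
    case False
    have "\<not> f integrable_on {x0..\<tau> x0}"
    proof
      assume "f integrable_on {x0..\<tau> x0}"
      from integrable_diff[OF this has_integral_integrable[OF 0]] False show False by simp
    qed
    with False show ?thesis by (simp add: not_integrable_integral)
  qed
qed

end

section \<open>Pointwise identities\<close>

lemma cross_cross_left: "(x \<times> y) \<times> z = (x \<bullet> z) *\<^sub>R y - (y \<bullet> z) *\<^sub>R x" for x y z :: R3
  using cross_skew[of "x \<times> y" z] by (simp add: Lagrange inner_commute)

lemmas vector_algebra_simps = cross_add_left cross_add_right Cross3.left_diff_distrib
  Cross3.right_diff_distrib cross_mult_left cross_mult_right Lagrange cross_cross_left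
  inner_add_left inner_add_right inner_diff_left inner_diff_right
  scaleR_add_right scaleR_diff_right scaleR_add_left scaleR_diff_left

text \<open>The Riccati equation \<open>D\<close> for the derivative of \<open>S\<close>, solved for the velocity \<open>V\<close>.  Only the
  component of \<open>V\<close> along \<open>S\<close> is not determined by \<open>S\<close> and \<open>D\<close>.\<close>

lemma riccati_linear_relation:
  fixes S V D :: R3
  assumes S: "S \<bullet> S = 1" and k: "c * c + \<rho> * \<rho> \<noteq> 0"
    and D: "(c * c + \<rho> * \<rho>) *\<^sub>R D = (- 2 * \<rho>) *\<^sub>R (V - (V \<bullet> S) *\<^sub>R S) + (2 * c) *\<^sub>R (V \<times> S)"
  shows "S \<bullet> D = 0"
    and "c *\<^sub>R D + \<rho> *\<^sub>R (S \<times> D) = 2 *\<^sub>R (V \<times> S)"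
    and "2 *\<^sub>R V = (2 * (V \<bullet> S)) *\<^sub>R S + c *\<^sub>R (S \<times> D) - \<rho> *\<^sub>R D"
proof -
  let ?k = "c * c + \<rho> * \<rho>" and ?W = "V - (V \<bullet> S) *\<^sub>R S"
  have "?k * (S \<bullet> D) = S \<bullet> (?k *\<^sub>R D)" by simp
  also have "\<dots> = 0" unfolding D
    by (simp add: inner_add_right inner_diff_right S dot_cross_self inner_commute)
  finally show SD: "S \<bullet> D = 0" using k by (simp only: mult_eq_0_iff simp_thms)
  have SW: "S \<times> ?W = - (V \<times> S)"
    by (simp add: Cross3.right_diff_distrib cross_mult_right flip: cross_skew)
  have SVS: "S \<times> (V \<times> S) = ?W" by (simp add: Lagrange S inner_commute)
  have "?k *\<^sub>R (c *\<^sub>R D + \<rho> *\<^sub>R (S \<times> D)) = c *\<^sub>R (?k *\<^sub>R D) + \<rho> *\<^sub>R (S \<times> (?k *\<^sub>R D))"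
    by (simp add: scaleR_add_right cross_mult_right mult_ac)
  also have "\<dots> = ?k *\<^sub>R (2 *\<^sub>R (V \<times> S))"
    unfolding D cross_add_right cross_mult_right SW SVS
    by (simp add: algebra_simps flip: scaleR_add_left)
  finally show rel: "c *\<^sub>R D + \<rho> *\<^sub>R (S \<times> D) = 2 *\<^sub>R (V \<times> S)"
    using k by (simp only: scaleR_cancel_left simp_thms)
  have "2 *\<^sub>R ?W = S \<times> (2 *\<^sub>R (V \<times> S))" by (simp only: cross_mult_right SVS)
  also have "\<dots> = c *\<^sub>R (S \<times> D) - \<rho> *\<^sub>R D"
    unfolding rel[symmetric] by (simp add: cross_add_right cross_mult_right Lagrange S SD)
  finally show "2 *\<^sub>R V = (2 * (V \<bullet> S)) *\<^sub>R S + c *\<^sub>R (S \<times> D) - \<rho> *\<^sub>R D"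
    by (simp add: algebra_simps)
qed

lemma rotation_about_inner:
  assumes "u \<bullet> u = 1"
  shows "rotation_about u \<theta> p \<bullet> rotation_about u \<theta> q = p \<bullet> q"
proof -
  define C s where "C = cos \<theta>" and "s = sin \<theta>"
  have cs: "C * C + s * s = 1" unfolding C_def s_def by (metis power2_eq_square sin_cos_squared_add2)
  have 1: "p \<bullet> (u \<times> q) = - (q \<bullet> (u \<times> p))"
    by (simp add: cross3_simps)
  have "rotation_about u \<theta> p \<bullet> rotation_about u \<theta> q
    = (C * C + s * s) * (p \<bullet> q) + (1 - C * C - s * s) * (u \<bullet> p) * (u \<bullet> q)"
    unfolding rotation_about_def C_def[symmetric] s_def[symmetric]
    by (simp add: inner_add_left inner_add_right dot_cross dot_cross_self assms inner_commute 1)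
       (simp add: 1 inner_commute[of q u] inner_commute[of p u] algebra_simps)
  then show ?thesis by (simp add: cs algebra_simps)
qed

lemma rotation_about_cross:
  assumes "u \<bullet> u = 1"
  shows "rotation_about u \<theta> p \<times> rotation_about u \<theta> q = rotation_about u \<theta> (p \<times> q)"
proof -
  define C s where "C = cos \<theta>" and "s = sin \<theta>"
  have cs: "s * s = 1 - C * C" unfolding C_def s_def by (metis power2_eq_square sin_squared_eq)
  have 1: "(u \<times> p) \<times> (u \<times> q) = (u \<bullet> (p \<times> q)) *\<^sub>R u"
    by (simp add: vec_eq_iff forall_3 cross_components inner_vec_def sum_3 algebra_simps)
  have 2: "p \<times> q = (u \<bullet> (p \<times> q)) *\<^sub>R u - (u \<bullet> q) *\<^sub>R (u \<times> p) + (u \<bullet> p) *\<^sub>R (u \<times> q)"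
  proof -
    have "u \<times> (u \<times> (p \<times> q)) = (u \<bullet> (p \<times> q)) *\<^sub>R u - p \<times> q"
      by (subst Lagrange) (simp add: assms)
    moreover have "u \<times> (u \<times> (p \<times> q)) = (u \<bullet> q) *\<^sub>R (u \<times> p) - (u \<bullet> p) *\<^sub>R (u \<times> q)"
      by (simp add: Lagrange[of u p q] Cross3.right_diff_distrib cross_mult_right)
    ultimately show ?thesis by (simp add: algebra_simps)
  qed
  have 3: "q \<bullet> (u \<times> p) = u \<bullet> (p \<times> q)"
    by (simp add: inner_vec_def sum_3 cross_components algebra_simps)
  have pu: "p \<times> u = - (u \<times> p)" by (rule cross_skew)
  have "rotation_about u \<theta> p \<times> rotation_about u \<theta> q
    = (C * C) *\<^sub>R (p \<times> q) + (C * s) *\<^sub>R (u \<times> (p \<times> q))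
      + (C * (1 - C)) *\<^sub>R ((u \<bullet> p) *\<^sub>R (u \<times> q) - (u \<bullet> q) *\<^sub>R (u \<times> p))
      + (s * s * (u \<bullet> (p \<times> q))) *\<^sub>R u + (s * (1 - C)) *\<^sub>R ((u \<bullet> q) *\<^sub>R p - (u \<bullet> p) *\<^sub>R q)"
    unfolding rotation_about_def C_def[symmetric] s_def[symmetric]
    by (simp add: cross_add_left cross_add_right cross_mult_left cross_mult_right 1 pu Lagrange
        cross_cross_left assms inner_commute)
       (simp add: algebra_simps inner_commute assms dot_cross_self 3)
  also have "\<dots> = C *\<^sub>R (p \<times> q) + s *\<^sub>R (u \<times> (p \<times> q)) + ((1 - C) * (u \<bullet> (p \<times> q))) *\<^sub>R u"
  proof -
    have e: "(u \<bullet> p) *\<^sub>R (u \<times> q) - (u \<bullet> q) *\<^sub>R (u \<times> p) = p \<times> q - (u \<bullet> (p \<times> q)) *\<^sub>R u"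
      "(u \<bullet> q) *\<^sub>R p - (u \<bullet> p) *\<^sub>R q = u \<times> (p \<times> q)"
      using 2 by (simp_all add: Lagrange algebra_simps)
    show ?thesis unfolding cs e by (simp add: vec_eq_iff algebra_simps)
  qed
  finally show ?thesis by (simp add: rotation_about_def C_def s_def)
qed

lemma orthonormal_expansion:
  fixes T N z :: R3
  assumes "T \<bullet> T = 1" "N \<bullet> N = 1" "N \<bullet> T = 0"
  defines "M \<equiv> T \<times> N"
  shows "z = (z \<bullet> T) *\<^sub>R T + (z \<bullet> N) *\<^sub>R N + (z \<bullet> M) *\<^sub>R M"
    and "M \<bullet> M = 1" "M \<times> T = N" "N \<times> M = T"
proof -
  show MM: "M \<bullet> M = 1" unfolding M_def by (simp add: dot_cross assms inner_commute)
  show MT: "M \<times> T = N" and NM: "N \<times> M = T"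
    unfolding M_def by (simp_all add: Lagrange cross_cross_left assms inner_commute)
  have "M \<times> (z \<times> M) = z - (z \<bullet> M) *\<^sub>R M" by (simp add: Lagrange MM inner_commute)
  moreover have "z \<times> M = (z \<bullet> N) *\<^sub>R T - (z \<bullet> T) *\<^sub>R N" by (simp add: M_def Lagrange)
  ultimately have "z - (z \<bullet> M) *\<^sub>R M = (z \<bullet> N) *\<^sub>R N - (z \<bullet> T) *\<^sub>R (M \<times> N)"
    by (simp add: Cross3.right_diff_distrib cross_mult_right MT)
  moreover have "M \<times> N = - T" using cross_skew[of M N] NM by simp
  ultimately show "z = (z \<bullet> T) *\<^sub>R T + (z \<bullet> N) *\<^sub>R N + (z \<bullet> M) *\<^sub>R M" by (simp add: algebra_simps)
qed

lemma orthonormal_inner: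
  fixes T N z w :: R3
  assumes "T \<bullet> T = 1" "N \<bullet> N = 1" "N \<bullet> T = 0"
  shows "z \<bullet> w = (z \<bullet> T) * (w \<bullet> T) + (z \<bullet> N) * (w \<bullet> N) + (z \<bullet> (T \<times> N)) * (w \<bullet> (T \<times> N))"
  by (subst orthonormal_expansion(1)[OF assms, of z])
     (simp add: inner_add_right inner_commute)

text \<open>If \<open>D\<close> is the derivative of the axis \<open>S\<close>, the vector on the left is the contribution of the
  turning axis to the derivative of the rotated normal.  For the \<open>D\<close> of a Darboux transform it is the
  rotated image of \<open>\<Omega> \<times> N\<close> with \<open>\<Omega>\<close> a multiple of \<open>S \<times> T\<close>, so it does not contribute to the
  torsion.  The proof computes in the frame \<open>T\<close>, \<open>N\<close>, \<open>T \<times> N\<close>.\<close>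

lemma rotation_about_translated_normal:
  fixes S T N :: R3
  assumes S: "S \<bullet> S = 1" and TN: "T \<bullet> T = 1" "N \<bullet> N = 1" "N \<bullet> T = 0"
    and D: "D = sin \<theta> *\<^sub>R (S \<times> T) - (1 - cos \<theta>) *\<^sub>R (T - (S \<bullet> T) *\<^sub>R S)"
  shows "(sin \<theta> *\<^sub>R (D \<times> N) + (1 - cos \<theta>) *\<^sub>R ((D \<bullet> N) *\<^sub>R S + (S \<bullet> N) *\<^sub>R D))
    \<bullet> rotation_about S \<theta> (T \<times> N) = 0"
proof -
  define C s where "C = cos \<theta>" and "s = sin \<theta>"
  have cs: "s * s = 1 - C * C" unfolding C_def s_def by (metis power2_eq_square sin_squared_eq)
  define M where "M = T \<times> N"
  define x y z where "x = S \<bullet> T" and "y = S \<bullet> N" and "z = S \<bullet> M"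
  note frame = orthonormal_expansion[OF TN, folded M_def]
  have c: "T \<times> N = M" "N \<times> T = - M" "M \<times> T = N" "T \<times> M = - N" "N \<times> M = T" "M \<times> N = - T"
    using frame(3,4) cross_skew[of T M] cross_skew[of M N] cross_skew[of N T] by (simp_all add: M_def)
  have i: "T \<bullet> M = 0" "M \<bullet> T = 0" "N \<bullet> M = 0" "M \<bullet> N = 0" "T \<bullet> N = 0"
    using TN by (simp_all add: M_def dot_cross_self inner_commute)
  have Sx: "S = x *\<^sub>R T + y *\<^sub>R N + z *\<^sub>R M" unfolding x_def y_def z_def by (rule frame(1))
  have 1: "x * x + y * y + z * z = 1"
    using S orthonormal_inner[OF TN, of S S] by (simp add: x_def y_def z_def M_def)
  have SM: "S \<times> M = y *\<^sub>R T - x *\<^sub>R N" and ST: "S \<times> T = z *\<^sub>R N - y *\<^sub>R M"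
    by (subst Sx; simp add: cross_add_left cross_mult_left c)+
  define p q r where "p = (1 - C) * (x * x - 1)" and "q = s * z + (1 - C) * x * y" 
    and "r = (1 - C) * x * z - s * y"
  have Dx: "D = p *\<^sub>R T + q *\<^sub>R N + r *\<^sub>R M"
    unfolding D ST x_def[symmetric] C_def[symmetric] s_def[symmetric]
    by (subst Sx) (simp add: p_def q_def r_def algebra_simps)
  have DN: "D \<times> N = p *\<^sub>R M - r *\<^sub>R T" and Dn: "D \<bullet> N = q"
    by (simp_all add: Dx cross_add_left cross_mult_left c inner_add_left i TN)
  have R: "rotation_about S \<theta> M = (s * y + (1 - C) * z * x) *\<^sub>R T + ((1 - C) * z * y - s * x) *\<^sub>R N
     + (C + (1 - C) * z * z) *\<^sub>R M"
    unfolding rotation_about_def SM z_def[symmetric] C_def[symmetric] s_def[symmetric]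
    by (subst Sx) (simp add: algebra_simps)
  have V: "s *\<^sub>R (D \<times> N) + (1 - C) *\<^sub>R ((D \<bullet> N) *\<^sub>R S + (S \<bullet> N) *\<^sub>R D)
    = ((1 - C) * (q * x + y * p) - s * r) *\<^sub>R T + ((1 - C) * (q * y + y * q)) *\<^sub>R N
      + ((1 - C) * (q * z + y * r) + s * p) *\<^sub>R M"
    unfolding DN Dn y_def[symmetric] by (subst Sx, subst Dx) (simp add: vec_eq_iff algebra_simps)
  have "(s *\<^sub>R (D \<times> N) + (1 - C) *\<^sub>R ((D \<bullet> N) *\<^sub>R S + (S \<bullet> N) *\<^sub>R D)) \<bullet> rotation_about S \<theta> M
    = ((1 - C) * (q * x + y * p) - s * r) * (s * y + (1 - C) * z * x)
      + ((1 - C) * (q * y + y * q)) * ((1 - C) * z * y - s * x)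
      + ((1 - C) * (q * z + y * r) + s * p) * (C + (1 - C) * z * z)"
    unfolding V R by (simp add: inner_add_left inner_add_right i TN frame(2))
  also have "\<dots> = 0" unfolding p_def q_def r_def using 1 cs by algebra
  finally show ?thesis by (simp add: C_def s_def M_def)
qed

section \<open>The total torsion\<close>

context equivariant_curve
begin

lemma E_two_param:
  assumes "smooth \<nu>"
  shows "E_two \<tau> x0 \<nu> \<gamma> = integral {x0..\<tau> x0}
    (\<lambda>x. vector_derivative \<nu> (at x) \<bullet> (tangent \<gamma> x \<times> \<nu> x))"
  unfolding E_two_def arc_integral_def
  by (rule arg_cong[of _ _ "integral _"])
     (use speed_pos in \<open>auto simp: arc_deriv_def fun_eq_iff less_imp_neq[symmetric]\<close>)

text \<open>The angle between two normal fields changes at a rate equal to the difference of their torsion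
  densities, and it returns to itself modulo \<^term>\<open>2 * pi\<close> after one period.\<close>

lemma E_two_normal_independent:
  assumes n1: "unit_normal_field \<tau> A \<gamma> n1" and n2: "unit_normal_field \<tau> A \<gamma> n2"
  shows "[E_two \<tau> x0 n2 \<gamma> = E_two \<tau> x0 n1 \<gamma>] (rmod (2 * pi))"
proof -
  let ?T = "tangent \<gamma>"
  define T' n1' n2' where "T' x = vector_derivative ?T (at x)"
    and "n1' x = vector_derivative n1 (at x)" and "n2' x = vector_derivative n2 (at x)" for x
  have smooth: "smooth n1" "smooth n2" using n1 n2 by (auto simp: unit_normal_field_def)
  have der: "(?T has_vector_derivative T' x) (at x)" "(n1 has_vector_derivative n1' x) (at x)"
    "(n2 has_vector_derivative n2' x) (at x)" for x
    unfolding T'_def n1'_def n2'_def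
    by (rule smooth_has_vector_derivative; rule smooth_tangent smooth)+
  have on1: "?T x \<bullet> ?T x = 1" "n1 x \<bullet> n1 x = 1" "n1 x \<bullet> ?T x = 0"
    and on2: "n2 x \<bullet> n2 x = 1" "n2 x \<bullet> ?T x = 0" for x
    using n1 n2 tangent_unit by (auto simp: unit_normal_field_def dot_square_norm)
  define m1 m2 where "m1 x = ?T x \<times> n1 x" and "m2 x = ?T x \<times> n2 x" for x
  define \<delta>1 \<delta>2 where "\<delta>1 x = n1' x \<bullet> m1 x" and "\<delta>2 x = n2' x \<bullet> m2 x" for x
  define p q where "p x = n2 x \<bullet> n1 x" and "q x = n2 x \<bullet> m1 x" for x
  define m1' where "m1' x = ?T x \<times> n1' x + T' x \<times> n1 x" for x
  have m1': "(m1 has_vector_derivative m1' x) (at x)" for x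
    unfolding m1_def[abs_def] m1'_def
    by (rule bounded_bilinear.has_vector_derivative[OF bounded_bilinear_cross3 der(1,2)])
  have zero: "f' \<bullet> g x + f x \<bullet> g' = 0"
    if "(f has_vector_derivative f') (at x)" "(g has_vector_derivative g') (at x)" "\<And>x. f x \<bullet> g x = c"
    for f g :: "real \<Rightarrow> R3" and f' g' x c
  proof -
    have "((\<lambda>x. f x \<bullet> g x) has_vector_derivative f x \<bullet> g' + f' \<bullet> g x) (at x)"
      by (rule bounded_bilinear.has_vector_derivative[OF bounded_bilinear_inner that(1,2)])
    then show ?thesis using that(3) vector_derivative_unique_at[OF _ has_vector_derivative_const]
      by fastforce
  qed
  have mm: "m1 x \<bullet> m1 x = 1" and m1n1: "m1 x \<bullet> n1 x = 0" for x
    using orthonormal_expansion(2)[OF on1] by (simp_all add: m1_def dot_cross_self)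
  have n2_exp: "n2 x = p x *\<^sub>R n1 x + q x *\<^sub>R m1 x" for x
    using orthonormal_expansion(1)[OF on1, of "n2 x" x] on2 by (simp add: p_def q_def m1_def)
  have n2_inner: "n2 x \<bullet> w = p x * (n1 x \<bullet> w) + q x * (m1 x \<bullet> w)" for x w
    by (subst n2_exp) (simp add: inner_add_left)
  have m2_exp: "m2 x = p x *\<^sub>R m1 x - q x *\<^sub>R n1 x" for x
  proof -
    have "?T x \<times> m1 x = - n1 x" by (simp add: m1_def Lagrange on1 inner_commute)
    then show ?thesis unfolding m2_def n2_exp
      by (simp add: cross_add_right cross_mult_right m1_def)
  qed
  have pq: "p x * p x + q x * q x = 1" for x
    using on2(1)[of x] by (subst (asm) (1 2) n2_exp)
      (simp add: inner_add_left inner_add_right on1 mm m1n1 inner_commute)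
  have n2': "n2' x \<bullet> n1 x = - q x * \<delta>2 x" "n2' x \<bullet> m1 x = p x * \<delta>2 x" for x
  proof -
    have "n2' x \<bullet> n2 x = 0" using zero[OF der(3) der(3) on2(1), of x] by (simp add: inner_commute)
    then have "p x * (n2' x \<bullet> n1 x) + q x * (n2' x \<bullet> m1 x) = 0"
      by (subst (asm) n2_exp) (simp add: inner_add_right)
    moreover have "\<delta>2 x = p x * (n2' x \<bullet> m1 x) - q x * (n2' x \<bullet> n1 x)"
      unfolding \<delta>2_def m2_exp by (simp add: inner_diff_right)
    ultimately show "n2' x \<bullet> n1 x = - q x * \<delta>2 x" "n2' x \<bullet> m1 x = p x * \<delta>2 x"
      using pq[of x] by algebra+
  qed
  have n1': "n2 x \<bullet> n1' x = q x * \<delta>1 x" "n2 x \<bullet> m1' x = - p x * \<delta>1 x" for x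
  proof -
    have "n1' x \<bullet> n1 x = 0" using zero[OF der(2) der(2) on1(2), of x] by (simp add: inner_commute)
    moreover have "m1' x \<bullet> m1 x = 0" using zero[OF m1' m1' mm, of x] by (simp add: inner_commute)
    moreover have "m1' x \<bullet> n1 x = - (m1 x \<bullet> n1' x)"
      using zero[OF m1' der(2) m1n1, of x] by linarith
    ultimately show "n2 x \<bullet> n1' x = q x * \<delta>1 x" "n2 x \<bullet> m1' x = - p x * \<delta>1 x"
      unfolding \<delta>1_def n2_inner by (auto simp: inner_commute)
  qed
  define \<delta> where "\<delta> x = \<delta>2 x - \<delta>1 x" for x
  have p': "(p has_real_derivative - q x * \<delta> x) (at x)" for x
    using bounded_bilinear.has_vector_derivative[OF bounded_bilinear_inner der(3) der(2), of x]
    unfolding p_def[abs_def] \<delta>_def has_real_derivative_iff_has_vector_derivative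
    by (simp add: n1' n2' p_def q_def algebra_simps)
  have q': "(q has_real_derivative p x * \<delta> x) (at x)" for x
    using bounded_bilinear.has_vector_derivative[OF bounded_bilinear_inner der(3) m1', of x]
    unfolding q_def[abs_def] \<delta>_def has_real_derivative_iff_has_vector_derivative
    by (simp add: n1' n2' p_def q_def algebra_simps)
  have "Cdiff n n1" "Cdiff n n2" "Cdiff n n1'" "Cdiff n n2'" "Cdiff n ?T" for n
    using smooth smooth_vector_derivative[of n1] smooth_vector_derivative[of n2] smooth_tangent
    by (auto simp: smooth_iff_Cdiff n1'_def[abs_def] n2'_def[abs_def])
  then have Cd: "Cdiff n \<delta>1" "Cdiff n \<delta>2" for n
    unfolding \<delta>1_def[abs_def] \<delta>2_def[abs_def] m1_def m2_def by (auto intro!: Cdiff_inner Cdiff_cross)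
  have cont: "continuous_on X \<delta>1" "continuous_on X \<delta>2" for X
    using Cd[of "Suc 0"] by (auto intro!: continuous_at_imp_continuous_on simp:
        differentiable_imp_continuous_within)
  then have cont\<delta>: "continuous_on X \<delta>" for X
    unfolding \<delta>_def[abs_def] by (intro continuous_intros)
  \<comment> \<open>By \<open>p'\<close> and \<open>q'\<close>, the coordinates \<open>(p, q)\<close> of \<open>n2\<close> rotate with angular velocity \<open>\<delta>\<close>; rotated
    back by the accumulated angle they are constant.\<close>
  define \<theta> where "\<theta> x = integral {x0..x} \<delta>" for x
  let ?I = "{x0..\<tau> x0}"
  have \<theta>': "(\<theta> has_real_derivative \<delta> x) (at x within ?I)" if "x \<in> ?I" for x
    unfolding \<theta>_def has_real_derivative_iff_has_vector_derivative
    by (rule integral_has_vector_derivative[OF cont\<delta> that])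
  have x0: "x0 < \<tau> x0" using translation by (simp add: translation_diffeo_def)
  have per: "p (\<tau> x0) = p x0" "q (\<tau> x0) = q x0"
    using n1 n2 by (simp_all add: p_def q_def m1_def unit_normal_field_def fun_eq_iff
        tangent_translate rot_part_preserves)
  have "((\<lambda>x. p x * cos (\<theta> x) + q x * sin (\<theta> x)) has_vector_derivative 0) (at x within ?I)"
    "((\<lambda>x. q x * cos (\<theta> x) - p x * sin (\<theta> x)) has_vector_derivative 0) (at x within ?I)"
    if x: "x \<in> ?I" for x
    unfolding has_real_derivative_iff_has_vector_derivative[symmetric]
    by (rule derivative_eq_intros \<theta>'[OF x] DERIV_subset[OF p' subset_UNIV]
        DERIV_subset[OF q' subset_UNIV] refl | simp add: algebra_simps)+
  then have const: "p (\<tau> x0) * cos (\<theta> (\<tau> x0)) + q (\<tau> x0) * sin (\<theta> (\<tau> x0)) = p x0 * cos (\<theta> x0)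
      + q x0 * sin (\<theta> x0)"
    "q (\<tau> x0) * cos (\<theta> (\<tau> x0)) - p (\<tau> x0) * sin (\<theta> (\<tau> x0)) = q x0 * cos (\<theta> x0) - p x0 * sin (\<theta> x0)"
    using has_vector_derivative_zero_constant[of ?I "\<lambda>x. p x * cos (\<theta> x) + q x * sin (\<theta> x)"]
      has_vector_derivative_zero_constant[of ?I "\<lambda>x. q x * cos (\<theta> x) - p x * sin (\<theta> x)"] x0
    by (metis (no_types, lifting) atLeastAtMost_iff convex_closed_interval convex_real_interval(5)
        less_imp_le order_refl)+
  have "\<theta> x0 = 0" by (simp add: \<theta>_def)
  with const per have const0: "p x0 * cos (\<theta> (\<tau> x0)) + q x0 * sin (\<theta> (\<tau> x0)) = p x0"
    "q x0 * cos (\<theta> (\<tau> x0)) - p x0 * sin (\<theta> (\<tau> x0)) = q x0"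
    by simp_all
  have "cos (\<theta> (\<tau> x0)) = (p x0 * p x0 + q x0 * q x0) * cos (\<theta> (\<tau> x0))" by (simp add: pq)
  also have "\<dots> = p x0 * (p x0 * cos (\<theta> (\<tau> x0)) + q x0 * sin (\<theta> (\<tau> x0)))
    + q x0 * (q x0 * cos (\<theta> (\<tau> x0)) - p x0 * sin (\<theta> (\<tau> x0)))"
    by (simp add: algebra_simps)
  also have "\<dots> = 1" unfolding const0 by (rule pq)
  finally have "cos (\<theta> (\<tau> x0)) = 1" .
  then obtain n :: int where n: "\<theta> (\<tau> x0) = of_int n * 2 * pi" by (auto simp: cos_one_2pi_int)
  have "\<theta> (\<tau> x0) = E_two \<tau> x0 n2 \<gamma> - E_two \<tau> x0 n1 \<gamma>"
    unfolding \<theta>_def \<delta>_def E_two_param[OF smooth(1)] E_two_param[OF smooth(2)]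
      n1'_def[symmetric] n2'_def[symmetric] m1_def[symmetric] m2_def[symmetric]
      \<delta>1_def[symmetric] \<delta>2_def[symmetric]
    by (rule integral_diff; rule integrable_continuous_interval[OF cont(2)]
        integrable_continuous_interval[OF cont(1)])
  with n show ?thesis
    unfolding rcong_altdef by (intro exI[of _ "- n"]) (simp add: algebra_simps)
qed

end

section \<open>Darboux transforms from solutions of the Riccati equation\<close>

text \<open>With \<open>c + \<i> \<rho> = - 1 / \<mu>\<close> one has \<open>c\<^sup>2 + \<rho>\<^sup>2 = 1 / |\<mu>|\<^sup>2\<close>, so the assumption \<open>riccati\<close> is the
  Riccati equation of the direction field divided by \<open>|\<mu>|\<^sup>2\<close>.\<close>

locale darboux_direction = equivariant_curve +
  fixes c \<rho> :: real and S S' :: "real \<Rightarrow> R3"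
  assumes rho: "\<rho> \<noteq> 0" and S_unit: "S x \<bullet> S x = 1"
    and S_derivative: "(S has_vector_derivative S' x) (at x)"
    and riccati: "(c * c + \<rho> * \<rho>) *\<^sub>R S' x
      = (- 2 * \<rho>) *\<^sub>R (velocity x - (velocity x \<bullet> S x) *\<^sub>R S x) + (2 * c) *\<^sub>R (velocity x \<times> S x)"
    and S_translate: "S (\<tau> x) = rot_part A (S x)"
begin

definition \<eta> :: "real \<Rightarrow> R3" where "\<eta> x = \<gamma> x + \<rho> *\<^sub>R S x"

definition k :: real where "k = c * c + \<rho> * \<rho>"

lemma k_nonzero: "k \<noteq> 0"
  using rho by (simp add: k_def)

lemmas riccati_k = riccati[folded k_def]

lemma S_S': "S x \<bullet> S' x = 0"
  and S'_linear: "c *\<^sub>R S' x + \<rho> *\<^sub>R (S x \<times> S' x) = 2 *\<^sub>R (velocity x \<times> S x)"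
  and velocity_decomposition:
    "2 *\<^sub>R velocity x = (2 * (velocity x \<bullet> S x)) *\<^sub>R S x + c *\<^sub>R (S x \<times> S' x) - \<rho> *\<^sub>R S' x"
  using riccati_linear_relation[OF S_unit k_nonzero[unfolded k_def] riccati] by auto

lemma \<eta>_derivative: "(\<eta> has_vector_derivative velocity x + \<rho> *\<^sub>R S' x) (at x)"
  unfolding \<eta>_def[abs_def]
  using has_vector_derivative_add[OF curve_derivative
      bounded_linear.has_vector_derivative[OF bounded_linear_scaleR_right S_derivative]] .

lemma vector_derivative_\<eta>: "vector_derivative \<eta> (at x) = velocity x + \<rho> *\<^sub>R S' x"
  by (rule vector_derivative_at[OF \<eta>_derivative])

text \<open>The half-angle is the argument of \<open>c - \<i> \<rho>\<close>.\<close>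

definition \<theta> :: real where "\<theta> = (SOME t. cos t = (c * c - \<rho> * \<rho>) / k \<and> sin t = - 2 * c * \<rho> / k)"

lemma cos_\<theta>: "cos \<theta> = (c * c - \<rho> * \<rho>) / k" and sin_\<theta>: "sin \<theta> = - 2 * c * \<rho> / k"
proof -
  have "(c * c - \<rho> * \<rho>)\<^sup>2 + (- 2 * c * \<rho>)\<^sup>2 = k\<^sup>2"
    unfolding k_def by algebra
  then have "((c * c - \<rho> * \<rho>) / k)\<^sup>2 + (- 2 * c * \<rho> / k)\<^sup>2 = 1"
    using k_nonzero by (simp add: power_divide flip: add_divide_distrib)
  then have "\<exists>t. cos t = (c * c - \<rho> * \<rho>) / k \<and> sin t = - 2 * c * \<rho> / k"
    by (metis sincos_total_2pi)
  from someI_ex[OF this] show "cos \<theta> = (c * c - \<rho> * \<rho>) / k" "sin \<theta> = - 2 * c * \<rho> / k"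
    by (auto simp: \<theta>_def)
qed

lemma one_minus_cos_\<theta>: "1 - cos \<theta> = 2 * \<rho> * \<rho> / k"
  using k_nonzero by (simp add: cos_\<theta> field_simps) (simp add: k_def)

lemma rho_S': "\<rho> *\<^sub>R S' x = sin \<theta> *\<^sub>R (S x \<times> velocity x)
  - (1 - cos \<theta>) *\<^sub>R (velocity x - (S x \<bullet> velocity x) *\<^sub>R S x)"
proof -
  note one_minus_cos_\<theta>
  moreover have "\<rho> *\<^sub>R S' x = (\<rho> / k) *\<^sub>R (k *\<^sub>R S' x)" using k_nonzero by simp
  moreover have "(\<rho> / k) *\<^sub>R (k *\<^sub>R S' x) = (- (2 * \<rho> * \<rho> / k)) *\<^sub>R (velocity x
      - (S x \<bullet> velocity x) *\<^sub>R S x)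
    + (- 2 * c * \<rho> / k) *\<^sub>R (S x \<times> velocity x)"
    unfolding riccati_k cross_skew[of "velocity x" "S x"] scaleR_add_right scaleR_scaleR
        inner_commute[of "S x"]
    by (simp add: mult_ac)
  ultimately show ?thesis unfolding sin_\<theta> by (simp add: k_nonzero)
qed

lemma \<eta>_velocity: "vector_derivative \<eta> (at x) = rotation_about (S x) \<theta> (velocity x)"
  unfolding vector_derivative_\<eta> rho_S' rotation_about_def by (simp add: algebra_simps)

lemma speed_\<eta>: "speed \<eta> x = speed \<gamma> x"
  unfolding speed_def \<eta>_velocity norm_eq_sqrt_inner by (simp add: rotation_about_inner[OF S_unit])

lemma rotation_about_linear:
  "rotation_about u t (r *\<^sub>R p) = r *\<^sub>R rotation_about u t p"
  by (simp add: rotation_about_def cross_mult_right scaleR_add_right mult_ac)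

lemma tangent_\<eta>: "tangent \<eta> x = rotation_about (S x) \<theta> (tangent \<gamma> x)"
  unfolding tangent_def arc_deriv_def speed_\<eta> \<eta>_velocity rotation_about_linear ..

lemma dist_\<eta>: "dist (\<eta> x) (\<gamma> x) = \<bar>\<rho>\<bar>"
  by (simp add: \<eta>_def dist_norm norm_eq_sqrt_inner S_unit)

lemma darboux_transform_\<eta>: "darboux_transform \<gamma> \<eta>"
  unfolding darboux_transform_def
proof (rule exI[of _ "\<bar>\<rho>\<bar>"], rule exI[of _ "sgn \<rho> * \<theta>"], intro conjI allI)
  show "\<bar>\<rho>\<bar> \<noteq> 0" using rho by simp
  fix x
  show "norm (\<eta> x - \<gamma> x) = \<bar>\<rho>\<bar>" using dist_\<eta>[of x] by (simp add: dist_norm)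
  show "\<eta> differentiable (at x)" using \<eta>_derivative by (rule differentiableI_vector)
  have "norm (S x) = 1" by (simp add: norm_eq_sqrt_inner S_unit)
  then have "sgn (\<eta> x - \<gamma> x) = sgn \<rho> *\<^sub>R S x"
    by (simp add: \<eta>_def sgn_div_norm sgn_real_def)
  moreover have "rotation_about (sgn \<rho> *\<^sub>R S x) (sgn \<rho> * \<theta>) p = rotation_about (S x) \<theta> p" for p
    using rho by (cases "\<rho> > 0") (auto simp: rotation_about_def)
  moreover have "arc_deriv \<gamma> \<eta> x = tangent \<eta> x"
    by (simp add: tangent_def arc_deriv_def speed_\<eta>)
  ultimately show "arc_deriv \<gamma> \<eta> x = rotation_about (sgn (\<eta> x - \<gamma> x)) (sgn \<rho> * \<theta>) (tangent \<gamma> x)"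
    by (simp add: tangent_\<eta>)
qed

lemma smooth_velocity: "smooth velocity"
  by (rule smooth_vector_derivative[OF smooth_curve])

text \<open>The right-hand side of the Riccati equation is a polynomial in \<open>S\<close> and the smooth velocity.\<close>

lemma smooth_S: "smooth S"
proof (rule smooth_bootstrap[OF S_derivative])
  fix n assume S: "Cdiff n S"
  have S': "S' = (\<lambda>x. (1 / k) *\<^sub>R ((- 2 * \<rho>) *\<^sub>R (velocity x - (velocity x \<bullet> S x) *\<^sub>R S x)
      + (2 * c) *\<^sub>R (velocity x \<times> S x)))"
    unfolding riccati_k[symmetric] using k_nonzero by auto
  have "Cdiff n velocity" using smooth_velocity by (simp add: smooth_iff_Cdiff)
  with S show "Cdiff n S'"
    unfolding S' by (intro Cdiff_scaleR Cdiff_const Cdiff_add Cdiff_diff Cdiff_inner Cdiff_cross)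
qed

lemma \<eta>_immersed: "\<eta> \<in> immersed_curves \<tau> A a"
proof -
  have "Cdiff n \<gamma>" "Cdiff n S" for n using smooth_curve smooth_S by (auto simp: smooth_iff_Cdiff)
  then have "smooth \<eta>"
    unfolding smooth_iff_Cdiff \<eta>_def[abs_def] by (intro allI Cdiff_add Cdiff_scaleR Cdiff_const)
  moreover have "vector_derivative \<eta> (at x) \<noteq> 0" for x
  proof -
    have "speed \<eta> x > 0" by (simp add: speed_\<eta> speed_pos)
    then show ?thesis by (auto simp: speed_def)
  qed
  moreover have "\<eta> \<circ> \<tau> = rigid_motion A a \<circ> \<eta>"
    by (simp add: fun_eq_iff \<eta>_def rigid_motion_def curve_translate S_translate rot_part_linear)
  ultimately show ?thesis by (simp add: immersed_curves_def)
qed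

sublocale darboux: equivariant_curve \<tau> A a \<eta>
  using translation SU2 \<eta>_immersed by unfold_locales

section \<open>Area and volume\<close>

text \<open>In \<open>\<eta> \<times> \<eta>' - \<gamma> \<times> \<gamma>'\<close>, integrating \<open>\<rho> \<gamma> \<times> S'\<close> by parts leaves \<open>\<rho> (2 S \<times> \<gamma>' + \<rho> S \<times> S')\<close>,
  which the linear relation turns into \<open>- \<rho> c S'\<close>.\<close>

lemma E_minus1_\<eta>:
  assumes axis: "is_axis A a b v"
  shows "E_minus1 \<tau> x0 b v \<eta> = E_minus1 \<tau> x0 b v \<gamma>"
proof -
  define \<Phi> where "\<Phi> x = \<rho> * (((\<gamma> x - b) \<times> S x) \<bullet> v) - \<rho> * c * (S x \<bullet> v)" for x
  define \<Phi>' where "\<Phi>' x = \<rho> * (((\<gamma> x - b) \<times> S' x + velocity x \<times> S x) \<bullet> v) - \<rho> * c * (S' x \<bullet> v)" for x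
  have g: "((\<lambda>x. \<gamma> x - b) has_vector_derivative velocity x) (at x)" for x
    using has_vector_derivative_diff[OF curve_derivative has_vector_derivative_const[of b]] by simp
  have "((\<lambda>x. ((\<gamma> x - b) \<times> S x) \<bullet> v) has_vector_derivative ((\<gamma> x - b) \<times> S' x
      + velocity x \<times> S x) \<bullet> v) (at x)" for x
    by (intro bounded_linear.has_vector_derivative[OF bounded_linear_inner_left]
        bounded_bilinear.has_vector_derivative[OF bounded_bilinear_cross3] g S_derivative)
  moreover have "((\<lambda>x. S x \<bullet> v) has_vector_derivative S' x \<bullet> v) (at x)" for x
    by (intro bounded_linear.has_vector_derivative[OF bounded_linear_inner_left] S_derivative)
  ultimately have "(\<Phi> has_real_derivative \<Phi>' x) (at x)" for x
    unfolding \<Phi>_def[abs_def] \<Phi>'_def has_real_derivative_iff_has_vector_derivative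
    by (intro has_vector_derivative_diff has_vector_derivative_mult_right)
  moreover have "\<Phi>' x = ((\<eta> x - b) \<times> vector_derivative \<eta> (at x)) \<bullet> v - ((\<gamma> x - b) \<times> velocity x) \<bullet> v"
      for x
  proof -
    have "\<rho> * ((c *\<^sub>R S' x + \<rho> *\<^sub>R (S x \<times> S' x)) \<bullet> v) = \<rho> * ((2 *\<^sub>R (velocity x \<times> S x)) \<bullet> v)"
      unfolding S'_linear ..
    then show ?thesis
      unfolding \<Phi>'_def vector_derivative_\<eta> cross_skew[of "velocity x" "S x"]
      by (simp add: \<eta>_def vector_algebra_simps algebra_simps)
  qed
  moreover have "\<Phi> (\<tau> x) = \<Phi> x" for x
  proof -
    obtain r where r: "rot_part A b + a = b + r *\<^sub>R v" and v: "rot_part A v = v"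
      using axis by (auto simp: is_axis_def rigid_motion_def)
    have "\<gamma> (\<tau> x) - b = rot_part A (\<gamma> x - b) + r *\<^sub>R v"
      using r by (simp add: curve_translate rot_part_linear algebra_simps)
    moreover have "rot_part A p \<bullet> v = p \<bullet> v" for p
      using rot_part_preserves(1)[of p v] by (simp add: v)
    ultimately show ?thesis
      by (simp add: \<Phi>_def S_translate cross_add_left cross_mult_left rot_part_preserves
          inner_add_left dot_cross_self)
  qed
  ultimately have "integral {x0..\<tau> x0} (\<lambda>x. ((\<eta> x - b) \<times> vector_derivative \<eta> (at x)) \<bullet> v)
    = integral {x0..\<tau> x0} (\<lambda>x. ((\<gamma> x - b) \<times> velocity x) \<bullet> v)"
    by (intro integral_eq_if_periodic_derivative[of \<Phi>]) auto
  then show ?thesis by (simp add: E_minus1_def)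
qed

text \<open>The same integration by parts, one order higher: the linear relation is now used against
  \<open>g \<times> v\<close>, and along \<open>v\<close> to remove the terms of second order in \<open>\<rho>\<close>, after which a multiple of
  \<open>(S', v)\<close> remains.  The potential involves \<open>\<gamma>\<close> only through its component orthogonal to the axis;
  this makes it periodic although the height \<open>(\<gamma> - b, v)\<close> is not.\<close>

lemma E_minus2_\<eta>:
  assumes axis: "is_axis A a b v"
  shows "E_minus2 \<tau> x0 b v \<eta> = E_minus2 \<tau> x0 b v \<gamma>"
proof -
  obtain r where r: "rot_part A b + a = b + r *\<^sub>R v" and v: "rot_part A v = v" and "norm v = 1"
    using axis by (auto simp: is_axis_def rigid_motion_def)
  then have vv: "v \<bullet> v = 1" by (simp add: dot_square_norm)
  define g where "g x = \<gamma> x - b" for x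
  define \<sigma> p q G w where "\<sigma> x = S x \<bullet> v" and "p x = g x \<bullet> v" and "q x = g x \<bullet> S x"
    and "G x = g x \<bullet> g x" and "w x = (g x \<times> v) \<bullet> S x" for x
  define \<Phi> where "\<Phi> x = \<rho> * (G x - p x * p x) * \<sigma> x + \<rho> * \<rho> * \<rho> * (\<sigma> x - \<sigma> x * \<sigma> x * \<sigma> x / 3)
    + \<rho> * \<rho> * (q x - p x * \<sigma> x) * \<sigma> x - \<rho> * c * w x - \<rho> * k * \<sigma> x / 2" for x
  define f where "f = (\<lambda>x. (norm ((\<eta> x - b) - ((\<eta> x - b) \<bullet> v) *\<^sub>R v))\<^sup>2 * (vector_derivative \<eta> (at
      x) \<bullet> v))"
  define h where "h = (\<lambda>x. (norm ((\<gamma> x - b) - ((\<gamma> x - b) \<bullet> v) *\<^sub>R v))\<^sup>2 * (velocity x \<bullet> v))"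
  have norm: "(norm (y - (y \<bullet> v) *\<^sub>R v))\<^sup>2 = y \<bullet> y - (y \<bullet> v) * (y \<bullet> v)" for y
    by (simp add: power2_norm_eq_inner inner_diff_left inner_diff_right vv inner_commute)
  have "(\<Phi> has_real_derivative f x - h x) (at x)" for x
  proof -
    let ?V = "velocity x"
    have g': "(g has_vector_derivative ?V) (at x)"
      unfolding g_def[abs_def]
      using has_vector_derivative_diff[OF curve_derivative has_vector_derivative_const[of b]] by simp
    note inner' = bounded_bilinear.has_vector_derivative[OF bounded_bilinear_inner,
        folded has_real_derivative_iff_has_vector_derivative]
    have \<sigma>': "(\<sigma> has_real_derivative S' x \<bullet> v) (at x)"
      unfolding \<sigma>_def[abs_def] using inner'[OF S_derivative has_vector_derivative_const[of v]] by simp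
    have p': "(p has_real_derivative ?V \<bullet> v) (at x)"
      unfolding p_def[abs_def] using inner'[OF g' has_vector_derivative_const[of v]] by simp
    have q': "(q has_real_derivative g x \<bullet> S' x + ?V \<bullet> S x) (at x)"
      unfolding q_def[abs_def] by (rule inner'[OF g' S_derivative])
    have G': "(G has_real_derivative 2 * (g x \<bullet> ?V)) (at x)"
      unfolding G_def[abs_def] using inner'[OF g' g'] by (simp add: inner_commute)
    have "((\<lambda>x. g x \<times> v) has_vector_derivative ?V \<times> v) (at x)"
      using bounded_bilinear.has_vector_derivative[OF bounded_bilinear_cross3 g'
          has_vector_derivative_const[of v]] by simp
    then have w': "(w has_real_derivative (g x \<times> v) \<bullet> S' x + (?V \<times> v) \<bullet> S x) (at x)"
      unfolding w_def[abs_def] by (rule inner'[OF _ S_derivative])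
    define hh \<sigma>' gV gD t x1 x2 where "hh = ?V \<bullet> v" and "\<sigma>' = S' x \<bullet> v" and "gV = g x \<bullet> ?V"
      and "gD = g x \<bullet> S' x" and "t = ?V \<bullet> S x" and "x1 = (g x \<times> v) \<bullet> S' x"
      and "x2 = (S x \<times> S' x) \<bullet> v"
    have lin: "2 *\<^sub>R (S x \<times> ?V) = - (c *\<^sub>R S' x + \<rho> *\<^sub>R (S x \<times> S' x))"
      unfolding S'_linear cross_skew[of "velocity x" "S x"] by simp
    \<comment> \<open>The linear relation against \<open>g \<times> v\<close> and against \<open>v\<close>, and its solution for the velocity
      against \<open>v\<close>.\<close>
    have R1: "2 * (q x * hh - gV * \<sigma> x) = - (c * x1 + \<rho> * (q x * \<sigma>' - gD * \<sigma> x))"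
    proof -
      have "(g x \<times> v) \<bullet> (2 *\<^sub>R (S x \<times> ?V)) = 2 * (q x * hh - gV * \<sigma> x)"
        by (simp add: dot_cross q_def hh_def gV_def \<sigma>_def inner_commute)
      then show ?thesis
        unfolding lin inner_minus_right by (simp add: dot_cross inner_add_right inner_diff_right
            algebra_simps x1_def q_def \<sigma>'_def gD_def \<sigma>_def inner_commute)
    qed
    have R2: "2 * hh = 2 * t * \<sigma> x + c * x2 - \<rho> * \<sigma>'"
      using arg_cong[OF velocity_decomposition[of x], of "\<lambda>y. y \<bullet> v"]
      by (simp add: inner_add_left inner_diff_left hh_def t_def \<sigma>_def x2_def \<sigma>'_def)
    have R3: "2 * ((?V \<times> v) \<bullet> S x) = - (c * \<sigma>' + \<rho> * x2)"
    proof -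
      have "(?V \<times> v) \<bullet> S x = (S x \<times> ?V) \<bullet> v" by (metis cross_triple)
      then show ?thesis
        using arg_cong[OF lin, of "\<lambda>y. y \<bullet> v"] by (simp add: inner_add_left inner_diff_left \<sigma>'_def
            x2_def)
    qed
    have fh: "f x - h x =
      (G x + 2 * \<rho> * q x + \<rho> * \<rho> - (p x + \<rho> * \<sigma> x) * (p x + \<rho> * \<sigma> x))
        * (hh + \<rho> * \<sigma>')
      - (G x - p x * p x) * hh"
    proof -
      have e: "\<eta> x - b = g x + \<rho> *\<^sub>R S x" by (simp add: \<eta>_def g_def)
      show ?thesis
        unfolding f_def h_def norm e g_def[symmetric] vector_derivative_\<eta>
        by (simp add: inner_add_left inner_add_right S_unit G_def q_def p_def \<sigma>_def hh_def \<sigma>'_def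
            inner_commute)
    qed
    have "f x - h x =
      (\<rho> * (2 * gV - 2 * p x * hh) * \<sigma> x + \<rho> * (G x - p x * p x) * \<sigma>')
      + \<rho> * \<rho> * \<rho> * (\<sigma>' - \<sigma> x * \<sigma> x * \<sigma>')
      + \<rho> * \<rho> * ((gD + t - hh * \<sigma> x - p x * \<sigma>') * \<sigma> x + (q x - p x * \<sigma> x) * \<sigma>')
      - \<rho> * c * (x1 + (?V \<times> v) \<bullet> S x) - \<rho> * k * \<sigma>' / 2"
      unfolding fh k_def using R1 R2 R3 by algebra
    moreover have "(\<Phi> has_real_derivative \<dots>) (at x)"
      unfolding \<Phi>_def[abs_def] hh_def \<sigma>'_def gV_def gD_def t_def x1_def
      by (rule derivative_eq_intros \<sigma>' p' q' G' w' refl | simp)+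
         (simp add: algebra_simps)
    ultimately show ?thesis by simp
  qed
  moreover have "\<Phi> (\<tau> x) = \<Phi> x" for x
  proof -
    have g: "g (\<tau> x) = rot_part A (g x) + r *\<^sub>R v"
      using r by (simp add: g_def curve_translate rot_part_linear algebra_simps)
    have rv: "rot_part A y \<bullet> v = y \<bullet> v" "v \<bullet> rot_part A y = v \<bullet> y" for y
      using rot_part_preserves(1)[of y v] by (simp_all add: v inner_commute)
    have rw: "rot_part A y \<times> v = rot_part A (y \<times> v)" for y
      using rot_part_preserves(2)[of y v] by (simp add: v)
    have "\<sigma> (\<tau> x) = \<sigma> x" "p (\<tau> x) = p x + r" "q (\<tau> x) = q x + r * \<sigma> x" "w (\<tau> x) = w x"
      "G (\<tau> x) = G x + 2 * r * p x + r * r"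
      by (simp_all add: \<sigma>_def p_def q_def w_def G_def g S_translate inner_add_left inner_add_right
          rv rw rot_part_preserves vv cross_add_left cross_mult_left inner_commute)
    then show ?thesis by (simp add: \<Phi>_def algebra_simps)
  qed
  ultimately have "integral {x0..\<tau> x0} f = integral {x0..\<tau> x0} h"
    by (intro integral_eq_if_periodic_derivative[of \<Phi>]) auto
  then show ?thesis by (simp add: E_minus2_def f_def h_def)
qed


section \<open>Torsion\<close>

lemma rotation_about_equivariant:
  "rotation_about (rot_part A u) t (rot_part A p) = rot_part A (rotation_about u t p)"
  by (simp add: rotation_about_def rot_part_preserves rot_part_linear)

lemma rotated_normal_field:
  assumes "unit_normal_field \<tau> A \<gamma> \<nu>"
  shows "unit_normal_field \<tau> A \<eta> (\<lambda>x. rotation_about (S x) \<theta> (\<nu> x))"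
proof -
  have "Cdiff n \<nu>" "Cdiff n S" for n
    using assms smooth_S by (auto simp: unit_normal_field_def smooth_iff_Cdiff)
  then have "smooth (\<lambda>x. rotation_about (S x) \<theta> (\<nu> x))"
    unfolding smooth_iff_Cdiff rotation_about_def
    by (intro allI Cdiff_add Cdiff_scaleR Cdiff_const Cdiff_cross Cdiff_mult Cdiff_inner)
  moreover have "norm (rotation_about (S x) \<theta> (\<nu> x)) = norm (\<nu> x)" for x
    by (simp add: norm_eq_sqrt_inner rotation_about_inner S_unit)
  ultimately show ?thesis
    using assms
    by (simp add: unit_normal_field_def tangent_\<eta> rotation_about_inner S_unit fun_eq_iff
        S_translate rotation_about_equivariant)
qed

lemma rotated_normal_torsion:
  assumes "unit_normal_field \<tau> A \<gamma> \<nu>"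
  shows "vector_derivative (\<lambda>x. rotation_about (S x) \<theta> (\<nu> x)) (at x)
      \<bullet> (tangent \<eta> x \<times> rotation_about (S x) \<theta> (\<nu> x))
    = vector_derivative \<nu> (at x) \<bullet> (tangent \<gamma> x \<times> \<nu> x)"
proof -
  define \<nu>' where "\<nu>' = vector_derivative \<nu> (at x)"
  have \<nu>': "(\<nu> has_vector_derivative \<nu>') (at x)"
    and n: "\<nu> x \<bullet> \<nu> x = 1" "\<nu> x \<bullet> tangent \<gamma> x = 0"
    using assms by (auto simp: unit_normal_field_def \<nu>'_def dot_square_norm intro:
        smooth_has_vector_derivative)
  let ?W = "\<lambda>D. sin \<theta> *\<^sub>R (D \<times> \<nu> x) + (1 - cos \<theta>) *\<^sub>R ((D \<bullet> \<nu> x) *\<^sub>R S x + (S x \<bullet> \<nu> x) *\<^sub>R D)"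
  let ?M = "rotation_about (S x) \<theta> (tangent \<gamma> x \<times> \<nu> x)"
  note inner' = bounded_bilinear.has_vector_derivative[OF bounded_bilinear_inner,
        folded has_real_derivative_iff_has_vector_derivative]
  note cross' = bounded_bilinear.has_vector_derivative[OF bounded_bilinear_cross3]
  have "((\<lambda>x. ((1 - cos \<theta>) * (S x \<bullet> \<nu> x)) *\<^sub>R S x) has_vector_derivative
    ((1 - cos \<theta>) * (S x \<bullet> \<nu> x)) *\<^sub>R S' x + ((1 - cos \<theta>) * (S x \<bullet> \<nu>' + S' x \<bullet> \<nu> x)) *\<^sub>R S x) (at x)"
    by (intro has_vector_derivative_scaleR DERIV_cmult inner' S_derivative \<nu>')
  then have "((\<lambda>x. rotation_about (S x) \<theta> (\<nu> x)) has_vector_derivative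
    cos \<theta> *\<^sub>R \<nu>' + sin \<theta> *\<^sub>R (S x \<times> \<nu>' + S' x \<times> \<nu> x)
    + (((1 - cos \<theta>) * (S x \<bullet> \<nu> x)) *\<^sub>R S' x + ((1 - cos \<theta>) * (S x \<bullet> \<nu>'
        + S' x \<bullet> \<nu> x)) *\<^sub>R S x)) (at x)"
    unfolding rotation_about_def
    by (intro has_vector_derivative_add cross' S_derivative \<nu>'
        bounded_linear.has_vector_derivative[OF bounded_linear_scaleR_right])
  then have "vector_derivative (\<lambda>x. rotation_about (S x) \<theta> (\<nu> x)) (at x)
    = rotation_about (S x) \<theta> \<nu>' + ?W (S' x)"
    by (simp add: vector_derivative_at rotation_about_def vec_eq_iff algebra_simps)
  moreover have "tangent \<eta> x \<times> rotation_about (S x) \<theta> (\<nu> x) = ?M"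
    by (simp add: tangent_\<eta> rotation_about_cross S_unit)
  moreover have "?W (S' x) \<bullet> ?M = 0"
  proof -
    define r where "r = \<rho> / speed \<gamma> x"
    have r: "r \<noteq> 0" using rho speed_pos[of x] by (simp add: r_def)
    have "r *\<^sub>R S' x = (1 / speed \<gamma> x) *\<^sub>R (\<rho> *\<^sub>R S' x)" by (simp add: r_def)
    also have "\<dots> = sin \<theta> *\<^sub>R (S x \<times> tangent \<gamma> x)
      - (1 - cos \<theta>) *\<^sub>R (tangent \<gamma> x - (S x \<bullet> tangent \<gamma> x) *\<^sub>R S x)"
      unfolding rho_S' velocity_eq using speed_pos[of x]
      by (simp add: cross_mult_right scaleR_diff_right)
    finally have "?W (r *\<^sub>R S' x) \<bullet> ?M = 0"
      by (intro rotation_about_translated_normal S_unit tangent_unit n)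
    moreover have "?W (r *\<^sub>R S' x) = r *\<^sub>R ?W (S' x)"
      by (simp add: cross_mult_left vec_eq_iff algebra_simps)
    ultimately show ?thesis using r by simp
  qed
  ultimately show ?thesis
    by (simp add: inner_add_left rotation_about_inner S_unit \<nu>'_def)
qed

lemma E_two_\<eta>:
  assumes "unit_normal_field \<tau> A \<gamma> \<nu>" "unit_normal_field \<tau> A \<eta> \<nu>'"
  shows "[E_two \<tau> x0 \<nu>' \<eta> = E_two \<tau> x0 \<nu> \<gamma>] (rmod (2 * pi))"
proof -
  let ?n = "\<lambda>x. rotation_about (S x) \<theta> (\<nu> x)"
  have n: "unit_normal_field \<tau> A \<eta> ?n" by (rule rotated_normal_field[OF assms(1)])
  have "E_two \<tau> x0 ?n \<eta> = E_two \<tau> x0 \<nu> \<gamma>"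
    using n assms(1)
    by (simp add: darboux.E_two_param E_two_param unit_normal_field_def
        rotated_normal_torsion[OF assms(1)])
  then show ?thesis using darboux.E_two_normal_independent[OF n assms(2), of x0] by (simp only:)
qed

end

section \<open>Vector algebra over a commutative ring\<close>

definition dot3 :: "'a::comm_ring_1 ^ 3 \<Rightarrow> 'a ^ 3 \<Rightarrow> 'a" where
  "dot3 u v = u $ 1 * v $ 1 + u $ 2 * v $ 2 + u $ 3 * v $ 3"

definition crs3 :: "'a::comm_ring_1 ^ 3 \<Rightarrow> 'a ^ 3 \<Rightarrow> 'a ^ 3" where
  "crs3 u v = vector [u $ 2 * v $ 3 - u $ 3 * v $ 2, u $ 3 * v $ 1 - u $ 1 * v $ 3, u $ 1 * v $ 2
      - u $ 2 * v $ 1]"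

lemma dot3_commute: "dot3 u v = dot3 v u"
  by (simp add: dot3_def mult.commute)

lemma dot3_linear:
  "dot3 (u + v) w = dot3 u w + dot3 v w" "dot3 (u - v) w = dot3 u w - dot3 v w" "dot3 (r *s u) w
      = r * dot3 u w"
  "dot3 w (u + v) = dot3 w u + dot3 w v" "dot3 w (u - v) = dot3 w u - dot3 w v" "dot3 w (r *s u)
      = r * dot3 w u"
  "dot3 (- u) w = - dot3 u w" "dot3 w (- u) = - dot3 w u"
  by (simp_all add: dot3_def algebra_simps)

lemma crs3_linear:
  "crs3 (u + v) w = crs3 u w + crs3 v w" "crs3 (u - v) w = crs3 u w - crs3 v w" "crs3 (r *s u) w
      = r *s crs3 u w"
  "crs3 w (u + v) = crs3 w u + crs3 w v" "crs3 w (u - v) = crs3 w u - crs3 w v" "crs3 w (r *s u)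
      = r *s crs3 w u"
  "crs3 (- u) w = - crs3 u w" "crs3 w (- u) = - crs3 w u"
  by (simp_all add: crs3_def vec_eq_iff forall_3 algebra_simps)

lemma crs3_crs3:
  "crs3 u (crs3 v w) = dot3 u w *s v - dot3 u v *s w"
  "crs3 (crs3 u v) w = dot3 u w *s v - dot3 v w *s u"
  by (simp_all add: crs3_def dot3_def vec_eq_iff forall_3 algebra_simps)

lemma crs3_self: "crs3 u u = 0"
  by (simp add: crs3_def vec_eq_iff forall_3)

lemma crs3_skew: "crs3 v u = - crs3 u v"
  by (simp add: crs3_def vec_eq_iff forall_3)

lemma dot3_crs3_self: "dot3 u (crs3 u v) = 0" "dot3 u (crs3 v u) = 0" "dot3 (crs3 u v) u
      = 0" "dot3 (crs3 v u) u = 0"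
  by (simp_all add: crs3_def dot3_def algebra_simps)

lemma dot3_crs3_rotate: "dot3 u (crs3 v w) = dot3 (crs3 u v) w"
  by (simp add: crs3_def dot3_def algebra_simps)

lemma dot3_crs3_crs3: "dot3 (crs3 u v) (crs3 w x) = dot3 u w * dot3 v x - dot3 u x * dot3 v w"
  by (simp add: crs3_def dot3_def algebra_simps)

text \<open>A product of two determinants is the determinant of the inner products.\<close>

lemma dot3_crs3_gram:
  "dot3 u (crs3 v w) * dot3 x (crs3 v w) =
    dot3 u x * (dot3 v v * dot3 w w - dot3 v w * dot3 v w)
    - dot3 u v * (dot3 x v * dot3 w w - dot3 v w * dot3 x w)
    + dot3 u w * (dot3 x v * dot3 v w - dot3 v v * dot3 x w)"
  by (simp add: crs3_def dot3_def algebra_simps)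

text \<open>Conjugation by the quaternion with scalar part \<open>\<alpha>\<close> and vector part \<open>\<rho> S\<close>, scaled by its
  squared norm \<open>\<alpha>\<^sup>2 + \<rho>\<^sup>2\<close>.\<close>

definition qrot :: "'a::comm_ring_1 \<Rightarrow> 'a \<Rightarrow> 'a ^ 3 \<Rightarrow> 'a ^ 3 \<Rightarrow> 'a ^ 3" where
  "qrot \<alpha> \<rho> S Y = (\<alpha> * \<alpha> - \<rho> * \<rho>) *s Y + (2 * \<rho> * \<rho> * dot3 S Y) *s S - (2 * \<alpha> * \<rho>) *s crs3 S Y"

lemma qrot_dot3:
  assumes "dot3 S S = 1"
  shows "dot3 (qrot \<alpha> \<rho> S Y) (qrot \<alpha> \<rho> S Y) = (\<alpha> * \<alpha> + \<rho> * \<rho>) * (\<alpha> * \<alpha> + \<rho> * \<rho>) * dot3 Y Y"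
proof -
  have e: "dot3 (crs3 S Y) (crs3 S Y) = dot3 Y Y - dot3 S Y * dot3 S Y"
    by (simp add: dot3_crs3_crs3 assms dot3_commute)
  show ?thesis
    unfolding qrot_def
    by (simp add: dot3_linear dot3_crs3_self e assms dot3_commute[of Y S])
       (simp add: algebra_simps)
qed

context
  fixes S D V Y :: "'a::comm_ring_1 ^ 3" and \<alpha> c \<rho> t :: 'a
  assumes SS: "dot3 S S = 1" and SD: "dot3 S D = 0"
    and V: "2 *s V = (2 * t) *s S + c *s crs3 S D - \<rho> *s D"
begin

text \<open>The relation on \<open>V\<close> makes the quaternion \<open>G = \<alpha> + \<rho> S\<close> a solution of the gauge equation
  \<open>(\<alpha> - c) \<rho> D = G (V + \<rho> D) - V G\<close>.  Below this is applied with \<open>\<alpha> - c = 2 z\<close>; the two lemmas are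
  its consequences for the conjugate of \<open>Y\<close> by \<open>G\<close>, first for its derivative and then for its
  component along the new velocity.  Both are stated with \<open>2 V\<close>, as two need not be invertible.\<close>

lemma darboux_gauge:
  "qrot \<alpha> \<rho> S (crs3 (2 *s V) Y) - (\<alpha> - c) *s ((2 * \<rho> * \<rho>) *s (dot3 D Y *s S + dot3 S Y *s D)
      - (2 * \<alpha> * \<rho>) *s crs3 D Y)
    = crs3 (2 *s V + (2 * \<rho>) *s D) (qrot \<alpha> \<rho> S Y)"
proof -
  define B y d e where "B = crs3 S D" and "y = dot3 S Y" and "d = dot3 D Y" and "e = dot3 B Y"
  have DS: "dot3 D S = 0" using SD by (simp add: dot3_commute)
  have BS: "crs3 B S = D" and DxS: "crs3 D S = - B" and SB: "crs3 S B = - D"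
    by (simp_all add: B_def crs3_crs3 SS SD DS crs3_skew[of D S])
  have BY: "crs3 B Y = y *s D - d *s S" by (simp add: B_def crs3_crs3 y_def d_def)
  have SDY: "dot3 S (crs3 D Y) = e" by (simp add: dot3_crs3_rotate e_def B_def)
  have "crs3 S (crs3 S (crs3 D Y)) = e *s S - crs3 D Y"
    unfolding crs3_crs3(1)[of S S "crs3 D Y"] SDY SS by simp
  moreover have "crs3 S (crs3 D Y) = y *s D" by (simp add: crs3_crs3 SD y_def)
  ultimately have DY: "crs3 D Y = e *s S - y *s B" by (simp add: crs3_linear B_def algebra_simps)
  have SSY: "crs3 S (crs3 S Y) = y *s S - Y" by (simp add: crs3_crs3 SS y_def)
  have BSY: "crs3 B (crs3 S Y) = e *s S"
    by (simp add: crs3_crs3 e_def B_def dot3_crs3_self)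
  have DSY: "crs3 D (crs3 S Y) = d *s S" by (simp add: crs3_crs3 DS d_def)
  have Sdot: "dot3 S B = 0" "dot3 S (crs3 S Y) = 0" by (simp_all add: B_def dot3_crs3_self)
  show ?thesis
    unfolding V qrot_def B_def[symmetric] y_def[symmetric] d_def[symmetric]
    by (simp add: crs3_linear dot3_linear BY DY SSY BSY DSY BS DxS SB SS SD Sdot crs3_self
        B_def[symmetric])
       (simp add: vec_eq_iff algebra_simps)
qed

lemma darboux_inner:
  "dot3 (2 *s V + (2 * \<rho>) *s D) (qrot \<alpha> \<rho> S Y) - (\<alpha> * \<alpha> + \<rho> * \<rho>) * dot3 (2 *s V) Y
    = 2 * \<rho> * (\<alpha> - c) * ((\<alpha> - c) * dot3 D Y - dot3 S (crs3 (2 *s V) Y))"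
proof -
  define B y d e where "B = crs3 S D" and "y = dot3 S Y" and "d = dot3 D Y" and "e = dot3 B Y"
  have DS: "dot3 D S = 0" using SD by (simp add: dot3_commute)
  have 1: "dot3 B S = 0" "dot3 S (crs3 S Y) = 0" by (simp_all add: B_def dot3_crs3_self)
  have 2: "dot3 B (crs3 S Y) = d" by (simp add: B_def dot3_crs3_crs3 SS d_def DS)
  have 3: "dot3 D (crs3 S Y) = - e"
    by (simp add: dot3_crs3_rotate crs3_skew[of D S] dot3_linear e_def B_def)
  have 4: "dot3 S (crs3 D Y) = e" by (simp add: dot3_crs3_rotate e_def B_def)
  have 5: "dot3 S (crs3 B Y) = - d" by (simp add: B_def crs3_crs3 dot3_linear SS SD d_def)
  show ?thesis
    unfolding V qrot_def B_def[symmetric]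
    by (simp add: dot3_linear crs3_linear 1 2 3 4 5 SS DS y_def[symmetric] d_def[symmetric]
        e_def[symmetric])
       (simp add: algebra_simps)
qed

end

section \<open>Families of formal power series\<close>

definition const_series :: "R3 \<Rightarrow> real fps ^ 3" where
  "const_series p = (\<chi> i. fps_const (p $ i))"

definition series_coeff :: "nat \<Rightarrow> real fps ^ 3 \<Rightarrow> R3" where
  "series_coeff n Y = (\<chi> i. fps_nth (Y $ i) n)"

lemma dot3_const_series: "dot3 (const_series p) (const_series q) = fps_const (p \<bullet> q)"
  by (simp add: dot3_def const_series_def inner_vec_def sum_3)

lemma crs3_const_series: "crs3 (const_series p) (const_series q) = const_series (p \<times> q)"
  by (simp add: crs3_def const_series_def cross3_def vec_eq_iff forall_3)

lemma const_series_linear: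
  "const_series (p + q) = const_series p + const_series q" "const_series (p - q) = const_series p
      - const_series q"
  "const_series (r *\<^sub>R p) = fps_const r *s const_series p"
  by (simp_all add: const_series_def vec_eq_iff)

lemma dot3_const_series_nth: "fps_nth (dot3 (const_series p) Y) n = p \<bullet> series_coeff n Y"
  by (simp add: dot3_def const_series_def series_coeff_def inner_vec_def sum_3)

lemma crs3_const_series_nth: "series_coeff n (crs3 (const_series p) Y) = p \<times> series_coeff n Y"
  by (simp add: crs3_def const_series_def series_coeff_def cross3_def vec_eq_iff forall_3)

lemma dot3_nth: "fps_nth (dot3 Y Z) n = (\<Sum>i=0..n. series_coeff i Y \<bullet> series_coeff (n - i) Z)"
  by (simp add: dot3_def series_coeff_def inner_vec_def sum_3 fps_mult_nth sum.distrib)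

lemma series_coeff_linear:
  "series_coeff n (Y + Z) = series_coeff n Y + series_coeff n Z"
  "series_coeff n (- Y) = - series_coeff n Y"
  "series_coeff n (fps_const r *s Y) = r *\<^sub>R series_coeff n Y"
  by (simp_all add: series_coeff_def vec_eq_iff)

lemma series_coeff_X: "series_coeff 0 (fps_X *s Y) = 0" "series_coeff (Suc n) (fps_X *s Y)
      = series_coeff n Y"
  by (simp_all add: series_coeff_def vec_eq_iff)

lemma series_eqI: "(\<And>n. series_coeff n Y = series_coeff n Z) \<Longrightarrow> Y = Z"
  by (simp add: series_coeff_def vec_eq_iff fps_eq_iff)

text \<open>The derivative of a family of series with respect to its real parameter is taken coefficient by
  coefficient.  It has nothing to do with the formal derivative in the variable of the series.\<close>

definition has_coeff_derivative :: "(real \<Rightarrow> real fps) \<Rightarrow> real fps \<Rightarrow> real \<Rightarrow> bool" where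
  "has_coeff_derivative f f' x \<longleftrightarrow>
    (\<forall>n. ((\<lambda>x. fps_nth (f x) n) has_real_derivative fps_nth f' n) (at x))"

definition has_series_derivative :: "(real \<Rightarrow> real fps ^ 3) \<Rightarrow> real fps ^ 3 \<Rightarrow> real \<Rightarrow> bool" where
  "has_series_derivative Y Y' x \<longleftrightarrow> (\<forall>i. has_coeff_derivative (\<lambda>x. Y x $ i) (Y' $ i) x)"

lemma has_coeff_derivative_const: "has_coeff_derivative (\<lambda>x. c) 0 x"
  by (simp add: has_coeff_derivative_def)

lemma has_coeff_derivative_unique:
  "has_coeff_derivative f f' x \<Longrightarrow> has_coeff_derivative f g' x \<Longrightarrow> f' = g'"
  unfolding has_coeff_derivative_def fps_eq_iff using DERIV_unique by blast

lemma has_coeff_derivative_add: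
  "has_coeff_derivative f f' x \<Longrightarrow> has_coeff_derivative g g' x \<Longrightarrow>
    has_coeff_derivative (\<lambda>x. f x + g x) (f' + g') x"
  by (simp add: has_coeff_derivative_def DERIV_add)

lemma has_coeff_derivative_diff:
  "has_coeff_derivative f f' x \<Longrightarrow> has_coeff_derivative g g' x \<Longrightarrow>
    has_coeff_derivative (\<lambda>x. f x - g x) (f' - g') x"
  by (simp add: has_coeff_derivative_def DERIV_diff)

lemma has_coeff_derivative_mult:
  assumes "has_coeff_derivative f f' x" "has_coeff_derivative g g' x"
  shows "has_coeff_derivative (\<lambda>x. f x * g x) (f' * g x + f x * g') x"
  unfolding has_coeff_derivative_def
proof
  fix n
  have "((\<lambda>x. \<Sum>i=0..n. fps_nth (f x) i * fps_nth (g x) (n - i)) has_real_derivative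
    (\<Sum>i=0..n. fps_nth f' i * fps_nth (g x) (n - i) + fps_nth g' (n - i) * fps_nth (f x) i)) (at x)"
    using assms by (intro DERIV_sum DERIV_mult) (auto simp: has_coeff_derivative_def)
  then show "((\<lambda>x. fps_nth (f x * g x) n) has_real_derivative fps_nth (f' * g x + f x * g') n) (at x)"
    by (simp add: fps_mult_nth sum.distrib mult.commute[of "fps_nth g' _"])
qed

lemma has_coeff_derivative_cmult:
  "has_coeff_derivative f f' x \<Longrightarrow> has_coeff_derivative (\<lambda>x. c * f x) (c * f') x"
  using has_coeff_derivative_mult[OF has_coeff_derivative_const, of f f' x c] by simp

text \<open>The coefficients of an inverse are determined recursively, whence their differentiability; the
  product rule then yields the derivative.\<close>

lemma has_coeff_derivative_inverse:
  assumes f: "has_coeff_derivative f f' x" and nz: "\<And>x. fps_nth (f x) 0 \<noteq> 0"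
  shows "has_coeff_derivative (\<lambda>x. inverse (f x)) (- (f' * inverse (f x) * inverse (f x))) x"
proof -
  let ?g = "\<lambda>x. inverse (f x)"
  have inv: "f y * ?g y = 1" for y using inverse_mult_eq_1[OF nz] by (simp add: mult.commute)
  have "\<exists>d. ((\<lambda>x. fps_nth (?g x) n) has_real_derivative d) (at x)" for n
  proof (induction n rule: less_induct)
    case (less n)
    show ?case
    proof (cases n)
      case 0
      have "((\<lambda>x. inverse (fps_nth (f x) 0)) has_real_derivative
        - (inverse ((fps_nth (f x) 0)\<^sup>2) * fps_nth f' 0)) (at x)"
        using f nz by (auto simp: has_coeff_derivative_def power2_eq_square intro!:
            derivative_eq_intros)
      then show ?thesis using 0 by auto
    next
      case (Suc m)
      have "fps_nth (?g y) n = - (\<Sum>i=1..n. fps_nth (f y) i * fps_nth (?g y) (n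
          - i)) * (1 / fps_nth (f y) 0)" for y
      proof -
        have "0 = fps_nth (f y * ?g y) n" using inv[of y] Suc by simp
        also have "\<dots> = fps_nth (f y) 0 * fps_nth (?g y) n + (\<Sum>i=1..n. fps_nth (f y) i * fps_nth (?g
            y) (n - i))"
          unfolding fps_mult_nth by (simp add: sum.atLeast_Suc_atMost)
        finally show ?thesis using nz[of y] by (simp add: field_simps)
      qed
      moreover have "\<exists>d. \<forall>i\<in>{1..n}. ((\<lambda>y. fps_nth (?g y) (n - i)) has_real_derivative d i) (at x)"
        using less.IH by (intro bchoice) auto
      then obtain d where d: "\<forall>i\<in>{1..n}. ((\<lambda>y. fps_nth (?g y) (n - i))
          has_real_derivative d i) (at x)" ..
      have "((\<lambda>y. - (\<Sum>i=1..n. fps_nth (f y) i * fps_nth (?g y) (n - i)) * (1 / fps_nth (f y) 0))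
          has_real_derivative
        - (\<Sum>i=1..n. fps_nth f' i * fps_nth (?g x) (n - i) + d i * fps_nth (f x) i) * (1 / fps_nth (f
            x) 0)
        + (- (fps_nth f' 0 / (fps_nth (f x) 0 * fps_nth (f x) 0))) *
            - (\<Sum>i=1..n. fps_nth (f x) i * fps_nth (?g x) (n - i))) (at x)"
        using f nz d
        by (intro DERIV_mult DERIV_minus DERIV_sum) (auto simp:
            has_coeff_derivative_def intro!: derivative_eq_intros)
      ultimately show ?thesis by auto
    qed
  qed
  then obtain d where "\<And>n. ((\<lambda>x. fps_nth (?g x) n) has_real_derivative d n) (at x)" by metis
  then have g: "has_coeff_derivative ?g (Abs_fps d) x" by (simp add: has_coeff_derivative_def)
  have "f' * ?g x + f x * Abs_fps d = 0"
    using has_coeff_derivative_mult[OF f g] has_coeff_derivative_const[of 1 x]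
    unfolding inv by (rule has_coeff_derivative_unique)
  then have "?g x * (f' * ?g x) + (f x * ?g x) * Abs_fps d = 0"
    by (metis distrib_left mult.assoc mult.commute mult_zero_right)
  then have "Abs_fps d = - (f' * ?g x * ?g x)" unfolding inv
      by (simp add: eq_neg_iff_add_eq_0 algebra_simps)
  with g show ?thesis by simp
qed

lemma has_coeff_derivative_deriv:
  "has_coeff_derivative f f' x \<Longrightarrow> has_coeff_derivative (\<lambda>x. fps_deriv (f x)) (fps_deriv f') x"
  by (simp add: has_coeff_derivative_def DERIV_cmult)

lemma has_series_derivative_const_series:
  "(p has_vector_derivative p') (at x) \<Longrightarrow> has_series_derivative (\<lambda>x. const_series (p x))
      (const_series p') x"
  by (auto simp: has_series_derivative_def has_coeff_derivative_def const_series_def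
      has_vector_derivative_vec_iff)

lemma has_series_derivative_add:
  "has_series_derivative Y Y' x \<Longrightarrow> has_series_derivative Z Z' x \<Longrightarrow>
    has_series_derivative (\<lambda>x. Y x + Z x) (Y' + Z') x"
  by (simp add: has_series_derivative_def has_coeff_derivative_add)

lemma has_series_derivative_diff:
  "has_series_derivative Y Y' x \<Longrightarrow> has_series_derivative Z Z' x \<Longrightarrow>
    has_series_derivative (\<lambda>x. Y x - Z x) (Y' - Z') x"
  by (simp add: has_series_derivative_def has_coeff_derivative_diff)

lemma has_series_derivative_smult:
  "has_coeff_derivative f f' x \<Longrightarrow> has_series_derivative Y Y' x \<Longrightarrow>
    has_series_derivative (\<lambda>x. f x *s Y x) (f' *s Y x + f x *s Y') x"
  by (auto simp: has_series_derivative_def intro!: has_coeff_derivative_mult)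

lemma has_series_derivative_cmult:
  "has_series_derivative Y Y' x \<Longrightarrow> has_series_derivative (\<lambda>x. c *s Y x) (c *s Y') x"
  by (simp add: has_series_derivative_def has_coeff_derivative_cmult)

lemma has_series_derivative_dot3:
  assumes "has_series_derivative Y Y' x" "has_series_derivative Z Z' x"
  shows "has_coeff_derivative (\<lambda>x. dot3 (Y x) (Z x)) (dot3 Y' (Z x) + dot3 (Y x) Z') x"
proof -
  have "has_coeff_derivative (\<lambda>x. dot3 (Y x) (Z x))
    ((Y' $ 1 * Z x $ 1 + Y x $ 1 * Z' $ 1) + (Y' $ 2 * Z x $ 2 + Y x $ 2 * Z' $ 2)
        + (Y' $ 3 * Z x $ 3 + Y x $ 3 * Z' $ 3)) x"
    unfolding dot3_def using assms
    by (intro has_coeff_derivative_add has_coeff_derivative_mult) (auto simp: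
        has_series_derivative_def)
  then show ?thesis by (simp add: dot3_def algebra_simps)
qed

lemma has_series_derivative_crs3:
  assumes "has_series_derivative Y Y' x" "has_series_derivative Z Z' x"
  shows "has_series_derivative (\<lambda>x. crs3 (Y x) (Z x)) (crs3 Y' (Z x) + crs3 (Y x) Z') x"
proof -
  have *: "has_coeff_derivative (\<lambda>x. Y x $ i * Z x $ j - Y x $ k * Z x $ l)
    ((Y' $ i * Z x $ j + Y x $ i * Z' $ j) - (Y' $ k * Z x $ l + Y x $ k * Z' $ l)) x" for i j k l
    using assms by (intro has_coeff_derivative_diff has_coeff_derivative_mult) (auto simp:
        has_series_derivative_def)
  show ?thesis
    unfolding has_series_derivative_def forall_3
    using *[of 2 3 3 2] *[of 3 1 1 3] *[of 1 2 2 1] by (simp add: crs3_def algebra_simps)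
qed

definition deriv_series :: "real fps ^ 3 \<Rightarrow> real fps ^ 3" where
  "deriv_series Y = (\<chi> i. fps_deriv (Y $ i))"

lemma has_series_derivative_deriv:
  "has_series_derivative Y Y' x \<Longrightarrow> has_series_derivative (\<lambda>x. deriv_series (Y x)) (deriv_series Y') x"
  by (simp add: has_series_derivative_def deriv_series_def has_coeff_derivative_deriv)

lemma fps_deriv_dot3: "fps_deriv (dot3 Y Z) = dot3 (deriv_series Y) Z + dot3 Y (deriv_series Z)"
  by (simp add: dot3_def deriv_series_def algebra_simps)

lemma deriv_series_crs3: "deriv_series (crs3 Y Z) = crs3 (deriv_series Y) Z + crs3 Y (deriv_series Z)"
  by (simp add: crs3_def deriv_series_def vec_eq_iff forall_3 algebra_simps)

lemma deriv_series_const: "deriv_series (const_series p) = 0"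
  by (simp add: deriv_series_def const_series_def vec_eq_iff)

lemma deriv_series_smult: "deriv_series (f *s Y) = fps_deriv f *s Y + f *s deriv_series Y"
  by (simp add: deriv_series_def vec_eq_iff algebra_simps)

section \<open>The formal parallel field\<close>

lemma Cdiff_sum:
  "finite I \<Longrightarrow> (\<And>i. i \<in> I \<Longrightarrow> Cdiff n (f i)) \<Longrightarrow> Cdiff n (\<lambda>x. \<Sum>i\<in>I. f i x)"
  by (induction I rule: finite_induct) (auto intro: Cdiff_add Cdiff_const)

text \<open>Parallel unit fields of the connection \<open>d + \<lambda> \<gamma>' \<times>\<close>, multiplied by \<open>z = 1 / \<lambda>\<close> to make sense as
  power series.\<close>

definition formal_parallel :: "(real \<Rightarrow> R3) \<Rightarrow> (real \<Rightarrow> real fps ^ 3) \<Rightarrow> bool" where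
  "formal_parallel \<gamma> Y \<longleftrightarrow> (\<forall>x. dot3 (Y x) (Y x) = 1 \<and> series_coeff 0 (Y x) = tangent \<gamma> x \<and>
    (\<exists>Y'. has_series_derivative Y Y' x \<and>
      fps_X *s Y' = - crs3 (const_series (vector_derivative \<gamma> (at x))) (Y x)))"

definition Y_series :: "(real \<Rightarrow> R3) \<Rightarrow> real \<Rightarrow> real fps ^ 3" where
  "Y_series \<gamma> x = (\<chi> i. Abs_fps (\<lambda>n. Y_field \<gamma> n x $ i))"

lemma series_coeff_Y_series [simp]: "series_coeff n (Y_series \<gamma> x) = Y_field \<gamma> n x"
  by (simp add: series_coeff_def Y_series_def vec_eq_iff)

text \<open>The defining equation mentions \<^term>\<open>Y_field \<gamma> (k - i + 1)\<close>, to which it would apply again.\<close>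
declare Y_field.simps(2) [simp del]

context equivariant_curve
begin

lemma smooth_Y_field: "smooth (Y_field \<gamma> n)"
proof (induction n rule: less_induct)
  case (less n)
  show ?case
  proof (cases n)
    case 0
    then show ?thesis by (simp add: smooth_tangent)
  next
    case (Suc k)
    have 1: "Cdiff m (Y_field \<gamma> i)" if "i \<le> k" for m i
      using less.IH[of i] that Suc by (simp add: smooth_iff_Cdiff)
    have 2: "Cdiff m (arc_deriv \<gamma> (Y_field \<gamma> k))" "Cdiff m (tangent \<gamma>)" for m
      using smooth_arc_deriv[OF less.IH[of k]] smooth_tangent Suc by (simp_all add: smooth_iff_Cdiff)
    show ?thesis
      unfolding smooth_iff_Cdiff Suc Y_field.simps(2)
      by (intro allI Cdiff_diff Cdiff_scaleR Cdiff_cross Cdiff_mult Cdiff_const Cdiff_sum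
          Cdiff_inner 2 1) auto
  qed
qed

lemma Y_field_translate: "Y_field \<gamma> n (\<tau> x) = rot_part A (Y_field \<gamma> n x)"
proof (induction n arbitrary: x rule: less_induct)
  case (less n)
  show ?case
  proof (cases n)
    case 0
    then show ?thesis by (simp add: tangent_translate)
  next
    case (Suc k)
    have "arc_deriv \<gamma> (Y_field \<gamma> k) (\<tau> x) = rot_part A (arc_deriv \<gamma> (Y_field \<gamma> k) x)"
    proof (rule arc_deriv_translate[where c = 0, OF smooth_Y_field bounded_linear_rot_part])
      show "Y_field \<gamma> k (\<tau> y) = rot_part A (Y_field \<gamma> k y) + 0" for y
        using less.IH[of k y] Suc by simp
    qed
    then show ?thesis
      using less.IH unfolding Suc Y_field.simps(2)
          by (simp add: tangent_translate rot_part_preserves rot_part_linear)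
  qed
qed

lemma dot3_self_nth_Suc:
  "fps_nth (dot3 Z Z) (Suc k) = 2 * (series_coeff 0 Z \<bullet> series_coeff (Suc k) Z)
    + (\<Sum>i\<in>{1..k}. series_coeff i Z \<bullet> series_coeff (k - i + 1) Z)"
proof -
  have "{0..Suc k} = insert 0 (insert (Suc k) {1..k})" by auto
  moreover have "(\<Sum>i\<in>{1..k}. series_coeff i Z \<bullet> series_coeff (Suc k - i) Z)
    = (\<Sum>i\<in>{1..k}. series_coeff i Z \<bullet> series_coeff (k - i + 1) Z)"
    by (rule sum.cong) (auto simp: Suc_diff_le)
  ultimately show ?thesis unfolding dot3_nth by (simp add: inner_commute)
qed

lemma unit_series_coeff:
  assumes "dot3 Z Z = 1" "series_coeff 0 Z = T"
  shows "T \<bullet> series_coeff (Suc k) Z = - 1/2 * (\<Sum>i\<in>{1..k}. series_coeff i Z \<bullet> series_coeff (k - i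
      + 1) Z)"
  using dot3_self_nth_Suc[of Z k] assms by simp

text \<open>The recursion of the coefficients prescribes the part of the parallel equation orthogonal to the
  tangent and, through the unit length, the tangential part of the field.  The tangential part \<open>\<zeta>\<close> of
  the equation holds for free: \<open>\<zeta> T\<close> is orthogonal to \<open>Y\<close>, since \<open>Y\<close> has constant length, while
  \<open>(T, Y)\<close> starts with one.\<close>

lemma formal_parallel_Y_series: "formal_parallel \<gamma> (Y_series \<gamma>)"
  unfolding formal_parallel_def
proof (intro allI conjI)
  fix x
  let ?T = "tangent \<gamma>" and ?Y = "Y_field \<gamma>"
  have unit: "dot3 (Y_series \<gamma> y) (Y_series \<gamma> y) = 1" for y
  proof (rule fps_ext)
    fix n show "fps_nth (dot3 (Y_series \<gamma> y) (Y_series \<gamma> y)) n = fps_nth 1 n"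
    proof (cases n)
      case 0
      then show ?thesis by (simp add: dot3_nth tangent_unit)
    next
      case (Suc k)
      have "?T y \<bullet> ?Y (Suc k) y = - 1/2 * (\<Sum>i\<in>{1..k}. ?Y i y \<bullet> ?Y (k - i + 1) y)"
        unfolding Y_field.simps(2) by (simp add: inner_diff_right dot_cross_self tangent_unit)
      then show ?thesis
        unfolding Suc dot3_self_nth_Suc series_coeff_Y_series Y_field.simps(1)
        by simp
    qed
  qed
  show "dot3 (Y_series \<gamma> x) (Y_series \<gamma> x) = 1" by (rule unit)
  show "series_coeff 0 (Y_series \<gamma> x) = ?T x" by simp
  define Y' where "Y' = (\<chi> i. Abs_fps (\<lambda>n. vector_derivative (?Y n) (at x) $ i))"
  have Y': "has_series_derivative (Y_series \<gamma>) Y' x"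
    using smooth_has_vector_derivative[OF smooth_Y_field]
    by (simp add: has_series_derivative_def has_coeff_derivative_def Y_series_def Y'_def
        has_vector_derivative_vec_iff)
  have coeff: "series_coeff n Y' = vector_derivative (?Y n) (at x)" for n
    by (simp add: series_coeff_def Y'_def vec_eq_iff)
  let ?V = "const_series (velocity x)"
  define \<zeta> where "\<zeta> = dot3 (const_series (?T x)) Y'"
  have Z: "fps_X *s Y' + crs3 ?V (Y_series \<gamma> x) = (fps_X * \<zeta>) *s const_series (?T x)"
  proof (rule series_eqI)
    fix n
    show "series_coeff n (fps_X *s Y' + crs3 ?V (Y_series \<gamma> x))
        = series_coeff n ((fps_X * \<zeta>) *s const_series (?T x))"
    proof (cases n)
      case 0
      have "velocity x \<times> ?T x = 0" by (simp add: velocity_eq cross_mult_left)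
      then show ?thesis
        by (simp add: 0 series_coeff_linear series_coeff_X crs3_const_series_nth)
           (simp add: series_coeff_def vec_eq_iff const_series_def)
    next
      case (Suc k)
      let ?D = "vector_derivative (?Y k) (at x)"
      have "velocity x \<times> ?Y (Suc k) x = ?T x \<times> (?T x \<times> ?D)"
        using speed_pos[of x] unfolding velocity_eq Y_field.simps(2)
        by (simp add: cross_mult_left cross_mult_right Cross3.right_diff_distrib arc_deriv_def)
      then have "velocity x \<times> ?Y (Suc k) x = (?T x \<bullet> ?D) *\<^sub>R ?T x - ?D"
          by (simp add: Lagrange tangent_unit)
      moreover have "fps_nth \<zeta> k = ?T x \<bullet> ?D" by (simp add: \<zeta>_def dot3_const_series_nth coeff)
      ultimately show ?thesis
        by (simp add: Suc series_coeff_linear series_coeff_X crs3_const_series_nth coeff)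
           (simp add: series_coeff_def vec_eq_iff const_series_def mult.assoc)
    qed
  qed
  have "dot3 Y' (Y_series \<gamma> x) + dot3 (Y_series \<gamma> x) Y' = 0"
    using has_series_derivative_dot3[OF Y' Y'] has_coeff_derivative_const[of 1 x]
    unfolding unit by (rule has_coeff_derivative_unique)
  then have "2 * dot3 Y' (Y_series \<gamma> x) = 0" by (simp add: dot3_commute)
  then have 0: "dot3 Y' (Y_series \<gamma> x) = 0" by simp
  have "dot3 (fps_X *s Y' + crs3 ?V (Y_series \<gamma> x)) (Y_series \<gamma> x) = 0"
    by (simp add: dot3_linear 0 dot3_crs3_self)
  then have "fps_X * \<zeta> * dot3 (const_series (?T x)) (Y_series \<gamma> x) = 0"
    unfolding Z by (simp add: dot3_linear)
  moreover have "fps_nth (dot3 (const_series (?T x)) (Y_series \<gamma> x)) 0 = 1"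
    by (simp add: dot3_const_series_nth tangent_unit)
  then have "dot3 (const_series (?T x)) (Y_series \<gamma> x) \<noteq> 0" by auto
  ultimately have "fps_X * \<zeta> = 0" by simp
  with Z have "fps_X *s Y' = - crs3 ?V (Y_series \<gamma> x)" by (simp add: eq_neg_iff_add_eq_0)
  with Y' show "\<exists>Y'. has_series_derivative (Y_series \<gamma>) Y' x \<and> fps_X *s Y' = - crs3 ?V (Y_series \<gamma> x)"
    by blast
qed

text \<open>Conversely, the cross product of the parallel equation with \<open>T\<close> is the recursion.\<close>

lemma formal_parallel_unique:
  assumes "formal_parallel \<gamma> Y"
  shows "Y = Y_series \<gamma>"
proof -
  have "\<forall>x. series_coeff n (Y x) = Y_field \<gamma> n x" for n
  proof (induction n rule: less_induct)
    case (less n)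
    show ?case
    proof (cases n)
      case 0
      then show ?thesis using assms by (simp add: formal_parallel_def)
    next
      case (Suc k)
      show ?thesis
      proof
        fix x
        let ?T = "tangent \<gamma> x"
        define w where "w = series_coeff (Suc k) (Y x)"
        obtain Y' where Y': "has_series_derivative Y Y' x"
          and ode: "fps_X *s Y' = - crs3 (const_series (velocity x)) (Y x)"
          and unit: "dot3 (Y x) (Y x) = 1" and T: "series_coeff 0 (Y x) = ?T"
          using assms by (auto simp: formal_parallel_def)
        have "((\<lambda>x. series_coeff k (Y x)) has_vector_derivative series_coeff k Y') (at x)"
          using Y' by (simp add: has_series_derivative_def has_coeff_derivative_def
              has_vector_derivative_vec_iff series_coeff_def)
        moreover have "(\<lambda>x. series_coeff k (Y x)) = Y_field \<gamma> k"
          using less.IH[of k] Suc by auto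
        moreover have "series_coeff k Y' = - (velocity x \<times> w)"
          using arg_cong[OF ode, of "series_coeff (Suc k)"]
          by (simp add: series_coeff_X series_coeff_linear crs3_const_series_nth w_def)
        ultimately have "arc_deriv \<gamma> (Y_field \<gamma> k) x = - (?T \<times> w)"
          by (intro arc_deriv_eqI) (simp add: velocity_eq cross_mult_left)
        then have "?T \<times> arc_deriv \<gamma> (Y_field \<gamma> k) x = w - (?T \<bullet> w) *\<^sub>R ?T"
          by (simp add: Lagrange tangent_unit)
        moreover have "?T \<bullet> w = - 1/2 * (\<Sum>i\<in>{1..k}. Y_field \<gamma> i x \<bullet> Y_field \<gamma> (k - i + 1) x)"
          unfolding w_def unit_series_coeff[OF unit T]
          by (rule arg_cong[of _ _ "\<lambda>s. - 1/2 * s"], rule sum.cong)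
             (use less.IH Suc in auto)
        ultimately have "w = Y_field \<gamma> (Suc k) x" unfolding Y_field.simps(2)
            by (simp add: algebra_simps)
        then show "series_coeff n (Y x) = Y_field \<gamma> n x" by (simp add: Suc w_def)
      qed
    qed
  qed
  then show ?thesis by (intro ext series_eqI) simp
qed

end

section \<open>The Hamiltonians of positive index\<close>

context equivariant_curve
begin

lemma dot3_translate:
  assumes "\<And>n. series_coeff n Y' = rot_part A (series_coeff n Y)" "\<And>n. series_coeff n Z'
      = rot_part A (series_coeff n Z)"
  shows "dot3 Y' Z' = dot3 Y Z"
  by (rule fps_ext) (simp add: dot3_nth assms rot_part_preserves)

lemma series_coeff_const_series: "series_coeff n (const_series p) = (if n = 0 then p else 0)"
  by (simp add: series_coeff_def const_series_def vec_eq_iff)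

lemma series_coeff_deriv_series: "series_coeff n (deriv_series Y)
      = real (Suc n) *\<^sub>R series_coeff (Suc n) Y"
  by (simp add: series_coeff_def deriv_series_def vec_eq_iff)

abbreviation tangent_part :: "real \<Rightarrow> real fps" where
  "tangent_part x \<equiv> dot3 (const_series (tangent \<gamma> x)) (Y_series \<gamma> x)"
abbreviation binormal_part :: "real \<Rightarrow> real fps" where
  "binormal_part x \<equiv> dot3 (const_series (Y_field \<gamma> 1 x)) (Y_series \<gamma> x)"

lemma Y_field_1: "Y_field \<gamma> 1 x = tangent \<gamma> x \<times> arc_deriv \<gamma> (tangent \<gamma>) x"
  unfolding One_nat_def Y_field.simps(2) by simp

lemma tangent_Y_field_1: "tangent \<gamma> x \<bullet> Y_field \<gamma> 1 x = 0"
  unfolding Y_field_1 by (simp add: dot_cross_self)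

lemma tangent_part_nth: "fps_nth (tangent_part x) n = tangent \<gamma> x \<bullet> Y_field \<gamma> n x"
  by (simp add: dot3_const_series_nth)

lemma one_plus_tangent_part_inverse: "inverse (1 + tangent_part x) * (1 + tangent_part x) = 1"
  by (rule inverse_mult_eq_1) (simp add: tangent_part_nth tangent_unit)

text \<open>The geometric series in the definition of the integrand is twice the inverse of \<open>1 + (T, Y)\<close>:
  the constant coefficient of \<open>(T, Y)\<close> is one and the next vanishes.\<close>

lemma E_integrand_eq: "E_integrand \<gamma> x = 2 * (binormal_part x * inverse (1 + tangent_part x))"
proof -
  define P where "P = Abs_fps (\<lambda>l. if l \<ge> 2 then 1/2 * (tangent \<gamma> x \<bullet> Y_field \<gamma> l x) else 0)"
  define G where "G = Abs_fps (\<lambda>j. (- 1 :: real) ^ j)"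
  have "G * (1 + fps_X) = 1"
  proof (rule fps_ext)
    fix n show "fps_nth (G * (1 + fps_X)) n = fps_nth 1 n"
      by (cases n) (simp_all add: G_def algebra_simps)
  qed
  then have "(G oo P) * ((1 + fps_X) oo P) = 1 oo P"
    using fps_compose_mult_distrib[of P G "1 + fps_X"] by (simp add: P_def)
  then have GP: "(G oo P) * (1 + P) = 1"
    by (simp add: fps_compose_add_distrib P_def)
  have P: "1 + tangent_part x = 2 * (1 + P)"
  proof (rule fps_ext)
    fix n :: nat
    have "n = 0 \<or> n = 1 \<or> n \<ge> 2" by linarith
    then show "fps_nth (1 + tangent_part x) n = fps_nth (2 * (1 + P)) n"
      using tangent_Y_field_1
      by (auto simp: tangent_part_nth tangent_unit P_def numeral_fps_const)
  qed
  have B: "Abs_fps (\<lambda>i. if i \<ge> 1 then Y_field \<gamma> i x \<bullet> Y_field \<gamma> 1 x else 0) = binormal_part x"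
  proof (rule fps_ext)
    fix n show "fps_nth (Abs_fps (\<lambda>i. if i \<ge> 1 then Y_field \<gamma> i x \<bullet> Y_field \<gamma> 1 x else 0)) n
        = fps_nth (binormal_part x) n"
      using tangent_Y_field_1[of x] by (cases n) (simp_all add: dot3_const_series_nth inner_commute)
  qed
  have "E_integrand \<gamma> x = binormal_part x * (G oo P)"
    unfolding E_integrand_def B P_def[symmetric] G_def[symmetric] ..
  also have "\<dots> = binormal_part x * (G oo P) * (inverse (1 + tangent_part x) * (1 + tangent_part x))"
    unfolding one_plus_tangent_part_inverse by simp
  also have "\<dots> = 2 * (binormal_part x * inverse (1 + tangent_part x)) * ((G oo P) * (1 + P))"
    by (subst (2) P) (simp only: mult_ac)
  finally show ?thesis unfolding GP by simp
qed

text \<open>Let \<open>U\<close> be half the integrand.  As \<open>d/d\<lambda> = - z\<^sup>2 d/dz\<close>, the equation says that the derivative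
  of \<open>U\<close> with respect to \<open>\<lambda>\<close> is \<open>(T, Y) - 1\<close> up to the arclength derivative of \<open>z\<^sup>2 g\<close>.  This is the
  variation of the holonomy angle: up to the total torsion the angle is the integral of \<open>\<lambda> + U\<close>, and
  its derivative is the integral of \<open>(T, Y)\<close>, the generator \<open>T\<close> being measured along the axis \<open>Y\<close>.
  The inner product of the formal derivatives that arises is evaluated as a Gram determinant.\<close>

lemma E_integrand_potential:
  defines "g \<equiv> \<lambda>x. dot3 (deriv_series (Y_series \<gamma> x)) (crs3 (const_series (tangent \<gamma> x)) (Y_series \<gamma>
      x)) * inverse (1 + tangent_part x)"
  shows "\<exists>g'. has_coeff_derivative g g' x \<and>
    fps_X * (fps_X * g') = fps_const (speed \<gamma> x) * (1 - tangent_part x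
        - fps_X * (fps_X * fps_deriv (binormal_part x * inverse (1 + tangent_part x))))"
proof -
  define s T b Y E c u J where "s = fps_const (speed \<gamma> x)" and "T = const_series (tangent \<gamma> x)"
    and "b = const_series (Y_field \<gamma> 1 x)" and "Y = Y_series \<gamma> x" and "E = deriv_series Y"
    and "c = tangent_part x" and "u = binormal_part x" and "J = inverse (1 + tangent_part x)"
  note defs = this
  define T' where "T' = s *s crs3 b T"
  obtain Y' where YY: "dot3 Y Y = 1"
    and Y': "has_series_derivative (Y_series \<gamma>) Y' x" and ode: "fps_X *s Y' =
        - crs3 (const_series (velocity x)) Y"
    using formal_parallel_Y_series[unfolded formal_parallel_def, rule_format, of x]
        by (auto simp: Y_def)
  have TT: "dot3 T T = 1" and Tb: "dot3 T b = 0" "dot3 b T = 0"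
    using tangent_Y_field_1[of x] by (simp_all add: T_def b_def dot3_const_series tangent_unit
        inner_commute)
  have ode: "fps_X *s Y' = - (s *s crs3 T Y)"
    unfolding ode velocity_eq by (simp add: const_series_linear crs3_linear s_def T_def)
  have T': "has_series_derivative (\<lambda>x. const_series (tangent \<gamma> x)) T' x"
  proof -
    have 0: "tangent \<gamma> x \<bullet> arc_deriv \<gamma> (tangent \<gamma>) x = 0"
    proof -
      have "((\<lambda>x. tangent \<gamma> x \<bullet> tangent \<gamma> x) has_vector_derivative
        tangent \<gamma> x \<bullet> (speed \<gamma> x *\<^sub>R arc_deriv \<gamma> (tangent \<gamma>) x)
            + (speed \<gamma> x *\<^sub>R arc_deriv \<gamma> (tangent \<gamma>) x) \<bullet> tangent \<gamma> x) (at x)"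
        by (intro bounded_bilinear.has_vector_derivative[OF bounded_bilinear_inner]
            derivative_eq_arc_deriv smooth_tangent)
      then have "speed \<gamma> x * (tangent \<gamma> x \<bullet> arc_deriv \<gamma> (tangent \<gamma>) x) = 0"
        unfolding tangent_unit using vector_derivative_unique_at[OF _
            has_vector_derivative_const[of 1]]
        by (fastforce simp: inner_commute)
      then show ?thesis using speed_pos[of x] by simp
    qed
    have "(tangent \<gamma> has_vector_derivative speed \<gamma> x *\<^sub>R (Y_field \<gamma> 1 x \<times> tangent \<gamma> x)) (at x)"
    proof -
      have "Y_field \<gamma> 1 x \<times> tangent \<gamma> x = arc_deriv \<gamma> (tangent \<gamma>) x"
        unfolding Y_field_1 by (simp add: cross_cross_left tangent_unit inner_commute 0)
      then show ?thesis using derivative_eq_arc_deriv[OF smooth_tangent, of x] by (simp only:)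
    qed
    from has_series_derivative_const_series[OF this] show ?thesis
      by (simp add: T'_def const_series_linear crs3_const_series s_def T_def b_def)
  qed
  have EY: "dot3 E Y = 0"
  proof -
    have "dot3 E Y + dot3 Y E = 0"
      using arg_cong[OF YY, of fps_deriv] by (simp add: fps_deriv_dot3 E_def)
    then have "2 * dot3 E Y = 0" by (simp add: dot3_commute[of Y E])
    then show ?thesis by simp
  qed
  define E' where "E' = deriv_series Y'"
  have E': "has_series_derivative (\<lambda>x. deriv_series (Y_series \<gamma> x)) E' x"
    unfolding E'_def by (rule has_series_derivative_deriv[OF Y'])
  have XE': "fps_X *s E' = - Y' - s *s crs3 T E"
  proof -
    have neg: "deriv_series (- Z) = - deriv_series Z" "crs3 0 Z = 0" for Z :: "real fps ^ 3"
      by (simp_all add: deriv_series_def crs3_def vec_eq_iff forall_3)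
    have "Y' + fps_X *s E' = - (s *s crs3 T E)"
      using arg_cong[OF ode, of deriv_series]
      by (simp add: deriv_series_smult neg deriv_series_crs3 deriv_series_const T_def s_def E_def
          E'_def vec_eq_iff)
    then have "Y' + fps_X *s E' - Y' = - (s *s crs3 T E) - Y'" by simp
    then show ?thesis by simp
  qed
  have J: "J * (1 + c) = 1" unfolding defs by (rule one_plus_tangent_part_inverse)
  have dc: "fps_deriv c = dot3 T E" and du: "fps_deriv u = dot3 b E"
    by (simp_all add: defs fps_deriv_dot3 deriv_series_const) (simp_all add: dot3_def)
  have cT: "dot3 T Y = c" and ub: "dot3 b Y = u" by (simp_all add: defs)
  define w where "w = dot3 E (crs3 T Y)"
  define w' where "w' = dot3 E' (crs3 T Y) + dot3 E (crs3 T' Y + crs3 T Y')"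
  define c' where "c' = dot3 T' Y + dot3 T Y'"
  have hc: "has_coeff_derivative tangent_part c' x"
    unfolding c'_def T_def Y_def by (rule has_series_derivative_dot3[OF T' Y'])
  have "has_coeff_derivative (\<lambda>x. 1 + tangent_part x) (0 + c') x"
    by (intro has_coeff_derivative_add has_coeff_derivative_const hc)
  then have "has_coeff_derivative (\<lambda>x. inverse (1 + tangent_part x)) (- ((0 + c') * inverse (1
      + tangent_part x) * inverse (1 + tangent_part x))) x"
    by (rule has_coeff_derivative_inverse) (simp add: tangent_part_nth tangent_unit)
  then have hJ: "has_coeff_derivative (\<lambda>x. inverse (1 + tangent_part x)) (- (c' * J * J)) x"
      by (simp add: J_def)
  have hw: "has_coeff_derivative (\<lambda>x. dot3 (deriv_series (Y_series \<gamma> x)) (crs3 (const_series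
      (tangent \<gamma> x)) (Y_series \<gamma> x))) w' x"
    unfolding w'_def E_def T_def Y_def
    by (intro has_series_derivative_dot3 has_series_derivative_crs3 E' T' Y')
  have g': "has_coeff_derivative g (w' * J + w * - (c' * J * J)) x"
    using has_coeff_derivative_mult[OF hw hJ] by (simp add: g_def w_def E_def T_def Y_def J_def)
  have "fps_X * dot3 T Y' = 0"
    unfolding dot3_linear(6)[symmetric] ode by (simp add: dot3_linear dot3_crs3_self)
  then have "dot3 T Y' = 0" by simp
  then have c'_eq: "c' = s * dot3 b (crs3 T Y)"
    by (simp add: c'_def T'_def dot3_linear dot3_crs3_rotate)
  \<comment> \<open>By the Gram identity the cross term of the product rule becomes polynomial in \<open>c\<close>, \<open>u\<close> and
    their formal derivatives.\<close>
  have gram: "w * dot3 b (crs3 T Y) = (1 - c * c) * dot3 b E + c * u * dot3 T E"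
    unfolding w_def dot3_crs3_gram TT YY EY cT ub Tb
    by (simp add: dot3_commute[of E] algebra_simps)
  have "fps_X * (fps_X * w') = fps_X * dot3 (fps_X *s E') (crs3 T Y)
      + fps_X * (fps_X * dot3 E (crs3 T' Y))
     + fps_X * dot3 E (crs3 T (fps_X *s Y'))"
    by (simp add: w'_def dot3_linear crs3_linear algebra_simps)
  also have "fps_X * dot3 (fps_X *s E') (crs3 T Y) = - dot3 (fps_X *s Y') (crs3 T Y)
      - fps_X * (s * dot3 (crs3 T E) (crs3 T Y))"
    unfolding XE' by (simp add: dot3_linear algebra_simps)
  also have "\<dots> = s * (1 - c * c) + fps_X * (s * (dot3 T E * c))"
    unfolding ode by (simp add: dot3_linear dot3_crs3_crs3 TT YY EY cT dot3_commute[of Y T]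
        dot3_commute[of E T] algebra_simps)
  also have "dot3 E (crs3 T' Y) = s * (u * dot3 T E - c * dot3 b E)"
    by (simp add: T'_def crs3_linear crs3_crs3 dot3_linear cT ub dot3_commute[of E]
        right_diff_distrib mult.assoc)
  also have "fps_X * dot3 E (crs3 T (fps_X *s Y')) = - (fps_X * (s * (c * dot3 T E)))"
    unfolding ode by (simp add: crs3_linear dot3_linear crs3_crs3 TT cT EY dot3_commute[of E T])
  finally have Xw': "fps_X * (fps_X * w') = s * ((1 - c * c) + fps_X * fps_X * (u * dot3 T E
      - c * dot3 b E))"
    by (simp add: algebra_simps)
  have dJ: "fps_deriv J = - (J * J * dot3 T E)"
  proof -
    have "fps_deriv J * (1 + c) + J * dot3 T E = 0"
      using arg_cong[OF J, of fps_deriv] by (simp add: dc algebra_simps)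
    then have "J * (fps_deriv J * (1 + c) + J * dot3 T E) = 0" by simp
    then have "fps_deriv J * (J * (1 + c)) + J * J * dot3 T E = 0" by (simp add: algebra_simps)
    then show ?thesis unfolding J by (simp add: eq_neg_iff_add_eq_0)
  qed
  have "fps_X * (fps_X * (w' * J + w * - (c' * J * J)))
    = (fps_X * (fps_X * w')) * J - s * (fps_X * fps_X) * (w * dot3 b (crs3 T Y)) * (J * J)"
    by (simp add: c'_eq algebra_simps)
  also have "\<dots> = s * ((1 - c * c) * J) + s * (fps_X * fps_X) * (dot3 T E * u * J - (J * c) * dot3 b E
      - (J * J * (1 - c * c)) * dot3 b E - (J * c) * J * u * dot3 T E)"
    unfolding Xw' gram by (simp add: algebra_simps)
  also have "\<dots> = s * (1 - c - fps_X * (fps_X * fps_deriv (u * J)))"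
  proof -
    have Jc: "J * c = 1 - J" using J by (simp add: algebra_simps)
    have "(1 - c * c) * J = (1 - c) * (J + J * c)" by (simp add: algebra_simps)
    then have e: "(1 - c * c) * J = 1 - c" unfolding Jc by simp
    have "J * J * (1 - c * c) = J * (1 - c)" unfolding e[symmetric] by (simp add: mult_ac)
    also have "\<dots> = J - J * c" by (simp add: algebra_simps)
    finally have e2: "J * J * (1 - c * c) = J - (1 - J)" unfolding Jc .
    show ?thesis unfolding e e2 Jc fps_deriv_mult du dJ by (simp add: algebra_simps)
  qed
  finally show ?thesis
    using g' by (auto simp: defs)
qed

lemma arc_integral_E_integrand:
  assumes "n \<ge> 1"
  shows "arc_integral \<tau> x0 \<gamma> (\<lambda>x. fps_nth (E_integrand \<gamma> x) n)
    = - (2 / real n) * integral {x0..\<tau> x0} (\<lambda>x. velocity x \<bullet> Y_field \<gamma> (Suc n) x)"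
proof -
  obtain m where n: "n = Suc m" using assms by (cases n) auto
  define g where "g x = dot3 (deriv_series (Y_series \<gamma> x)) (crs3 (const_series (tangent \<gamma> x))
      (Y_series \<gamma> x)) * inverse (1 + tangent_part x)" for x
  define \<Phi> where "\<Phi> x = - (2 / real n) * fps_nth (g x) m" for x
  have "integral {x0..\<tau> x0} (\<lambda>x. fps_nth (E_integrand \<gamma> x) n * speed \<gamma> x)
    = integral {x0..\<tau> x0} (\<lambda>x. - (2 / real n) * (velocity x \<bullet> Y_field \<gamma> (Suc n) x))"
  proof (rule integral_eq_if_periodic_derivative[of \<Phi>])
    fix x
    define U where "U = binormal_part x * inverse (1 + tangent_part x)"
    obtain g' where g': "has_coeff_derivative g g' x"
      and eq: "fps_X * (fps_X * g') = fps_const (speed \<gamma> x) * (1 - tangent_part x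
          - fps_X * (fps_X * fps_deriv U))"
      using E_integrand_potential[of x] unfolding g_def[abs_def] U_def by auto
    have "fps_nth g' m = speed \<gamma> x * (- (tangent \<gamma> x \<bullet> Y_field \<gamma> (Suc n) x) - real n * fps_nth U n)"
      using arg_cong[OF eq, of "\<lambda>f. fps_nth f (Suc n)"]
      by (simp add: n tangent_part_nth)
    then have e: "- (2 / real n) * fps_nth g' m = fps_nth (E_integrand \<gamma> x) n * speed \<gamma> x
        - - (2 / real n) * (velocity x \<bullet> Y_field \<gamma> (Suc n) x)"
      unfolding E_integrand_eq U_def[symmetric] velocity_eq using assms
      by (simp add: numeral_fps_const field_simps)
    show "(\<Phi> has_real_derivative fps_nth (E_integrand \<gamma> x) n * speed \<gamma> x
        - - (2 / real n) * (velocity x \<bullet> Y_field \<gamma> (Suc n) x)) (at x)"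
      unfolding e[symmetric] \<Phi>_def[abs_def] using g'
      by (intro DERIV_cmult) (simp add: has_coeff_derivative_def)
    have "g (\<tau> x) = g x"
      unfolding g_def
      by (intro arg_cong2[of _ _ _ _ "(*)"] arg_cong[of _ _ "\<lambda>f. inverse (1 + f)"] dot3_translate)
        (simp_all add: series_coeff_const_series series_coeff_deriv_series crs3_const_series_nth
          Y_field_translate tangent_translate rot_part_preserves rot_part_linear)
    then show "\<Phi> (\<tau> x) = \<Phi> x" by (simp add: \<Phi>_def)
  qed
  then show ?thesis by (simp only: arc_integral_def integral_mult_right)
qed

end

context darboux_direction
begin

text \<open>A commutator of quaternions is twice the cross product, so the parallel equation with parameter
  \<open>\<lambda>\<close> belongs to the frame equation with parameter \<open>\<lambda> / 2\<close>.  Hence the factor two in the gauge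
  transformation \<open>2 z + c + \<rho> S\<close>.\<close>

definition alpha :: "real fps" where "alpha = 2 * fps_X + fps_const c"
definition gauge_norm :: "real fps" where "gauge_norm = alpha * alpha + fps_const \<rho> * fps_const \<rho>"

definition gauged :: "real \<Rightarrow> real fps ^ 3" where
  "gauged x = inverse gauge_norm *s qrot alpha (fps_const \<rho>) (const_series (S x)) (Y_series \<gamma> x)"

lemma gauge_norm_inverse: "inverse gauge_norm * gauge_norm = 1"
proof -
  have "fps_nth gauge_norm 0 = k" by (simp add: gauge_norm_def alpha_def k_def)
  then show ?thesis using k_nonzero by (intro inverse_mult_eq_1) simp
qed

lemma series_hypotheses:
  "dot3 (const_series (S x)) (const_series (S x)) = 1"
  "dot3 (const_series (S x)) (const_series (S' x)) = 0"
  "2 *s const_series (velocity x) = (2 * fps_const (velocity x \<bullet> S x)) *s const_series (S x)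
    + fps_const c *s crs3 (const_series (S x)) (const_series (S' x))
        - fps_const \<rho> *s const_series (S' x)"
proof -
  show "dot3 (const_series (S x)) (const_series (S x)) = 1" "dot3 (const_series (S x)) (const_series
      (S' x)) = 0"
    by (simp_all add: dot3_const_series S_unit S_S')
  have 2: "(2 :: real fps) = fps_const 2" by (rule numeral_fps_const)
  show "2 *s const_series (velocity x) = (2 * fps_const (velocity x \<bullet> S x)) *s const_series (S x)
    + fps_const c *s crs3 (const_series (S x)) (const_series (S' x))
        - fps_const \<rho> *s const_series (S' x)"
    unfolding crs3_const_series 2 fps_const_mult const_series_linear[symmetric]
        velocity_decomposition ..
qed

lemma series_velocity_\<eta>:
  "2 *s const_series (vector_derivative \<eta> (at x))
    = 2 *s const_series (velocity x) + (2 * fps_const \<rho>) *s const_series (S' x)"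
  by (simp add: vector_derivative_\<eta> const_series_linear vec_eq_iff algebra_simps)

lemma has_series_derivative_S: "has_series_derivative (\<lambda>x. const_series (S x)) (const_series (S' x))
      x"
  by (rule has_series_derivative_const_series[OF S_derivative])

text \<open>At \<open>z = 0\<close> the gauge transformation is the rotation taking the tangent of \<open>\<gamma>\<close> to that of \<open>\<eta>\<close>, so
  the transformed field also has the right initial coefficient.\<close>

lemma formal_parallel_gauged: "formal_parallel \<eta> gauged"
  unfolding formal_parallel_def
proof (intro allI conjI)
  fix x
  let ?S = "const_series (S x)" and ?D = "const_series (S' x)" and ?V = "const_series (velocity x)"
    and ?Y = "Y_series \<gamma> x" and ?q = "qrot alpha (fps_const \<rho>) (const_series (S x))"
  define r where "r = fps_const \<rho>"
  obtain Y' where unit: "dot3 ?Y ?Y = 1"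
    and Y': "has_series_derivative (Y_series \<gamma>) Y' x" and ode: "fps_X *s Y' = - crs3 ?V ?Y"
    using formal_parallel_Y_series[unfolded formal_parallel_def, rule_format, of x] by auto
  note hyp = series_hypotheses[of x]
  show "dot3 (gauged x) (gauged x) = 1"
  proof -
    have "dot3 (gauged x) (gauged x) = (inverse gauge_norm * gauge_norm) * (inverse gauge_norm *
        gauge_norm)"
      unfolding gauged_def dot3_linear qrot_dot3[OF hyp(1)] unit gauge_norm_def[symmetric]
      by (simp only: mult_ac mult_1_right mult_1_left)
    then show ?thesis unfolding gauge_norm_inverse by simp
  qed
  show "series_coeff 0 (gauged x) = tangent \<eta> x"
  proof -
    have "series_coeff 0 (f *s Y) = fps_nth f 0 *\<^sub>R series_coeff 0 Y" for f Y
      by (simp add: series_coeff_def vec_eq_iff)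
    moreover have "series_coeff 0 (Y - Z) = series_coeff 0 Y - series_coeff 0 Z" for Y Z
      by (simp add: series_coeff_def vec_eq_iff)
    moreover have "series_coeff 0 ?S = S x" by (simp add: series_coeff_def const_series_def
        vec_eq_iff)
    ultimately have "series_coeff 0 (gauged x) = (1 / k) *\<^sub>R ((c * c - \<rho> * \<rho>) *\<^sub>R tangent \<gamma> x
      + (2 * \<rho> * \<rho> * (S x \<bullet> tangent \<gamma> x)) *\<^sub>R S x - (2 * c * \<rho>) *\<^sub>R (S x \<times> tangent \<gamma> x))"
      by (simp add: gauged_def qrot_def series_coeff_linear alpha_def gauge_norm_def k_def
          dot3_const_series_nth crs3_const_series_nth inverse_eq_divide)
        (simp add: vec_eq_iff algebra_simps add_divide_distrib diff_divide_distrib)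
    also have "\<dots> = tangent \<eta> x"
      unfolding tangent_\<eta> rotation_about_def sin_\<theta> one_minus_cos_\<theta> unfolding cos_\<theta>
      by (simp add: vec_eq_iff algebra_simps add_divide_distrib diff_divide_distrib)
    finally show ?thesis .
  qed
  define Q' where "Q' = (alpha * alpha - r * r) *s Y'
    + ((2 * r * r * (dot3 ?D ?Y + dot3 ?S Y')) *s ?S + (2 * r * r * dot3 ?S ?Y) *s ?D)
    - (2 * alpha * r) *s (crs3 ?D ?Y + crs3 ?S Y')"
  have "has_series_derivative (\<lambda>x. qrot alpha (fps_const \<rho>) (const_series (S x)) (Y_series \<gamma> x)) Q' x"
    unfolding qrot_def Q'_def r_def[symmetric]
    by (intro has_series_derivative_add has_series_derivative_diff has_series_derivative_cmult
        has_series_derivative_smult has_coeff_derivative_cmult has_series_derivative_dot3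
        has_series_derivative_crs3 has_series_derivative_S Y')
  then have 1: "has_series_derivative gauged (inverse gauge_norm *s Q') x"
    unfolding gauged_def[abs_def] by (rule has_series_derivative_cmult)
  have XY: "fps_X * dot3 Z Y' = - dot3 Z (crs3 ?V ?Y)" "fps_X *s crs3 Z Y' = - crs3 Z (crs3 ?V ?Y)"
      for Z
    unfolding dot3_linear(6)[symmetric] crs3_linear(6)[symmetric] ode
        by (simp_all add: dot3_linear crs3_linear)
  have X: "fps_X *s Q' = - ?q (crs3 ?V ?Y)
    + fps_X *s ((2 * r * r) *s (dot3 ?D ?Y *s ?S + dot3 ?S ?Y *s ?D) - (2 * alpha * r) *s crs3 ?D ?Y)"
  proof -
    have "fps_X *s Q' = (alpha * alpha - r * r) *s (fps_X *s Y')
      + (2 * r * r * (fps_X * dot3 ?S Y')) *s ?S - (2 * alpha * r) *s (fps_X *s crs3 ?S Y')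
      + fps_X *s ((2 * r * r) *s (dot3 ?D ?Y *s ?S + dot3 ?S ?Y *s ?D)
          - (2 * alpha * r) *s crs3 ?D ?Y)"
      unfolding Q'_def by (simp add: vec_eq_iff algebra_simps)
    then show ?thesis
      unfolding ode XY qrot_def r_def[symmetric] by (simp add: vec_eq_iff algebra_simps)
  qed
  have cancel: "2 *s u = 2 *s v \<Longrightarrow> u = v" for u v :: "real fps ^ 3"
    by (simp add: vec_eq_iff)
  have q2: "?q (crs3 (2 *s ?V) ?Y) = 2 *s ?q (crs3 ?V ?Y)"
    unfolding qrot_def r_def[symmetric] by (simp add: crs3_linear dot3_linear vec_eq_iff
        algebra_simps)
  have "2 *s (fps_X *s Q') = - (?q (crs3 (2 *s ?V) ?Y) - (alpha - fps_const c) *s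
    ((2 * r * r) *s (dot3 ?D ?Y *s ?S + dot3 ?S ?Y *s ?D) - (2 * alpha * r) *s crs3 ?D ?Y))"
    unfolding X q2 by (simp add: alpha_def vec_eq_iff algebra_simps)
  also have "\<dots> = - crs3 (2 *s const_series (vector_derivative \<eta> (at x))) (?q ?Y)"
    unfolding r_def darboux_gauge[OF hyp] series_velocity_\<eta> ..
  also have "\<dots> = 2 *s (- crs3 (const_series (vector_derivative \<eta> (at x))) (?q ?Y))"
    by (simp add: crs3_linear vec_eq_iff)
  finally have XQ: "fps_X *s Q' = - crs3 (const_series (vector_derivative \<eta> (at x))) (?q ?Y)"
    by (rule cancel)
  have "fps_X *s (inverse gauge_norm *s Q') = inverse gauge_norm *s (fps_X *s Q')"
    by (simp add: vec_eq_iff mult_ac)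
  then have "fps_X *s (inverse gauge_norm *s Q') = - crs3 (const_series (vector_derivative \<eta> (at
      x))) (gauged x)"
    unfolding XQ gauged_def crs3_linear by (simp add: vec_eq_iff)
  with 1 show "\<exists>Y'. has_series_derivative gauged Y' x
    \<and> fps_X *s Y' = - crs3 (const_series (vector_derivative \<eta> (at x))) (gauged x)"
    by (intro exI conjI)
qed

end

context darboux_direction
begin

lemma gauged_eq: "gauged = Y_series \<eta>"
  by (rule darboux.formal_parallel_unique[OF formal_parallel_gauged])

text \<open>The velocity is the derivative of the connection with respect to \<open>\<lambda>\<close>.  Differentiating the gauge
  relation, the two velocities correspond to each other up to the covariant derivative of the
  logarithmic \<open>\<lambda>\<close>-derivative of the gauge transformation, which is a constant multiple of \<open>S\<close>.  Paired
  with a parallel field, a covariant derivative becomes an ordinary one.\<close>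

lemma tangential_component_derivative:
  "\<exists>f'. has_coeff_derivative
      (\<lambda>x. 4 * fps_const \<rho> * fps_X * fps_X * inverse gauge_norm * dot3 (const_series (S x))
          (Y_series \<gamma> x)) f' x
    \<and> f' = dot3 (const_series (vector_derivative \<eta> (at x))) (Y_series \<eta> x)
         - dot3 (const_series (velocity x)) (Y_series \<gamma> x)"
proof -
  let ?S = "const_series (S x)" and ?D = "const_series (S' x)" and ?V = "const_series (velocity x)"
    and ?Y = "Y_series \<gamma> x" and ?W = "const_series (vector_derivative \<eta> (at x))"
  define r q where "r = fps_const \<rho>" and "q = qrot alpha r ?S ?Y"
  obtain Y' where Y': "has_series_derivative (Y_series \<gamma>) Y' x" and ode: "fps_X *s Y' = - crs3 ?V ?Y"
    using formal_parallel_Y_series[unfolded formal_parallel_def, rule_format, of x] by auto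
  define d where "d = dot3 ?D ?Y + dot3 ?S Y'"
  have Xd: "fps_X * d = fps_X * dot3 ?D ?Y - dot3 ?S (crs3 ?V ?Y)"
    using arg_cong[OF ode, of "dot3 ?S"] by (simp add: d_def dot3_linear distrib_left)
  have ac: "alpha - fps_const c = 2 * fps_X" by (simp add: alpha_def)
  have "2 * dot3 ?W q - gauge_norm * (2 * dot3 ?V ?Y)
    = 2 * r * (2 * fps_X) * (2 * fps_X * dot3 ?D ?Y - 2 * dot3 ?S (crs3 ?V ?Y))"
    using darboux_inner[where \<alpha> = alpha and Y = ?Y, OF series_hypotheses[of x]]
    unfolding series_velocity_\<eta>[symmetric] ac gauge_norm_def[symmetric]
    unfolding r_def[symmetric] q_def[symmetric]
    by (simp only: dot3_linear crs3_linear)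
  also have "\<dots> = 2 * (4 * r * fps_X * (fps_X * d))" unfolding Xd by (simp add: algebra_simps)
  finally have "2 * (dot3 ?W q - gauge_norm * dot3 ?V ?Y) = 2 * (4 * r * fps_X * (fps_X * d))"
    by (simp add: algebra_simps)
  then have eq: "dot3 ?W q - gauge_norm * dot3 ?V ?Y = 4 * r * fps_X * (fps_X * d)"
    by (simp only: mult_cancel_left) simp
  have "dot3 ?W (Y_series \<eta> x) - dot3 ?V ?Y
    = inverse gauge_norm * dot3 ?W q - (inverse gauge_norm * gauge_norm) * dot3 ?V ?Y"
    unfolding gauge_norm_inverse gauged_eq[symmetric] gauged_def q_def r_def
        by (simp only: dot3_linear mult_1_left)
  also have "\<dots> = inverse gauge_norm * (dot3 ?W q - gauge_norm * dot3 ?V ?Y)"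
      by (simp add: algebra_simps)
  also have "\<dots> = 4 * r * fps_X * fps_X * inverse gauge_norm * d" unfolding eq by (simp add: mult_ac)
  finally have e: "4 * r * fps_X * fps_X * inverse gauge_norm * d = dot3 ?W (Y_series \<eta> x)
      - dot3 ?V ?Y" by simp
  have "has_coeff_derivative (\<lambda>x. 4 * r * fps_X * fps_X * inverse gauge_norm * dot3 (const_series (S
      x)) (Y_series \<gamma> x))
    (4 * r * fps_X * fps_X * inverse gauge_norm * d) x"
    unfolding d_def by (intro has_coeff_derivative_cmult has_series_derivative_dot3
        has_series_derivative_S Y')
  with e show ?thesis unfolding r_def by blast
qed

lemma tangential_integral:
  "integral {x0..\<tau> x0} (\<lambda>x. vector_derivative \<eta> (at x) \<bullet> Y_field \<eta> n x)
    = integral {x0..\<tau> x0} (\<lambda>x. velocity x \<bullet> Y_field \<gamma> n x)"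
proof -
  define \<Phi> where "\<Phi> x = 4 * fps_const \<rho> * fps_X * fps_X * inverse gauge_norm * dot3 (const_series (S
      x)) (Y_series \<gamma> x)" for x
  show ?thesis
  proof (rule integral_eq_if_periodic_derivative[of "\<lambda>x. fps_nth (\<Phi> x) n"])
    fix x
    obtain f' where "has_coeff_derivative \<Phi> f' x"
      "f' = dot3 (const_series (vector_derivative \<eta> (at x))) (Y_series \<eta> x)
         - dot3 (const_series (velocity x)) (Y_series \<gamma> x)"
      using tangential_component_derivative[of x] unfolding \<Phi>_def[abs_def] by blast
    then show "((\<lambda>x. fps_nth (\<Phi> x) n) has_real_derivative
      vector_derivative \<eta> (at x) \<bullet> Y_field \<eta> n x - velocity x \<bullet> Y_field \<gamma> n x) (at x)"
      by (simp add: has_coeff_derivative_def dot3_const_series_nth)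
    have "dot3 (const_series (S (\<tau> x))) (Y_series \<gamma> (\<tau> x)) = dot3 (const_series (S x)) (Y_series \<gamma> x)"
      by (rule dot3_translate) (simp_all add: series_coeff_const_series S_translate
          Y_field_translate rot_part_linear)
    then show "fps_nth (\<Phi> (\<tau> x)) n = fps_nth (\<Phi> x) n" by (simp add: \<Phi>_def)
  qed
qed

lemma E_nonneg_\<eta>:
  assumes "k' \<noteq> 2"
  shows "E_nonneg \<tau> x0 k' \<eta> = E_nonneg \<tau> x0 k' \<gamma>"
proof (cases "k' \<ge> 3")
  case True
  have "arc_integral \<tau> x0 \<eta> (\<lambda>x. fps_nth (E_integrand \<eta> x) (k' - 2))
    = arc_integral \<tau> x0 \<gamma> (\<lambda>x. fps_nth (E_integrand \<gamma> x) (k' - 2))"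
    using True by (simp add: arc_integral_E_integrand darboux.arc_integral_E_integrand
        tangential_integral)
  then show ?thesis
    using True by (simp add: E_nonneg_def E_generating_def mult.assoc fps_X_power_mult_nth)
next
  case False
  with assms have "k' = 0 \<or> k' = 1" by linarith
  then show ?thesis by (auto simp: E_nonneg_def arc_integral_def speed_\<eta>)
qed

end

theorem theorem14:
  fixes \<tau> :: "real \<Rightarrow> real" and x0 :: real
    and A :: mat2 and a :: R3
    and \<gamma> \<eta>p \<eta>m :: "real \<Rightarrow> R3"
    and \<mu> :: complex and F :: "real \<Rightarrow> mat2"
    and wp wm :: "complex ^ 2"
  assumes "translation_diffeo \<tau>"
    and "A \<in> SU2"
    and "\<gamma> \<in> immersed_curves \<tau> A a"
    and "\<mu> \<notin> \<real>"
    and "is_frame \<gamma> x0 \<mu> F"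
    and "fixed_points_at_infinity (monodromy_matrix \<tau> A x0 F) = {ideal_point wp, ideal_point wm}"
    and "ideal_point wp \<noteq> ideal_point wm"
    and "\<eta>p = (\<lambda>x. \<gamma> x + (Im \<mu> / (cmod \<mu>)\<^sup>2) *\<^sub>R ideal_map F wp x)"
    and "\<eta>m = (\<lambda>x. \<gamma> x + (Im \<mu> / (cmod \<mu>)\<^sup>2) *\<^sub>R ideal_map F wm x)"
  shows "\<forall>\<eta>\<in>{\<eta>p, \<eta>m}.
      darboux_transform \<gamma> \<eta> \<and>
      \<eta> \<in> immersed_curves \<tau> A a \<and>
      (\<exists>r. \<forall>x. dist (\<eta> x) (\<gamma> x) = r) \<and>
      (\<forall>x. speed \<eta> x = speed \<gamma> x) \<and>
      (\<forall>b v. is_axis A a b v \<longrightarrow>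
         E_minus2 \<tau> x0 b v \<eta> = E_minus2 \<tau> x0 b v \<gamma> \<and>
         E_minus1 \<tau> x0 b v \<eta> = E_minus1 \<tau> x0 b v \<gamma>) \<and>
      (\<forall>\<nu> \<nu>'. unit_normal_field \<tau> A \<gamma> \<nu> \<and> unit_normal_field \<tau> A \<eta> \<nu>' \<longrightarrow>
         [E_two \<tau> x0 \<nu>' \<eta> = E_two \<tau> x0 \<nu> \<gamma>] (rmod (2 * pi))) \<and>
      (\<forall>k. k \<noteq> 2 \<longrightarrow> E_nonneg \<tau> x0 k \<eta> = E_nonneg \<tau> x0 k \<gamma>)"
proof
  interpret equivariant_curve \<tau> A a \<gamma> using assms(1-3) by unfold_locales
  fix \<zeta> assume "\<zeta> \<in> {\<eta>p, \<eta>m}"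
  then obtain w where w: "ideal_point w \<in> fixed_points_at_infinity (monodromy_matrix \<tau> A x0 F)"
    and \<zeta>: "\<zeta> = (\<lambda>x. \<gamma> x + (Im \<mu> / (cmod \<mu>)\<^sup>2) *\<^sub>R ideal_map F w x)"
    using assms(6,8,9) by auto
  define S where "S = ideal_map F w"
  define \<rho> c where "\<rho> = Im \<mu> / (cmod \<mu>)\<^sup>2" and "c = - (Re \<mu> / (cmod \<mu>)\<^sup>2)"
  define S' where "S' x = - (2 * Im \<mu>) *\<^sub>R (velocity x - (velocity x \<bullet> S x) *\<^sub>R S x)
      - (2 * Re \<mu>) *\<^sub>R (velocity x \<times> S x)" for x
  note S = ideal_map_properties[OF assms(5) velocity_nonzero SU2 translation_has_derivative[OF translation]
      velocity_translate w, folded S_def]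
  have Im: "Im \<mu> \<noteq> 0" using assms(4) complex_is_Real_iff by blast
  then have m: "(cmod \<mu>)\<^sup>2 \<noteq> 0" by auto
  interpret darboux_direction \<tau> A a \<gamma> c \<rho> S S'
  proof unfold_locales
    show "\<rho> \<noteq> 0" using Im m by (simp add: \<rho>_def)
    fix x
    show "S x \<bullet> S x = 1" using S(1)[of x] by (simp add: dot_square_norm)
    show "(S has_vector_derivative S' x) (at x)" unfolding S'_def by (rule S(2))
    show "S (\<tau> x) = rot_part A (S x)" by (rule S(3))
    have k: "c * c + \<rho> * \<rho> = 1 / (cmod \<mu>)\<^sup>2"
    proof -
      have "c * c + \<rho> * \<rho> = ((Re \<mu>)\<^sup>2 + (Im \<mu>)\<^sup>2) / ((cmod \<mu>)\<^sup>2 * (cmod \<mu>)\<^sup>2)"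
        unfolding c_def \<rho>_def by (simp add: power2_eq_square add_divide_distrib)
      moreover have "M / (M * M) = 1 / M" if "M \<noteq> 0" for M :: real using that by simp
      ultimately show ?thesis unfolding cmod_power2[symmetric] using m by metis
    qed
    show "(c * c + \<rho> * \<rho>) *\<^sub>R S' x
      = (- 2 * \<rho>) *\<^sub>R (velocity x - (velocity x \<bullet> S x) *\<^sub>R S x) + (2 * c) *\<^sub>R (velocity x \<times> S x)"
      unfolding k S'_def scaleR_diff_right[of "1 / (cmod \<mu>)\<^sup>2"] scaleR_scaleR
      by (simp add: c_def \<rho>_def)
  qed
  have e: "\<eta> = \<zeta>" unfolding \<zeta> S_def[symmetric] \<rho>_def[symmetric] by (rule ext) (rule \<eta>_def)
  show "darboux_transform \<gamma> \<zeta> \<and>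
      \<zeta> \<in> immersed_curves \<tau> A a \<and>
      (\<exists>r. \<forall>x. dist (\<zeta> x) (\<gamma> x) = r) \<and>
      (\<forall>x. speed \<zeta> x = speed \<gamma> x) \<and>
      (\<forall>b v. is_axis A a b v \<longrightarrow>
         E_minus2 \<tau> x0 b v \<zeta> = E_minus2 \<tau> x0 b v \<gamma> \<and>
         E_minus1 \<tau> x0 b v \<zeta> = E_minus1 \<tau> x0 b v \<gamma>) \<and>
      (\<forall>\<nu> \<nu>'. unit_normal_field \<tau> A \<gamma> \<nu> \<and> unit_normal_field \<tau> A \<zeta> \<nu>' \<longrightarrow>
         [E_two \<tau> x0 \<nu>' \<zeta> = E_two \<tau> x0 \<nu> \<gamma>] (rmod (2 * pi))) \<and>
      (\<forall>k. k \<noteq> 2 \<longrightarrow> E_nonneg \<tau> x0 k \<zeta> = E_nonneg \<tau> x0 k \<gamma>)"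
    using darboux_transform_\<eta> \<eta>_immersed dist_\<eta> speed_\<eta> E_minus1_\<eta> E_minus2_\<eta> E_two_\<eta> E_nonneg_\<eta>
    unfolding e by blast
qed

end
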